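(* Let $n\ge 1$, let $k$ be a field, and let $\Lambda$ be the path algebra over $k$ of the quiver $1\leftarrow 2\leftarrow\cdots\leftarrow n$ of Dynkin type $A_n$. Let $\overline{\mathcal E}=\mathcal E/\!\sim$ be the set of equivalence classes of complete exceptional sequences in $\mathcal D^b(\mathrm{mod}\,\Lambda)$. Then the assignment $$\epsilon=(E_1,E_2,\dots,E_n)\ \longmapsto\ \Phi(\epsilon):=\{\Phi(E_i)\mid 1\le i\le n\}$$ gives a well-defined bijection from $\overline{\mathcal E}$ to the set of non-crossing spanning trees on the circle with $n+1$ points.
   Context: $\mathrm{mod}\,\Lambda$ is the category of finitely generated right $\Lambda$-modules, identified with finite-dimensional representations over $k$ of the quiver $1\leftarrow 2\leftarrow\cdots\leftarrow n$ (one arrow $a+1\to a$ for each $1\le a\le n-1$). $\mathcal D^b(\mathrm{mod}\,\Lambda)$ is its bounded derived category with shift functor $\Sigma$; $\mathrm{Hom}$ between objects means $\mathrm{Hom}$ in this category. Exceptional sequences. An object $E$ of $\mathcal D^b(\mathrm{mod}\,\Lambda)$ is exceptional if $\mathrm{Hom}(E,E)\cong k$ and $\mathrm{Hom}(\Sigma^l E,E)=0$ for all integers $l\ne 0$. A pair $(E,F)$ of exceptional objects is an exceptional pair if $\mathrm{Hom}(\Sigma^l F,E)=0$ for all integers $l$. A sequence $(E_1,\dots,E_r)$ of exceptional objects is an exceptional sequence of length $r$ if $(E_i,E_j)$ is an exceptional pair for all $i<j$. It is complete if $r=n$ (the number of simple $\Lambda$-modules). $\mathcal E$ denotes the set of complete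 exceptional sequences in $\mathcal D^b(\mathrm{mod}\,\Lambda)$. For $\epsilon=(E_1,\dots,E_n)$ and $\epsilon'=(E_1',\dots,E_n')$ in $\mathcal E$, write $\epsilon\sim\epsilon'$ if there are a permutation $\sigma$ of $\{1,\dots,n\}$ and integers $l_1,\dots,l_n$ with $E_i\cong\Sigma^{l_i}E'_{\sigma(i)}$ for every $i$. Indecomposables. For $0\le i<j\le n$, $X_{i,j}$ is the indecomposable representation with $k$ at the vertices $i+1,\dots,j$, zero at the other vertices, and identity maps between neighbouring copies of $k$. The $X_{i,j}$ represent all isomorphism classes of indecomposable $\Lambda$-modules. Exceptional objects of $\mathcal D^b(\mathrm{mod}\,\Lambda)$ are exactly the indecomposable objects, and every indecomposable object is isomorphic to $\Sigma^l X_{i,j}$ for a unique integer $l$ and unique $i<j$. Chords. Place $n+1$ distinct points labelled $0,1,\dots,n$ counterclockwise on a circle. For $i\neq j$, $c(i,j)=c(j,i)$ is the chord (straight segment) joining $i$ and $j$, and $C_{n+1}$ is the set of all such chords. The map $\Phi$ from indecomposable objects to $C_{n+1}$ is $\Phi(\Sigma^l X_{i,j})=c(i,j)$ for all $l\in\mathbb Z$. A set $T$ of $n$ chords in $C_{n+1}$ is a non-crossing spanning tree if its chords form a tree, i.e. no two distinct chords of $T$ meet in the interior of the circle, and the graph with vertex set $\{0,1,\dots,n\}$ and edge set $T$ is a tree (connected and without cycles). *)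

theory Defs
  imports
    "HOL-Analysis.Line_Segment"
    "HOL-Combinatorics.Permutations"
    "Jordan_Normal_Form.Matrix"
begin

section \<open>Representations of the quiver \<open>1 \<leftarrow> 2 \<leftarrow> \<dots> \<leftarrow> n\<close>\<close>

text \<open>
  The category \<open>mod \<Lambda>\<close> is identified with the finite-dimensional representations of the quiver
  over the field \<open>'k\<close>. The space at vertex \<open>a\<close> is \<open>k^d\<close> with \<open>d = rdim V a\<close>, and linear maps are
  matrices acting on column vectors.

  Vertices are indexed by all of \<open>nat\<close>, but the space is required to be zero off \<open>{1..n}\<close>. As
  there is exactly one matrix with a zero dimension, the matrices attached to the additional
  vertices and arrows carry no information, and equality of morphisms is plain equality of functions.
\<close>

record 'k rep =
  rdim :: "nat \<Rightarrow> nat"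
  rarr :: "nat \<Rightarrow> 'k mat"  \<comment> \<open>\<open>rarr V a\<close> is the map from the space at \<open>a + 1\<close> to the one at \<open>a\<close>\<close>

type_synonym 'k repmap = "nat \<Rightarrow> 'k mat"

definition is_rep :: "nat \<Rightarrow> 'k::field rep \<Rightarrow> bool" where
  "is_rep n V \<longleftrightarrow>
     (\<forall>a. a \<notin> {1..n} \<longrightarrow> rdim V a = 0) \<and>
     (\<forall>a. rarr V a \<in> carrier_mat (rdim V a) (rdim V (a + 1)))"

definition is_repmap :: "'k::field rep \<Rightarrow> 'k rep \<Rightarrow> 'k repmap \<Rightarrow> bool" where
  "is_repmap V W f \<longleftrightarrow>
     (\<forall>a. f a \<in> carrier_mat (rdim W a) (rdim V a)) \<and>
     (\<forall>a. f a * rarr V a = rarr W a * f (a + 1))"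

definition zero_rep :: "'k::field rep" where
  "zero_rep = \<lparr>rdim = (\<lambda>_. 0), rarr = (\<lambda>_. 0\<^sub>m 0 0)\<rparr>"

definition X_dim :: "nat \<Rightarrow> nat \<Rightarrow> nat \<Rightarrow> nat" where
  "X_dim i j a = (if i < a \<and> a \<le> j then 1 else 0)"

text \<open>
  The indecomposable \<open>X\<^sub>i\<^sub>,\<^sub>j\<close>. Between neighbouring one-dimensional spaces the all-ones matrix below
  is the identity; every other arrow matrix is empty.
\<close>

definition X_rep :: "nat \<Rightarrow> nat \<Rightarrow> 'k::field rep" where
  "X_rep i j = \<lparr>rdim = X_dim i j,
                rarr = (\<lambda>a. mat (X_dim i j a) (X_dim i j (a + 1)) (\<lambda>_. 1))\<rparr>"


section \<open>Bounded complexes\<close>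

record 'k cpx =
  obj :: "int \<Rightarrow> 'k rep"
  diff :: "int \<Rightarrow> 'k repmap"  \<comment> \<open>cohomological grading: \<open>diff X i\<close> maps degree \<open>i\<close> to degree \<open>i + 1\<close>\<close>

type_synonym 'k cmap = "int \<Rightarrow> 'k repmap"

definition is_cpx :: "nat \<Rightarrow> 'k::field cpx \<Rightarrow> bool" where
  "is_cpx n X \<longleftrightarrow>
     (\<forall>i. is_rep n (obj X i)) \<and>
     (\<forall>i. is_repmap (obj X i) (obj X (i + 1)) (diff X i)) \<and>
     (\<forall>i a. diff X (i + 1) a * diff X i a = 0\<^sub>m (rdim (obj X (i + 1 + 1)) a) (rdim (obj X i) a)) \<and>
     finite {i. \<exists>a. rdim (obj X i) a \<noteq> 0}"

definition chain_map :: "'k::field cpx \<Rightarrow> 'k cpx \<Rightarrow> 'k cmap \<Rightarrow> bool" where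
  "chain_map X Y f \<longleftrightarrow>
     (\<forall>i. is_repmap (obj X i) (obj Y i) (f i)) \<and>
     (\<forall>i a. diff Y i a * f i a = f (i + 1) a * diff X i a)"

definition cmap_id :: "'k::field cpx \<Rightarrow> 'k cmap" where
  "cmap_id X = (\<lambda>i a. 1\<^sub>m (rdim (obj X i) a))"

definition cmap_zero :: "'k::field cpx \<Rightarrow> 'k cpx \<Rightarrow> 'k cmap" where
  "cmap_zero X Y = (\<lambda>i a. 0\<^sub>m (rdim (obj Y i) a) (rdim (obj X i) a))"

definition cmap_comp :: "'k::field cmap \<Rightarrow> 'k cmap \<Rightarrow> 'k cmap" where
  "cmap_comp g f = (\<lambda>i a. g i a * f i a)"

definition cmap_add :: "'k::field cmap \<Rightarrow> 'k cmap \<Rightarrow> 'k cmap" where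
  "cmap_add f g = (\<lambda>i a. f i a + g i a)"

definition cmap_smult :: "'k::field \<Rightarrow> 'k cmap \<Rightarrow> 'k cmap" where
  "cmap_smult c f = (\<lambda>i a. c \<cdot>\<^sub>m f i a)"

definition homotopic :: "'k::field cpx \<Rightarrow> 'k cpx \<Rightarrow> 'k cmap \<Rightarrow> 'k cmap \<Rightarrow> bool" where
  "homotopic X Y f g \<longleftrightarrow>
     (\<exists>h :: 'k cmap.
        (\<forall>i. is_repmap (obj X i) (obj Y (i - 1)) (h i)) \<and>
        (\<forall>i a. f i a - g i a = diff Y (i - 1) a * h i a + h (i + 1) a * diff X i a))"

text \<open>The cohomology \<open>H\<^sup>i(X)\<close>, given by its underlying quotient spaces at the vertices.\<close>

definition cocycles :: "'k::field cpx \<Rightarrow> int \<Rightarrow> nat \<Rightarrow> 'k vec set" where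
  "cocycles X i a =
     {v \<in> carrier_vec (rdim (obj X i) a). diff X i a *\<^sub>v v = 0\<^sub>v (rdim (obj X (i + 1)) a)}"

definition coboundaries :: "'k::field cpx \<Rightarrow> int \<Rightarrow> nat \<Rightarrow> 'k vec set" where
  "coboundaries X i a = (\<lambda>w. diff X (i - 1) a *\<^sub>v w) ` carrier_vec (rdim (obj X (i - 1)) a)"

definition cohomologous :: "'k::field cpx \<Rightarrow> int \<Rightarrow> nat \<Rightarrow> 'k vec rel" where
  "cohomologous X i a =
     {(v, w). v \<in> cocycles X i a \<and> w \<in> cocycles X i a \<and> v - w \<in> coboundaries X i a}"

definition cohomology :: "'k::field cpx \<Rightarrow> int \<Rightarrow> nat \<Rightarrow> 'k vec set set" where
  "cohomology X i a = cocycles X i a // cohomologous X i a"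

definition cohomology_map ::
  "'k::field cpx \<Rightarrow> 'k cmap \<Rightarrow> int \<Rightarrow> nat \<Rightarrow> 'k vec set \<Rightarrow> 'k vec set" where
  "cohomology_map Y f i a C = cohomologous Y i a `` ((\<lambda>v. f i a *\<^sub>v v) ` C)"

definition quasi_iso :: "'k::field cpx \<Rightarrow> 'k cpx \<Rightarrow> 'k cmap \<Rightarrow> bool" where
  "quasi_iso X Y f \<longleftrightarrow>
     chain_map X Y f \<and>
     (\<forall>i a. bij_betw (cohomology_map Y f i a) (cohomology X i a) (cohomology Y i a))"

definition shift :: "int \<Rightarrow> 'k::field cpx \<Rightarrow> 'k cpx" where
  "shift l X = \<lparr>obj = (\<lambda>i. obj X (i + l)),
                diff = (\<lambda>i a. if even l then diff X (i + l) a else - diff X (i + l) a)\<rparr>"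

definition stalk :: "'k::field rep \<Rightarrow> 'k cpx" where
  "stalk V =
     (let ob = (\<lambda>i::int. if i = 0 then V else zero_rep)
      in \<lparr>obj = ob, diff = (\<lambda>i a. 0\<^sub>m (rdim (ob (i + 1)) a) (rdim (ob i) a))\<rparr>)"


section \<open>The bounded derived category\<close>

text \<open>
  The localisation of the bounded homotopy category at the quasi-isomorphisms. A morphism
  from \<open>X\<close> to \<open>Y\<close> is an equivalence class of roofs \<open>X \<leftarrow> Z \<rightarrow> Y\<close> (with \<open>s : Z \<rightarrow> X\<close> a
  quasi-isomorphism and \<open>f : Z \<rightarrow> Y\<close>), two roofs being equivalent if they are dominated,
  up to homotopy, by a common third one.
\<close>

type_synonym 'k roof = "'k cpx \<times> 'k cmap \<times> 'k cmap"

definition roofs :: "nat \<Rightarrow> 'k::field cpx \<Rightarrow> 'k cpx \<Rightarrow> 'k roof set" where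
  "roofs n X Y = {(Z, s, f). is_cpx n Z \<and> quasi_iso Z X s \<and> chain_map Z Y f}"

definition roof_rel :: "nat \<Rightarrow> 'k::field cpx \<Rightarrow> 'k cpx \<Rightarrow> 'k roof rel" where
  "roof_rel n X Y =
     {((Z, s, f), (Z', s', f')).
        (Z, s, f) \<in> roofs n X Y \<and> (Z', s', f') \<in> roofs n X Y \<and>
        (\<exists>W u u'. is_cpx n W \<and> chain_map W Z u \<and> chain_map W Z' u' \<and>
           quasi_iso W X (cmap_comp s u) \<and>
           homotopic W X (cmap_comp s u) (cmap_comp s' u') \<and>
           homotopic W Y (cmap_comp f u) (cmap_comp f' u'))}"

definition roof_class :: "nat \<Rightarrow> 'k::field cpx \<Rightarrow> 'k cpx \<Rightarrow> 'k roof \<Rightarrow> 'k roof set" where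
  "roof_class n X Y r = roof_rel n X Y `` {r}"

definition D_hom :: "nat \<Rightarrow> 'k::field cpx \<Rightarrow> 'k cpx \<Rightarrow> 'k roof set set" where
  "D_hom n X Y = roofs n X Y // roof_rel n X Y"

definition D_id :: "nat \<Rightarrow> 'k::field cpx \<Rightarrow> 'k roof set" where
  "D_id n X = roof_class n X X (X, cmap_id X, cmap_id X)"

definition D_zero :: "nat \<Rightarrow> 'k::field cpx \<Rightarrow> 'k cpx \<Rightarrow> 'k roof set" where
  "D_zero n X Y = roof_class n X Y (X, cmap_id X, cmap_zero X Y)"

text \<open>
  Sums, scalar multiples and composites of morphisms are computed on representatives. Each union
  below runs over all admissible choices of representatives, which all yield the same class.
  A sum uses representatives with a common denominator; a composite uses an Ore completion \<open>U\<close>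
  of the inner legs \<open>f : Z \<rightarrow> Y\<close> and \<open>t : W \<rightarrow> Y\<close>.
\<close>

definition D_add ::
  "nat \<Rightarrow> 'k::field cpx \<Rightarrow> 'k cpx \<Rightarrow> 'k roof set \<Rightarrow> 'k roof set \<Rightarrow> 'k roof set" where
  "D_add n X Y \<alpha> \<beta> =
     \<Union>{roof_class n X Y (Z, s, cmap_add f g) | Z s f g. (Z, s, f) \<in> \<alpha> \<and> (Z, s, g) \<in> \<beta>}"

definition D_smult ::
  "nat \<Rightarrow> 'k::field cpx \<Rightarrow> 'k cpx \<Rightarrow> 'k \<Rightarrow> 'k roof set \<Rightarrow> 'k roof set" where
  "D_smult n X Y c \<alpha> =
     \<Union>{roof_class n X Y (Z, s, cmap_smult c f) | Z s f. (Z, s, f) \<in> \<alpha>}"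

definition D_comp ::
  "nat \<Rightarrow> 'k::field cpx \<Rightarrow> 'k cpx \<Rightarrow> 'k cpx \<Rightarrow> 'k roof set \<Rightarrow> 'k roof set \<Rightarrow> 'k roof set" where
  "D_comp n X Y V \<beta> \<alpha> =
     \<Union>{roof_class n X V (U, cmap_comp s u, cmap_comp g v) | Z s f W t g U u v.
          (Z, s, f) \<in> \<alpha> \<and> (W, t, g) \<in> \<beta> \<and>
          is_cpx n U \<and> quasi_iso U Z u \<and> chain_map U W v \<and>
          homotopic U Y (cmap_comp f u) (cmap_comp t v)}"

definition D_iso :: "nat \<Rightarrow> 'k::field cpx \<Rightarrow> 'k cpx \<Rightarrow> bool" where
  "D_iso n X Y \<longleftrightarrow>
     (\<exists>\<alpha> \<in> D_hom n X Y. \<exists>\<beta> \<in> D_hom n Y X.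
        D_comp n X Y X \<beta> \<alpha> = D_id n X \<and> D_comp n Y X Y \<alpha> \<beta> = D_id n Y)"

definition D_hom_is_zero :: "nat \<Rightarrow> 'k::field cpx \<Rightarrow> 'k cpx \<Rightarrow> bool" where
  "D_hom_is_zero n X Y \<longleftrightarrow> D_hom n X Y = {D_zero n X Y}"

text \<open>\<open>Hom(X, Y) \<cong> k\<close> as vector spaces over \<open>k\<close>.\<close>

definition D_hom_iso_field :: "nat \<Rightarrow> 'k::field cpx \<Rightarrow> 'k cpx \<Rightarrow> bool" where
  "D_hom_iso_field n X Y \<longleftrightarrow>
     (\<exists>\<phi> :: 'k \<Rightarrow> 'k roof set.
        bij_betw \<phi> UNIV (D_hom n X Y) \<and>
        (\<forall>a b. \<phi> (a + b) = D_add n X Y (\<phi> a) (\<phi> b)) \<and>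
        (\<forall>c a. \<phi> (c * a) = D_smult n X Y c (\<phi> a)))"


section \<open>Exceptional sequences\<close>

definition exceptional :: "nat \<Rightarrow> 'k::field cpx \<Rightarrow> bool" where
  "exceptional n E \<longleftrightarrow>
     is_cpx n E \<and> D_hom_iso_field n E E \<and> (\<forall>l. l \<noteq> 0 \<longrightarrow> D_hom_is_zero n (shift l E) E)"

definition exceptional_pair :: "nat \<Rightarrow> 'k::field cpx \<Rightarrow> 'k cpx \<Rightarrow> bool" where
  "exceptional_pair n E F \<longleftrightarrow>
     exceptional n E \<and> exceptional n F \<and> (\<forall>l. D_hom_is_zero n (shift l F) E)"

definition exceptional_seq :: "nat \<Rightarrow> 'k::field cpx list \<Rightarrow> bool" where
  "exceptional_seq n Es \<longleftrightarrow>
     (\<forall>E \<in> set Es. exceptional n E) \<and>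
     (\<forall>i j. i < j \<and> j < length Es \<longrightarrow> exceptional_pair n (Es ! i) (Es ! j))"

definition complete_exceptional_seqs :: "nat \<Rightarrow> 'k::field cpx list set" where
  "complete_exceptional_seqs n = {Es. exceptional_seq n Es \<and> length Es = n}"

definition exceptional_seq_rel :: "nat \<Rightarrow> 'k::field cpx list rel" where
  "exceptional_seq_rel n =
     {(Es, Es'). Es \<in> complete_exceptional_seqs n \<and> Es' \<in> complete_exceptional_seqs n \<and>
        (\<exists>\<sigma> (l :: nat \<Rightarrow> int). \<sigma> permutes {..<n} \<and>
           (\<forall>i<n. D_iso n (Es ! i) (shift (l i) (Es' ! \<sigma> i))))}"


section \<open>Chords and non-crossing spanning trees\<close>

definition ccw_on_circle :: "complex \<Rightarrow> real \<Rightarrow> nat \<Rightarrow> (nat \<Rightarrow> complex) \<Rightarrow> bool" where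
  "ccw_on_circle z r n p \<longleftrightarrow>
     r > 0 \<and>
     (\<exists>\<theta> :: nat \<Rightarrow> real. strict_mono_on {0..n} \<theta> \<and> \<theta> n < \<theta> 0 + 2 * pi \<and>
        (\<forall>a\<le>n. p a = z + complex_of_real r * cis (\<theta> a)))"

definition chord :: "(nat \<Rightarrow> complex) \<Rightarrow> nat \<Rightarrow> nat \<Rightarrow> complex set" where
  "chord p i j = closed_segment (p i) (p j)"

definition chords :: "nat \<Rightarrow> (nat \<Rightarrow> complex) \<Rightarrow> complex set set" where
  "chords n p = {chord p i j | i j. i \<le> n \<and> j \<le> n \<and> i \<noteq> j}"

definition chord_adj :: "nat \<Rightarrow> (nat \<Rightarrow> complex) \<Rightarrow> complex set set \<Rightarrow> nat rel" where
  "chord_adj n p T = {(i, j). i \<le> n \<and> j \<le> n \<and> i \<noteq> j \<and> chord p i j \<in> T}"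

text \<open>
  A cycle in an undirected graph, given by a symmetric irreflexive relation: at least three
  distinct vertices, consecutive ones being adjacent cyclically. (The notions of
  \<open>Graph_Theory\<close> are not usable here, since a symmetric digraph has the directed cycle
  \<open>u \<rightarrow> v \<rightarrow> u\<close> for each edge.)
\<close>

definition has_cycle :: "nat rel \<Rightarrow> bool" where
  "has_cycle A \<longleftrightarrow>
     (\<exists>vs. length vs \<ge> 3 \<and> distinct vs \<and>
        successively (\<lambda>u v. (u, v) \<in> A) vs \<and> (last vs, hd vs) \<in> A)"

definition graph_is_tree :: "nat set \<Rightarrow> nat rel \<Rightarrow> bool" where
  "graph_is_tree V A \<longleftrightarrow> (\<forall>u \<in> V. \<forall>v \<in> V. (u, v) \<in> A\<^sup>*) \<and> \<not> has_cycle A"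

definition noncrossing_spanning_trees ::
  "complex \<Rightarrow> real \<Rightarrow> nat \<Rightarrow> (nat \<Rightarrow> complex) \<Rightarrow> complex set set set" where
  "noncrossing_spanning_trees z r n p =
     {T. T \<subseteq> chords n p \<and> card T = n \<and>
         (\<forall>C \<in> T. \<forall>C' \<in> T. C \<noteq> C' \<longrightarrow> C \<inter> C' \<inter> ball z r = {}) \<and>
         graph_is_tree {0..n} (chord_adj n p T)}"


section \<open>The map \<open>\<Phi>\<close>\<close>

definition is_Phi :: "nat \<Rightarrow> (nat \<Rightarrow> complex) \<Rightarrow> 'k::field cpx \<Rightarrow> complex set \<Rightarrow> bool" where
  "is_Phi n p E C \<longleftrightarrow>
     (\<exists>i j l. i < j \<and> j \<le> n \<and> D_iso n E (shift l (stalk (X_rep i j))) \<and> C = chord p i j)"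

definition Phi :: "nat \<Rightarrow> (nat \<Rightarrow> complex) \<Rightarrow> 'k::field cpx \<Rightarrow> complex set" where
  "Phi n p E = (THE C. is_Phi n p E C)"

definition Phi_seq :: "nat \<Rightarrow> (nat \<Rightarrow> complex) \<Rightarrow> 'k::field cpx list \<Rightarrow> complex set set" where
  "Phi_seq n p Es = Phi n p ` set Es"

end

theory Submission
  imports Defs "HOL-Library.Function_Algebras" "HOL-Number_Theory.Cong" "HOL-Analysis.Starlike"
begin

text \<open>
  Every bounded complex is quasi-isomorphic to a direct sum of two-term complexes of projectives
  \<open>P\<^sub>i \<rightarrow> P\<^sub>j\<close>, the resolutions of the shifted \<open>X\<^sub>i\<^sub>,\<^sub>j\<close>: a nonzero class at the topmost vertex in
  the support of the cohomology generates an interval submodule that is injective among the modules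
  with this support, so it splits off. These complexes are K-projective, which turns morphisms in the derived category into
  homotopy classes of chain maps. Hence an exceptional object is a shift of some \<open>X\<^sub>i\<^sub>,\<^sub>j\<close>, and
  \<open>Hom(\<Sigma>\<^sup>s X\<^sub>i\<^sub>,\<^sub>j, X\<^sub>a\<^sub>,\<^sub>b)\<close> is nonzero for some \<open>s\<close> if and only if exactly one of \<open>i\<close>, \<open>j\<close> lies in
  \<open>{a<..b}\<close>. So crossing chords have nonzero \<open>Hom\<close> in both directions, chords with a common end
  point in exactly one, and disjoint chords in none. Following the membership in \<open>{a<..b}\<close> around a
  cycle, with \<open>(a, b)\<close> its first chord, shows that the chords of an exceptional sequence form a
  forest; conversely the chords of a non-crossing tree can be
  ordered by inserting one leaf after the other.
\<close>

section \<open>Homotopy of chain maps\<close>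

text \<open>The algebra is hereditary: with \<open>P_j\<close> for the projective
  \<open>X_rep 0 j\<close>, the sequence \<open>0 \<rightarrow> P_i \<rightarrow> P_j \<rightarrow>
  X_i,j \<rightarrow> 0\<close> is exact, so two terms resolve every indecomposable.
  \<open>Hom(-, X_a,b)\<close> turns it into a map between spaces that are \<open>k\<close> or zero
  according to whether \<open>j\<close> and \<open>i\<close> lie in \<open>{a<..b}\<close>,
  bijective if both do; its kernel is \<open>Hom\<close>, its cokernel \<open>Ext^1\<close>, whence
  the criterion by exactly one membership. The obstacle is that \<open>D_hom\<close>,
  \<open>D_add\<close> and \<open>D_comp\<close> are made of classes of roofs, about which neither
  transitivity nor independence of representatives is known beforehand. Evaluating each roof on a
  fixed resolution of its source settles all of this at once. The decomposition of a complex takes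
  place on its cohomology, through subspaces between coboundaries and cocycles; its terms are never
  decomposed. An exceptional object has a single summand because two of its endomorphisms are always
  linearly dependent. Completeness enters by counting: a forest with \<open>n\<close> edges on
  \<open>n + 1\<close> vertices is connected.\<close>

lemma mult_assoc_dim:
  fixes A :: "'a::semiring_0 mat"
  assumes "dim_col A = dim_row B" "dim_col B = dim_row C"
  shows "A * B * C = A * (B * C)"
  using assms by (intro assoc_mult_mat[of _ "dim_row A" "dim_col A" _ "dim_col B" _ "dim_col C"]) auto

lemma mult_assoc_dim_vec:
  fixes A :: "'a::semiring_0 mat"
  assumes "dim_col A = dim_row B" "dim_vec v = dim_col B"
  shows "A * B *\<^sub>v v = A *\<^sub>v (B *\<^sub>v v)"
  using assms assoc_mult_mat_vec[of A "dim_row A" "dim_row B" B "dim_col B" v]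
  by (metis carrier_mat_triv carrier_vec_dim_vec)

lemma add_mult_dim:
  fixes A :: "'a::semiring_0 mat"
  assumes "dim_row A = dim_row B" "dim_col A = dim_col B" "dim_col B = dim_row C"
  shows "(A + B) * C = A * C + B * C"
  using assms by (intro add_mult_distrib_mat[of _ "dim_row A" "dim_col A" _ _ "dim_col C"]) auto

lemma mult_add_dim:
  fixes A :: "'a::semiring_0 mat"
  assumes "dim_row B = dim_row C" "dim_col B = dim_col C" "dim_col A = dim_row C"
  shows "A * (B + C) = A * B + A * C"
  using assms by (intro mult_add_distrib_mat[of _ "dim_row A" "dim_col A" _ "dim_col C"]) auto

lemma minus_mult_dim:
  fixes A :: "'a::ring mat"
  assumes "dim_row A = dim_row B" "dim_col A = dim_col B" "dim_col B = dim_row C"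
  shows "(A - B) * C = A * C - B * C"
  using assms by (intro minus_mult_distrib_mat[of _ "dim_row A" "dim_col A" _ _ "dim_col C"]) auto

lemma mult_minus_dim:
  fixes A :: "'a::ring mat"
  assumes "dim_row B = dim_row C" "dim_col B = dim_col C" "dim_col A = dim_row C"
  shows "A * (B - C) = A * B - A * C"
  using assms by (intro mult_minus_distrib_mat[of _ "dim_row A" "dim_col A" _ "dim_col C"]) auto

lemma smult_mult_dim:
  fixes A :: "'a::comm_semiring_0 mat"
  assumes "dim_col A = dim_row B"
  shows "c \<cdot>\<^sub>m A * B = c \<cdot>\<^sub>m (A * B)"
  using assms by (intro mult_smult_assoc_mat[of _ "dim_row A" "dim_col A" _ "dim_col B"]) auto

lemma mult_smult_dim:
  fixes A :: "'a::comm_semiring_0 mat"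
  assumes "dim_col A = dim_row B"
  shows "A * (c \<cdot>\<^sub>m B) = c \<cdot>\<^sub>m (A * B)"
  using assms by (intro mult_smult_distrib[of _ "dim_row A" "dim_col A" _ "dim_col B"]) auto

lemma carrier_mat_iff: "A \<in> carrier_mat r c \<longleftrightarrow> dim_row A = r \<and> dim_col A = c"
  by auto

text \<open>With equations between dimensions in place of carrier hypotheses, the side conditions
  follow by rewriting with the facts on \<open>dim_row\<close> and \<open>dim_col\<close>, and no
  intermediate dimension has to be guessed.\<close>

lemmas mat_dim_simps = carrier_mat_iff mult_assoc_dim add_mult_dim mult_add_dim minus_mult_dim mult_minus_dim
  smult_mult_dim mult_smult_dim

lemma mat_add_rearrange:
  fixes A B C D :: "'a::ab_group_add mat"
  assumes "dim_row A = dim_row B" "dim_col A = dim_col B"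
  shows "dim_row C = dim_row B \<Longrightarrow> dim_row D = dim_row B \<Longrightarrow>
      dim_col C = dim_col B \<Longrightarrow> dim_col D = dim_col B \<Longrightarrow> (A + B) + (C + D) = (A + C) + (B + D)"
    "dim_row C = dim_row B \<Longrightarrow> dim_row D = dim_row B \<Longrightarrow>
      dim_col C = dim_col B \<Longrightarrow> dim_col D = dim_col B \<Longrightarrow> (A + B) - (C + D) = (A - C) + (B - D)"
    "dim_row C = dim_row B \<Longrightarrow> dim_col C = dim_col B \<Longrightarrow> A - C = (A - B) + (B - C)"
    "B - A = - (A - B)" "- (A + B) = - A + - B"
  using assms by (auto simp: mat_eq_iff)

text \<open>Includes the well-formedness of both ends: \<open>chain_map\<close> by itself fixes the
  dimensions of the components of \<open>f\<close>, but not those of the arrows and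
  differentials.\<close>

definition cmor :: "nat \<Rightarrow> 'k::field cpx \<Rightarrow> 'k cpx \<Rightarrow> 'k cmap \<Rightarrow> bool" where
  "cmor n X Y f \<longleftrightarrow> is_cpx n X \<and> is_cpx n Y \<and> chain_map X Y f"

definition chtpy :: "nat \<Rightarrow> 'k::field cpx \<Rightarrow> 'k cpx \<Rightarrow> 'k cmap \<Rightarrow> 'k cmap \<Rightarrow> bool" where
  "chtpy n X Y f g \<longleftrightarrow> cmor n X Y f \<and> cmor n X Y g \<and> homotopic X Y f g"

lemma is_repD:
  assumes "is_rep n V"
  shows "rarr V a \<in> carrier_mat (rdim V a) (rdim V (a + 1))"
    and "rarr V a \<in> carrier_mat (rdim V a) (rdim V (Suc a))"
    and "a \<notin> {1..n} \<Longrightarrow> rdim V a = 0"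
  using assms by (auto simp: is_rep_def)

lemma is_repmapD:
  assumes "is_repmap V W f"
  shows "f a \<in> carrier_mat (rdim W a) (rdim V a)"
    and "f a * rarr V a = rarr W a * f (a + 1)"
    and "f a * rarr V a = rarr W a * f (Suc a)"
  using assms by (auto simp: is_repmap_def)

lemma is_cpxD:
  assumes "is_cpx n X"
  shows "is_rep n (obj X i)"
    and "is_repmap (obj X i) (obj X (i + 1)) (diff X i)"
    and "diff X (i + 1) a * diff X i a = 0\<^sub>m (rdim (obj X (i + 1 + 1)) a) (rdim (obj X i) a)"
    and "rarr (obj X i) a \<in> carrier_mat (rdim (obj X i) a) (rdim (obj X i) (a + 1))"
    and "rarr (obj X i) a \<in> carrier_mat (rdim (obj X i) a) (rdim (obj X i) (Suc a))"
    and "diff X i a \<in> carrier_mat (rdim (obj X (i + 1)) a) (rdim (obj X i) a)"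
    and "diff X (i - 1) a \<in> carrier_mat (rdim (obj X i) a) (rdim (obj X (i - 1)) a)"
    and "diff X i a * rarr (obj X i) a = rarr (obj X (i + 1)) a * diff X i (Suc a)"
proof -
  show 1: "is_rep n (obj X i)" and 2: "is_repmap (obj X i) (obj X (i + 1)) (diff X i)"
    and "diff X (i + 1) a * diff X i a = 0\<^sub>m (rdim (obj X (i + 1 + 1)) a) (rdim (obj X i) a)" for i
    using assms by (auto simp: is_cpx_def)
  show "rarr (obj X i) a \<in> carrier_mat (rdim (obj X i) a) (rdim (obj X i) (a + 1))"
    "rarr (obj X i) a \<in> carrier_mat (rdim (obj X i) a) (rdim (obj X i) (Suc a))"
    using is_repD[OF 1] by blast+
  show "diff X i a \<in> carrier_mat (rdim (obj X (i + 1)) a) (rdim (obj X i) a)"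
    "diff X i a * rarr (obj X i) a = rarr (obj X (i + 1)) a * diff X i (Suc a)"
    using is_repmapD[OF 2] by blast+
  show "diff X (i - 1) a \<in> carrier_mat (rdim (obj X i) a) (rdim (obj X (i - 1)) a)"
    using is_repmapD(1)[OF 2, of "i - 1" a] by simp
qed

lemma chain_mapD:
  assumes "chain_map X Y f"
  shows "is_repmap (obj X i) (obj Y i) (f i)"
    and "f i a \<in> carrier_mat (rdim (obj Y i) a) (rdim (obj X i) a)"
    and "f i a * rarr (obj X i) a = rarr (obj Y i) a * f i (a + 1)"
    and "f i a * rarr (obj X i) a = rarr (obj Y i) a * f i (Suc a)"
    and "diff Y i a * f i a = f (i + 1) a * diff X i a"
  using assms by (auto simp: chain_map_def is_repmap_def)

lemma cmorD:
  assumes "cmor n X Y f"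
  shows "is_cpx n X" "is_cpx n Y" "chain_map X Y f"
  using assms by (auto simp: cmor_def)

lemma is_rep_dims:
  assumes "is_rep n V"
  shows "dim_row (rarr V a) = rdim V a" "dim_col (rarr V a) = rdim V (Suc a)"
  using is_repD[OF assms] by auto

lemma is_repmap_dims:
  assumes "is_repmap V W f"
  shows "dim_row (f a) = rdim W a" "dim_col (f a) = rdim V a"
  using is_repmapD[OF assms] by auto

lemma is_cpx_dims:
  assumes "is_cpx n X"
  shows "dim_row (rarr (obj X i) a) = rdim (obj X i) a"
    "dim_col (rarr (obj X i) a) = rdim (obj X i) (Suc a)"
    "dim_row (diff X i a) = rdim (obj X (i + 1)) a"
    "dim_col (diff X i a) = rdim (obj X i) a"
  using is_cpxD[OF assms] by (blast dest: carrier_matD)+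

lemma cmor_dims:
  assumes "cmor n X Y f"
  shows "dim_row (f i a) = rdim (obj Y i) a" "dim_col (f i a) = rdim (obj X i) a"
  using chain_mapD[OF cmorD(3)[OF assms]] by auto

lemmas cmor_facts = cmorD(1,2) chain_mapD[OF cmorD(3)]

lemma is_repmap_comp:
  assumes "is_rep n U" "is_rep n V" "is_rep n W" "is_repmap U V f" "is_repmap V W g"
  shows "is_repmap U W (\<lambda>a. g a * f a)"
proof -
  note [simp] = is_rep_dims[OF assms(1)] is_rep_dims[OF assms(2)] is_rep_dims[OF assms(3)]
    is_repmap_dims[OF assms(4)] is_repmap_dims[OF assms(5)]
  show ?thesis unfolding is_repmap_def
  proof (intro conjI allI)
    fix a
    have "g a * f a * rarr U a = g a * (f a * rarr U a)" by (simp add: mult_assoc_dim)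
    also have "\<dots> = (g a * rarr V a) * f (a + 1)"
      unfolding is_repmapD(2)[OF assms(4)] by (simp add: mult_assoc_dim)
    also have "\<dots> = rarr W a * (g (a + 1) * f (a + 1))"
      unfolding is_repmapD(2)[OF assms(5)] by (simp add: mult_assoc_dim)
    finally show "g a * f a * rarr U a = rarr W a * (g (a + 1) * f (a + 1))" .
  qed (simp add: carrier_mat_iff)
qed

lemma is_repmap_lin:
  assumes "is_rep n U" "is_rep n V" "is_repmap U V f" "is_repmap U V g"
  shows "is_repmap U V (\<lambda>a. f a + g a)" "is_repmap U V (\<lambda>a. f a - g a)"
    "is_repmap U V (\<lambda>a. c \<cdot>\<^sub>m f a)" "is_repmap U V (\<lambda>a. - f a)"
    "is_repmap U V (\<lambda>a. 0\<^sub>m (rdim V a) (rdim U a))"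
    "is_repmap U U (\<lambda>a. 1\<^sub>m (rdim U a))"
proof -
  note [simp] = is_rep_dims[OF assms(1)] is_rep_dims[OF assms(2)]
    is_repmap_dims[OF assms(3)] is_repmap_dims[OF assms(4)]
  note eqs = is_repmapD(2,3)[OF assms(3)] is_repmapD(2,3)[OF assms(4)]
  show "is_repmap U V (\<lambda>a. f a + g a)" "is_repmap U V (\<lambda>a. f a - g a)"
    "is_repmap U V (\<lambda>a. c \<cdot>\<^sub>m f a)" "is_repmap U V (\<lambda>a. - f a)"
    "is_repmap U V (\<lambda>a. 0\<^sub>m (rdim V a) (rdim U a))"
    "is_repmap U U (\<lambda>a. 1\<^sub>m (rdim U a))"
    by (auto simp: is_repmap_def mat_dim_simps eqs)
qed

lemma cmor_comp:
  assumes "cmor n X Y f" "cmor n Y Z g"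
  shows "cmor n X Z (cmap_comp g f)"
proof -
  note X = cmorD(1)[OF assms(1)] and Y = cmorD(2)[OF assms(1)] and Z = cmorD(2)[OF assms(2)]
  note [simp] = is_cpx_dims[OF X] is_cpx_dims[OF Y] is_cpx_dims[OF Z]
    cmor_dims[OF assms(1)] cmor_dims[OF assms(2)]
  have 1: "is_repmap (obj X i) (obj Z i) (cmap_comp g f i)" for i
    unfolding cmap_comp_def
    by (rule is_repmap_comp[OF is_cpxD(1)[OF X] is_cpxD(1)[OF Y] is_cpxD(1)[OF Z]
          cmor_facts(3)[OF assms(1)] cmor_facts(3)[OF assms(2)]])
  have 2: "diff Z i a * cmap_comp g f i a = cmap_comp g f (i + 1) a * diff X i a" for i a
  proof -
    have "diff Z i a * (g i a * f i a) = (diff Z i a * g i a) * f i a" by (simp add: mult_assoc_dim)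
    also have "\<dots> = g (i + 1) a * (diff Y i a * f i a)"
      unfolding cmor_facts(7)[OF assms(2)] by (simp add: mult_assoc_dim)
    also have "\<dots> = g (i + 1) a * f (i + 1) a * diff X i a"
      unfolding cmor_facts(7)[OF assms(1)] by (simp add: mult_assoc_dim)
    finally show ?thesis by (simp add: cmap_comp_def)
  qed
  show ?thesis using 1 2 X Z by (auto simp: cmor_def chain_map_def)
qed

lemma cmor_id: assumes "is_cpx n X" shows "cmor n X X (cmap_id X)"
proof -
  note [simp] = is_cpx_dims[OF assms]
  show ?thesis using assms
    by (simp add: cmor_def chain_map_def cmap_id_def is_repmap_def carrier_mat_iff)
qed

lemma cmor_zero:
  assumes "is_cpx n X" "is_cpx n Y"
  shows "cmor n X Y (cmap_zero X Y)"
proof -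
  note [simp] = is_cpx_dims[OF assms(1)] is_cpx_dims[OF assms(2)]
  show ?thesis using assms
    by (simp add: cmor_def chain_map_def cmap_zero_def is_repmap_def carrier_mat_iff)
qed

lemma cmor_lin:
  assumes f: "cmor n X Y f" and g: "cmor n X Y g"
  shows "cmor n X Y (cmap_add f g)" "cmor n X Y (cmap_smult c f)"
    "cmor n X Y (\<lambda>i a. f i a - g i a)"
proof -
  note X = cmorD(1)[OF f] and Y = cmorD(2)[OF f]
  note [simp] = is_cpx_dims[OF X] is_cpx_dims[OF Y] cmor_dims[OF f] cmor_dims[OF g]
  note lin = is_repmap_lin[OF is_cpxD(1)[OF X] is_cpxD(1)[OF Y] cmor_facts(3)[OF f] cmor_facts(3)[OF g]]
  show "cmor n X Y (cmap_add f g)" "cmor n X Y (cmap_smult c f)"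
    "cmor n X Y (\<lambda>i a. f i a - g i a)"
    using X Y lin
    by (auto simp: cmor_def chain_map_def cmap_add_def cmap_smult_def mat_dim_simps
        cmor_facts(7)[OF f] cmor_facts(7)[OF g])
qed

lemma comp_id:
  assumes "cmor n X Y f"
  shows "cmap_comp f (cmap_id X) = f" "cmap_comp (cmap_id Y) f = f"
  by (simp_all add: fun_eq_iff cmap_comp_def cmap_id_def cmor_dims[OF assms])

lemma comp_assoc:
  assumes f: "cmor n X Y f" and g: "cmor n Y Z g" and h: "cmor n Z W h"
  shows "cmap_comp (cmap_comp h g) f = cmap_comp h (cmap_comp g f)"
  by (simp add: fun_eq_iff cmap_comp_def  mult_assoc_dim cmor_dims[OF f] cmor_dims[OF g] cmor_dims[OF h])

lemma comp_add:
  assumes f: "cmor n X Y f" and g: "cmor n X Y g" and h: "cmor n Y W h"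
  shows "cmap_comp h (cmap_add f g) = cmap_add (cmap_comp h f) (cmap_comp h g)"
  by (simp add: fun_eq_iff cmap_comp_def cmap_add_def  mult_add_dim cmor_dims[OF f] cmor_dims[OF g] cmor_dims[OF h])

lemma add_comp:
  assumes f: "cmor n X Y f" and g: "cmor n X Y g" and h: "cmor n W X h"
  shows "cmap_comp (cmap_add f g) h = cmap_add (cmap_comp f h) (cmap_comp g h)"
  by (simp add: fun_eq_iff cmap_comp_def cmap_add_def  add_mult_dim cmor_dims[OF f] cmor_dims[OF g] cmor_dims[OF h])

lemma smult_comp:
  assumes f: "cmor n X Y f" and h: "cmor n W X h"
  shows "cmap_comp (cmap_smult c f) h = cmap_smult c (cmap_comp f h)"
  by (simp add: fun_eq_iff cmap_comp_def cmap_smult_def  smult_mult_dim cmor_dims[OF f] cmor_dims[OF h])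

lemma comp_smult:
  assumes f: "cmor n X Y f" and h: "cmor n Y W h"
  shows "cmap_comp h (cmap_smult c f) = cmap_smult c (cmap_comp h f)"
  by (simp add: fun_eq_iff cmap_comp_def cmap_smult_def  mult_smult_dim cmor_dims[OF f] cmor_dims[OF h])

lemma comp_zero:
  assumes "cmor n X Y f"
  shows "cmap_comp f (cmap_zero W X) = cmap_zero W Y" "cmap_comp (cmap_zero Y W) f = cmap_zero X W"
  by (simp_all add: fun_eq_iff cmap_comp_def cmap_zero_def cmor_dims[OF assms])

lemma zero_smult_cmor:
  assumes "cmor n X Y f"
  shows "cmap_smult 0 f = cmap_zero X Y"
  using cmor_dims[OF assms] by (intro ext eq_matI) (simp_all add: cmap_smult_def cmap_zero_def)

lemma homotopicI:
  assumes "\<And>i. is_repmap (obj X i) (obj Y (i - 1)) (h i)"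
    "\<And>i a. f i a - g i a = diff Y (i - 1) a * h i a + h (i + 1) a * diff X i a"
  shows "homotopic X Y f g"
  using assms unfolding homotopic_def by blast

lemma chtpy_refl: assumes "cmor n X Y f" shows "chtpy n X Y f f"
  unfolding chtpy_def
proof (intro conjI assms)
  note X = cmorD(1)[OF assms] and Y = cmorD(2)[OF assms]
  note [simp] = is_cpx_dims[OF X] is_cpx_dims[OF Y] cmor_dims[OF assms]
  show "homotopic X Y f f"
    by (rule homotopicI[of _ _ "\<lambda>i a. 0\<^sub>m (rdim (obj Y (i - 1)) a) (rdim (obj X i) a)"])
      (auto simp: is_repmap_def)
qed

lemma chtpy_sym: assumes "chtpy n X Y f g" shows "chtpy n X Y g f"
proof -
  have f: "cmor n X Y f" and g: "cmor n X Y g" and h: "homotopic X Y f g"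
    using assms by (auto simp: chtpy_def)
  note X = cmorD(1)[OF f] and Y = cmorD(2)[OF f]
  note [simp] = is_cpx_dims[OF X] is_cpx_dims[OF Y] cmor_dims[OF f] cmor_dims[OF g]
  obtain h where h0: "\<forall>i. is_repmap (obj X i) (obj Y (i - 1)) (h i)"
    "\<forall>i a. f i a - g i a = diff Y (i - 1) a * h i a + h (i + 1) a * diff X i a"
    using h unfolding homotopic_def by blast
  note h = h0[rule_format]
  note [simp] = is_repmap_dims[OF h(1)]
  have "homotopic X Y g f"
  proof (rule homotopicI[of _ _ "\<lambda>i a. - h i a"])
    fix i a
    have "g i a - f i a = - (f i a - g i a)" by (intro mat_add_rearrange(4)) simp_all
    also have "\<dots> = diff Y (i - 1) a * - h i a + - h (i + 1) a * diff X i a"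
      unfolding h(2) by (simp add: mat_add_rearrange(5))
    finally show "g i a - f i a = diff Y (i - 1) a * - h i a + - h (i + 1) a * diff X i a" .
  qed (rule is_repmap_lin(4)[OF is_cpxD(1)[OF X] is_cpxD(1)[OF Y] h(1) h(1)])
  then show ?thesis using f g by (auto simp: chtpy_def)
qed

text \<open>Only the difference of two maps enters a homotopy, and homotopies add up. The form with
  arbitrary \<open>F\<close> and \<open>G\<close> serves both the transitivity of
  \<open>chtpy\<close> and its compatibility with sums.\<close>

lemma homotopic_add:
  assumes f: "cmor n X Y f" and g: "cmor n X Y g" and f': "cmor n X Y f'" and g': "cmor n X Y g'"
    and hom: "homotopic X Y f g" "homotopic X Y f' g'"
    and eq: "\<And>i a. F i a - G i a = (f i a - g i a) + (f' i a - g' i a)"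
  shows "homotopic X Y F G"
proof -
  note X = cmorD(1)[OF f] and Y = cmorD(2)[OF f]
  note [simp] = is_cpx_dims[OF X] is_cpx_dims[OF Y] cmor_dims[OF f] cmor_dims[OF g]
    cmor_dims[OF f'] cmor_dims[OF g']
  obtain h where h0: "\<forall>i. is_repmap (obj X i) (obj Y (i - 1)) (h i)"
    "\<forall>i a. f i a - g i a = diff Y (i - 1) a * h i a + h (i + 1) a * diff X i a"
    using hom(1) unfolding homotopic_def by blast
  note h = h0[rule_format]
  note [simp] = is_repmap_dims[OF h(1)]
  obtain k where k0: "\<forall>i. is_repmap (obj X i) (obj Y (i - 1)) (k i)"
    "\<forall>i a. f' i a - g' i a = diff Y (i - 1) a * k i a + k (i + 1) a * diff X i a"
    using hom(2) unfolding homotopic_def by blast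
  note k = k0[rule_format]
  note [simp] = is_repmap_dims[OF k(1)]
  show ?thesis
  proof (rule homotopicI[of _ _ "\<lambda>i a. h i a + k i a"])
    fix i a
    show "F i a - G i a = diff Y (i - 1) a * (h i a + k i a) + (h (i + 1) a + k (i + 1) a) * diff X i a"
    proof -
      have "diff Y (i - 1) a * (h i a + k i a) = diff Y (i - 1) a * h i a + diff Y (i - 1) a * k i a"
        "(h (i + 1) a + k (i + 1) a) * diff X i a = h (i + 1) a * diff X i a + k (i + 1) a * diff X i a"
        by (simp_all add: mat_dim_simps)
      then show ?thesis unfolding eq h k by (simp only:) (rule mat_add_rearrange(1); simp)
    qed
  qed (rule is_repmap_lin(1)[OF is_cpxD(1)[OF X] is_cpxD(1)[OF Y] h(1) k(1)])
qed

lemma chtpy_trans: assumes "chtpy n X Y f g" "chtpy n X Y g k" shows "chtpy n X Y f k"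
proof -
  have f: "cmor n X Y f" and g: "cmor n X Y g" and k: "cmor n X Y k"
    and h: "homotopic X Y f g" "homotopic X Y g k"
    using assms by (auto simp: chtpy_def)
  have "homotopic X Y f k"
    by (rule homotopic_add[OF f g g k h], rule mat_add_rearrange(3))
      (simp_all add: cmor_dims[OF f] cmor_dims[OF g] cmor_dims[OF k])
  then show ?thesis using f k by (auto simp: chtpy_def)
qed

lemma chtpy_add:
  assumes "chtpy n X Y f g" "chtpy n X Y f' g'"
  shows "chtpy n X Y (cmap_add f f') (cmap_add g g')"
proof -
  have f: "cmor n X Y f" and g: "cmor n X Y g" and f': "cmor n X Y f'" and g': "cmor n X Y g'"
    and h: "homotopic X Y f g" "homotopic X Y f' g'"
    using assms by (auto simp: chtpy_def)
  have "homotopic X Y (cmap_add f f') (cmap_add g g')"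
    by (rule homotopic_add[OF f g f' g' h], unfold cmap_add_def, rule mat_add_rearrange(2))
      (simp_all add: cmor_dims[OF f] cmor_dims[OF g] cmor_dims[OF f'] cmor_dims[OF g'])
  then show ?thesis using cmor_lin[OF f f'] cmor_lin[OF g g'] by (auto simp: chtpy_def)
qed

lemma chtpy_comp_left: assumes "chtpy n X Y f g" "cmor n Y Z k"
  shows "chtpy n X Z (cmap_comp k f) (cmap_comp k g)"
proof -
  have f: "cmor n X Y f" and g: "cmor n X Y g" and h: "homotopic X Y f g"
    using assms by (auto simp: chtpy_def)
  note k = assms(2)
  note X = cmorD(1)[OF f] and Y = cmorD(2)[OF f] and Z = cmorD(2)[OF k]
  note [simp] = is_cpx_dims[OF X] is_cpx_dims[OF Y] is_cpx_dims[OF Z]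
    cmor_dims[OF f] cmor_dims[OF g] cmor_dims[OF k]
  obtain h where h0: "\<forall>i. is_repmap (obj X i) (obj Y (i - 1)) (h i)"
    "\<forall>i a. f i a - g i a = diff Y (i - 1) a * h i a + h (i + 1) a * diff X i a"
    using h unfolding homotopic_def by blast
  note h = h0[rule_format]
  note [simp] = is_repmap_dims[OF h(1)]
  have "homotopic X Z (cmap_comp k f) (cmap_comp k g)"
  proof (rule homotopicI[of _ _ "\<lambda>i a. k (i - 1) a * h i a"])
    fix i a
    have "cmap_comp k f i a - cmap_comp k g i a = k i a * (f i a - g i a)"
      by (simp add: cmap_comp_def mat_dim_simps)
    also have "\<dots> = (k i a * diff Y (i - 1) a) * h i a + k i a * (h (i + 1) a * diff X i a)"
      unfolding h(2) by (simp add: mat_dim_simps)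
    also have "k i a * diff Y (i - 1) a = diff Z (i - 1) a * k (i - 1) a"
      using cmor_facts(7)[OF k, of "i - 1" a] by simp
    finally show "cmap_comp k f i a - cmap_comp k g i a =
       diff Z (i - 1) a * (k (i - 1) a * h i a) + k (i + 1 - 1) a * h (i + 1) a * diff X i a"
      by (simp add: mat_dim_simps)
  qed (rule is_repmap_comp[OF is_cpxD(1)[OF X] is_cpxD(1)[OF Y] is_cpxD(1)[OF Z] h(1) cmor_facts(3)[OF k]])
  then show ?thesis using cmor_comp[OF f k] cmor_comp[OF g k] by (auto simp: chtpy_def)
qed

lemma chtpy_comp_right: assumes "chtpy n X Y f g" "cmor n W X k"
  shows "chtpy n W Y (cmap_comp f k) (cmap_comp g k)"
proof -
  have f: "cmor n X Y f" and g: "cmor n X Y g" and h: "homotopic X Y f g"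
    using assms by (auto simp: chtpy_def)
  note k = assms(2)
  note X = cmorD(1)[OF f] and Y = cmorD(2)[OF f] and W = cmorD(1)[OF k]
  note [simp] = is_cpx_dims[OF X] is_cpx_dims[OF Y] is_cpx_dims[OF W]
    cmor_dims[OF f] cmor_dims[OF g] cmor_dims[OF k]
  obtain h where h0: "\<forall>i. is_repmap (obj X i) (obj Y (i - 1)) (h i)"
    "\<forall>i a. f i a - g i a = diff Y (i - 1) a * h i a + h (i + 1) a * diff X i a"
    using h unfolding homotopic_def by blast
  note h = h0[rule_format]
  note [simp] = is_repmap_dims[OF h(1)]
  have "homotopic W Y (cmap_comp f k) (cmap_comp g k)"
  proof (rule homotopicI[of _ _ "\<lambda>i a. h i a * k i a"])
    fix i a
    have "cmap_comp f k i a - cmap_comp g k i a = (f i a - g i a) * k i a"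
      by (simp add: cmap_comp_def mat_dim_simps)
    also have "\<dots> = diff Y (i - 1) a * (h i a * k i a) + h (i + 1) a * (diff X i a * k i a)"
      unfolding h(2) by (simp add: mat_dim_simps)
    also have "diff X i a * k i a = k (i + 1) a * diff W i a"
      using cmor_facts(7)[OF k, of "i" a] by simp
    finally show "cmap_comp f k i a - cmap_comp g k i a =
       diff Y (i - 1) a * (h i a * k i a) + h (i + 1) a * k (i + 1) a * diff W i a"
      by (simp add: mat_dim_simps)
  qed (rule is_repmap_comp[OF is_cpxD(1)[OF W] is_cpxD(1)[OF X] is_cpxD(1)[OF Y] cmor_facts(3)[OF k] h(1)])
  then show ?thesis using cmor_comp[OF k f] cmor_comp[OF k g] by (auto simp: chtpy_def)
qed

text \<open>Reduces the homotopy invariance of scalar multiples to that of composites.\<close>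

lemma smult_conv_comp:
  assumes "cmor n X Y f"
  shows "cmap_smult c f = cmap_comp (cmap_smult c (cmap_id Y)) f"
  using smult_comp[OF cmor_id[OF cmorD(2)[OF assms]] assms] comp_id[OF assms] by simp

lemma chtpy_smult: assumes "chtpy n X Y f g"
  shows "chtpy n X Y (cmap_smult c f) (cmap_smult c g)"
proof -
  have f: "cmor n X Y f" and g: "cmor n X Y g" using assms by (auto simp: chtpy_def)
  have "cmor n Y Y (cmap_smult c (cmap_id Y))"
    using cmor_lin(2) cmor_id cmorD(2)[OF f] by blast
  then show ?thesis
    using chtpy_comp_left[OF assms] smult_conv_comp[OF f] smult_conv_comp[OF g] by metis
qed

lemma chtpyD: "chtpy n X Y f g \<Longrightarrow> cmor n X Y f" "chtpy n X Y f g \<Longrightarrow> cmor n X Y g"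
  "chtpy n X Y f g \<Longrightarrow> homotopic X Y f g"
  by (auto simp: chtpy_def)

section \<open>Quasi-isomorphisms\<close>

lemma vec_arith:
  fixes u v w :: "'a::ab_group_add vec"
  assumes "u \<in> carrier_vec d" "v \<in> carrier_vec d" "w \<in> carrier_vec d"
  shows "u - v + v = u" "(u - v) + (v - w) = u - w" "- (u - v) = v - u" "u - (u - v) = v" "u + v - u = v"
  using assms by (auto simp: vec_eq_iff)

text \<open>Cocycles, coboundaries and the spaces between them are treated as subspaces of one
  coordinate space, so that arguments on cohomology can be made with representatives.\<close>

definition vsub :: "nat \<Rightarrow> 'k::field vec set \<Rightarrow> bool" where
  "vsub d S \<longleftrightarrow> S \<subseteq> carrier_vec d \<and> 0\<^sub>v d \<in> S \<and> (\<forall>u\<in>S. \<forall>v\<in>S. u + v \<in> S) \<and> (\<forall>c. \<forall>u\<in>S. c \<cdot>\<^sub>v u \<in> S)"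

lemma vsubD:
  assumes "vsub d S"
  shows "u \<in> S \<Longrightarrow> u \<in> carrier_vec d" "0\<^sub>v d \<in> S" "u \<in> S \<Longrightarrow> v \<in> S \<Longrightarrow> u + v \<in> S"
    "u \<in> S \<Longrightarrow> c \<cdot>\<^sub>v u \<in> S" "u \<in> S \<Longrightarrow> - u \<in> S" "u \<in> S \<Longrightarrow> v \<in> S \<Longrightarrow> u - v \<in> S"
proof -
  show 1: "u \<in> S \<Longrightarrow> u \<in> carrier_vec d" "0\<^sub>v d \<in> S"
    and 2: "u \<in> S \<Longrightarrow> v \<in> S \<Longrightarrow> u + v \<in> S" and 3: "u \<in> S \<Longrightarrow> c \<cdot>\<^sub>v u \<in> S" for u v c
    using assms by (auto simp: vsub_def)
  show 4: "- u \<in> S" if "u \<in> S" for u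
  proof -
    have "(- 1) \<cdot>\<^sub>v u = - u" by (intro eq_vecI) auto
    then show ?thesis using 3[OF that, of "- 1"] by simp
  qed
  show "u - v \<in> S" if "u \<in> S" "v \<in> S" for u v
    using 2[OF that(1) 4[OF that(2)]] minus_add_uminus_vec[OF 1(1)[OF that(1)] 1(1)[OF that(2)]] by simp
qed

lemma vsub_diff_swap:
  assumes "vsub d S" "u - v \<in> S" "u \<in> carrier_vec d" "v \<in> carrier_vec d"
  shows "v - u \<in> S"
  using vsubD(5)[OF assms(1,2)] vec_arith(3)[OF assms(3,4,3)] by simp

lemma vsub_diff_trans:
  assumes "vsub d S" "u - v \<in> S" "v - w \<in> S" "u \<in> carrier_vec d" "v \<in> carrier_vec d" "w \<in> carrier_vec d"
  shows "u - w \<in> S"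
  using vsubD(3)[OF assms(1-3)] vec_arith(2)[OF assms(4-6)] by simp

lemma mat_vec_linear:
  fixes A :: "'a::field mat"
  assumes "u \<in> carrier_vec (dim_col A)" "v \<in> carrier_vec (dim_col A)"
  shows "A *\<^sub>v (u + v) = A *\<^sub>v u + A *\<^sub>v v" "A *\<^sub>v (u - v) = A *\<^sub>v u - A *\<^sub>v v"
    "A *\<^sub>v (c \<cdot>\<^sub>v u) = c \<cdot>\<^sub>v (A *\<^sub>v u)" "A *\<^sub>v (- u) = - (A *\<^sub>v u)"
proof -
  show "A *\<^sub>v (u + v) = A *\<^sub>v u + A *\<^sub>v v" "A *\<^sub>v (u - v) = A *\<^sub>v u - A *\<^sub>v v"
    "A *\<^sub>v (c \<cdot>\<^sub>v u) = c \<cdot>\<^sub>v (A *\<^sub>v u)"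
    using assms by (auto intro: mult_add_distrib_mat_vec mult_minus_distrib_mat_vec mult_mat_vec)
  have "0\<^sub>v (dim_col A) - u = - u" using assms by simp
  moreover have "A *\<^sub>v (0\<^sub>v (dim_col A) - u) = A *\<^sub>v 0\<^sub>v (dim_col A) - A *\<^sub>v u"
    using assms by (intro mult_minus_distrib_mat_vec) auto
  moreover have "A *\<^sub>v 0\<^sub>v (dim_col A) = 0\<^sub>v (dim_row A)" by (auto intro!: eq_vecI)
  ultimately show "A *\<^sub>v (- u) = - (A *\<^sub>v u)" by (auto intro!: eq_vecI)
qed

lemma mat_vec_zero [simp]: "dim_col A = d \<Longrightarrow> (A :: 'a::field mat) *\<^sub>v 0\<^sub>v d = 0\<^sub>v (dim_row A)"
  by (auto intro!: eq_vecI)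

lemma zero_mat_vec [simp]: "v \<in> carrier_vec c \<Longrightarrow> 0\<^sub>m r c *\<^sub>v v = (0\<^sub>v r :: 'a::field vec)"
  by (auto intro!: eq_vecI)

lemma mat_vec_linear_mats:
  fixes A :: "'a::field mat"
  assumes "dim_row B = dim_row A" "dim_col B = dim_col A" "v \<in> carrier_vec (dim_col A)"
  shows "(A + B) *\<^sub>v v = A *\<^sub>v v + B *\<^sub>v v" "(A - B) *\<^sub>v v = A *\<^sub>v v - B *\<^sub>v v"
  using assms by (metis add_mult_distrib_mat_vec carrier_mat_triv,
    metis minus_mult_distrib_mat_vec carrier_mat_triv)

lemma smult_mat_vec_dim:
  fixes A :: "'a::field mat"
  assumes "v \<in> carrier_vec (dim_col A)"
  shows "(c \<cdot>\<^sub>m A) *\<^sub>v v = c \<cdot>\<^sub>v (A *\<^sub>v v)"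
  using assms by (auto intro!: eq_vecI)

lemma mult_mat_vec_carrier_dim: "dim_row A = d \<Longrightarrow> A *\<^sub>v v \<in> carrier_vec d"
  by (metis carrier_vec_dim_vec dim_mult_mat_vec)

section \<open>Cocycles and coboundaries of a complex\<close>

lemma cpx_vec_simps:
  assumes "is_cpx n X"
  shows "diff X i a *\<^sub>v v \<in> carrier_vec (rdim (obj X (i + 1)) a)"
    "diff X (i - 1) a *\<^sub>v v \<in> carrier_vec (rdim (obj X i) a)"
    "rarr (obj X i) a *\<^sub>v v \<in> carrier_vec (rdim (obj X i) a)"
  using is_cpx_dims[OF assms] by (auto intro!: mult_mat_vec_carrier_dim)

lemma cmor_vec_carrier:
  assumes "cmor n X Y f"
  shows "f i a *\<^sub>v v \<in> carrier_vec (rdim (obj Y i) a)"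
  using cmor_dims[OF assms] by (auto intro!: mult_mat_vec_carrier_dim)

lemma cpx_vec_eqs:
  assumes X: "is_cpx n X"
  shows "v \<in> carrier_vec (rdim (obj X i) a) \<Longrightarrow>
      diff X (i + 1) a *\<^sub>v (diff X i a *\<^sub>v v) = 0\<^sub>v (rdim (obj X (i + 1 + 1)) a)"
    "v \<in> carrier_vec (rdim (obj X (i - 1)) a) \<Longrightarrow>
      diff X i a *\<^sub>v (diff X (i - 1) a *\<^sub>v v) = 0\<^sub>v (rdim (obj X (i + 1)) a)"
    "v \<in> carrier_vec (rdim (obj X i) (Suc a)) \<Longrightarrow>
      diff X i a *\<^sub>v (rarr (obj X i) a *\<^sub>v v) = rarr (obj X (i + 1)) a *\<^sub>v (diff X i (Suc a) *\<^sub>v v)"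
proof -
  note [simp] = is_cpx_dims[OF X]
  show 1: "diff X (i + 1) a *\<^sub>v (diff X i a *\<^sub>v v) = 0\<^sub>v (rdim (obj X (i + 1 + 1)) a)"
    if "v \<in> carrier_vec (rdim (obj X i) a)" for v i
    using that by (subst mult_assoc_dim_vec[symmetric]) (simp_all add: is_cpxD(3)[OF X] add.assoc[symmetric])
  show "diff X i a *\<^sub>v (diff X (i - 1) a *\<^sub>v v) = 0\<^sub>v (rdim (obj X (i + 1)) a)"
    if "v \<in> carrier_vec (rdim (obj X (i - 1)) a)"
    using 1[OF that] by simp
  show "diff X i a *\<^sub>v (rarr (obj X i) a *\<^sub>v v) = rarr (obj X (i + 1)) a *\<^sub>v (diff X i (Suc a) *\<^sub>v v)"
    if "v \<in> carrier_vec (rdim (obj X i) (Suc a))"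
    using that by (subst (1 2) mult_assoc_dim_vec[symmetric]) (simp_all add: is_cpxD(8)[OF X])
qed

lemma cmor_vec_eqs:
  assumes f: "cmor n X Y f"
  shows "v \<in> carrier_vec (rdim (obj X i) a) \<Longrightarrow>
      diff Y i a *\<^sub>v (f i a *\<^sub>v v) = f (i + 1) a *\<^sub>v (diff X i a *\<^sub>v v)"
    "v \<in> carrier_vec (rdim (obj X (i - 1)) a) \<Longrightarrow>
      diff Y (i - 1) a *\<^sub>v (f (i - 1) a *\<^sub>v v) = f i a *\<^sub>v (diff X (i - 1) a *\<^sub>v v)"
    "v \<in> carrier_vec (rdim (obj X i) (Suc a)) \<Longrightarrow>
      f i a *\<^sub>v (rarr (obj X i) a *\<^sub>v v) = rarr (obj Y i) a *\<^sub>v (f i (Suc a) *\<^sub>v v)"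
proof -
  note [simp] = is_cpx_dims[OF cmorD(1)[OF f]] is_cpx_dims[OF cmorD(2)[OF f]] cmor_dims[OF f]
  show 1: "diff Y i a *\<^sub>v (f i a *\<^sub>v v) = f (i + 1) a *\<^sub>v (diff X i a *\<^sub>v v)"
    if "v \<in> carrier_vec (rdim (obj X i) a)" for i v
    using that by (subst (1 2) mult_assoc_dim_vec[symmetric]) (simp_all add: cmor_facts(7)[OF f])
  show "diff Y (i - 1) a *\<^sub>v (f (i - 1) a *\<^sub>v v) = f i a *\<^sub>v (diff X (i - 1) a *\<^sub>v v)"
    if "v \<in> carrier_vec (rdim (obj X (i - 1)) a)"
    using 1[OF that] by simp
  show "f i a *\<^sub>v (rarr (obj X i) a *\<^sub>v v) = rarr (obj Y i) a *\<^sub>v (f i (Suc a) *\<^sub>v v)"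
    if "v \<in> carrier_vec (rdim (obj X i) (Suc a))"
    using that by (subst (1 2) mult_assoc_dim_vec[symmetric]) (simp_all add: cmor_facts(6)[OF f])
qed

lemma cocyclesD:
  assumes "v \<in> cocycles X i a"
  shows "v \<in> carrier_vec (rdim (obj X i) a)" "diff X i a *\<^sub>v v = 0\<^sub>v (rdim (obj X (i + 1)) a)"
  using assms by (auto simp: cocycles_def)

lemma coboundariesI:
  "w \<in> carrier_vec (rdim (obj X (i - 1)) a) \<Longrightarrow> diff X (i - 1) a *\<^sub>v w \<in> coboundaries X i a"
  by (auto simp: coboundaries_def)

lemma coboundariesE:
  assumes "v \<in> coboundaries X i a"
  obtains w where "w \<in> carrier_vec (rdim (obj X (i - 1)) a)" "v = diff X (i - 1) a *\<^sub>v w"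
  using assms by (auto simp: coboundaries_def)

lemma vsub_cocycles:
  assumes "is_cpx n X"
  shows "vsub (rdim (obj X i) a) (cocycles X i a)"
proof -
  note [simp] = is_cpx_dims[OF assms]
  show ?thesis
    by (auto simp: vsub_def cocycles_def mat_vec_linear)
qed

lemma vsub_coboundaries:
  assumes "is_cpx n X"
  shows "vsub (rdim (obj X i) a) (coboundaries X i a)"
proof -
  note [simp] = is_cpx_dims[OF assms]
  show ?thesis
    unfolding vsub_def
  proof (intro conjI ballI allI)
    show "coboundaries X i a \<subseteq> carrier_vec (rdim (obj X i) a)"
      by (auto elim!: coboundariesE simp: cpx_vec_simps[OF assms])
    show "0\<^sub>v (rdim (obj X i) a) \<in> coboundaries X i a"
      using coboundariesI[of "0\<^sub>v (rdim (obj X (i - 1)) a)" X i a] by simp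
    show "u + v \<in> coboundaries X i a" if uv: "u \<in> coboundaries X i a" "v \<in> coboundaries X i a" for u v
    proof -
      obtain u' v' where "u' \<in> carrier_vec (rdim (obj X (i - 1)) a)" "u = diff X (i - 1) a *\<^sub>v u'"
        "v' \<in> carrier_vec (rdim (obj X (i - 1)) a)" "v = diff X (i - 1) a *\<^sub>v v'"
        using uv by (meson coboundariesE)
      then show ?thesis using coboundariesI[of "u' + v'" X i a] by (simp add: mat_vec_linear)
    qed
    show "c \<cdot>\<^sub>v u \<in> coboundaries X i a" if u: "u \<in> coboundaries X i a" for u c
    proof -
      obtain u' where "u' \<in> carrier_vec (rdim (obj X (i - 1)) a)" "u = diff X (i - 1) a *\<^sub>v u'"
        using u by (meson coboundariesE)
      then show ?thesis using coboundariesI[of "c \<cdot>\<^sub>v u'" X i a] by (simp add: mat_vec_linear)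
    qed
  qed
qed

lemma coboundaries_cocycles:
  assumes "is_cpx n X" "v \<in> coboundaries X i a"
  shows "v \<in> cocycles X i a"
  using assms(2) by (auto elim!: coboundariesE simp: cocycles_def cpx_vec_simps[OF assms(1)] cpx_vec_eqs[OF assms(1)])

lemma cmor_cocycles:
  assumes "cmor n X Y f" "v \<in> cocycles X i a"
  shows "f i a *\<^sub>v v \<in> cocycles Y i a"
  using cocyclesD[OF assms(2)] cmor_dims[OF assms(1)]
  by (simp add: cocycles_def cmor_vec_carrier[OF assms(1)] cmor_vec_eqs[OF assms(1)])

lemma cmor_coboundaries:
  assumes "cmor n X Y f" "v \<in> coboundaries X i a"
  shows "f i a *\<^sub>v v \<in> coboundaries Y i a"
  using assms(2)
proof (rule coboundariesE)
  fix w assume w: "w \<in> carrier_vec (rdim (obj X (i - 1)) a)" "v = diff X (i - 1) a *\<^sub>v w"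
  then have "f i a *\<^sub>v v = diff Y (i - 1) a *\<^sub>v (f (i - 1) a *\<^sub>v w)"
    by (simp add: cmor_vec_eqs[OF assms(1)])
  then show ?thesis by (simp add: coboundariesI cmor_vec_carrier[OF assms(1)])
qed

lemma rarr_cocycles:
  assumes "is_cpx n X" "v \<in> cocycles X i (Suc a)"
  shows "rarr (obj X i) a *\<^sub>v v \<in> cocycles X i a"
  using cocyclesD[OF assms(2)] is_cpx_dims[OF assms(1)]
  by (simp add: cocycles_def cpx_vec_simps[OF assms(1)] cpx_vec_eqs[OF assms(1)])

lemma rarr_coboundaries:
  assumes "is_cpx n X" "v \<in> coboundaries X i (Suc a)"
  shows "rarr (obj X i) a *\<^sub>v v \<in> coboundaries X i a"
  using assms(2)
proof (rule coboundariesE)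
  fix w assume w: "w \<in> carrier_vec (rdim (obj X (i - 1)) (Suc a))" "v = diff X (i - 1) (Suc a) *\<^sub>v w"
  then have "rarr (obj X i) a *\<^sub>v v = diff X (i - 1) a *\<^sub>v (rarr (obj X (i - 1)) a *\<^sub>v w)"
    using cpx_vec_eqs(3)[OF assms(1) w(1)] by simp
  then show ?thesis by (simp add: coboundariesI cpx_vec_simps[OF assms(1)])
qed

text \<open>Bijectivity on cohomology in terms of representatives: the first clause is surjectivity,
  the second is triviality of the kernel. The quotient sets of \<open>quasi_iso\<close> occur only
  up to \<open>quasi_iso_iff\<close>.\<close>

definition qis :: "nat \<Rightarrow> 'k::field cpx \<Rightarrow> 'k cpx \<Rightarrow> 'k cmap \<Rightarrow> bool" where
  "qis n X Y f \<longleftrightarrow> cmor n X Y f \<and>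
     (\<forall>i a. \<forall>z\<in>cocycles Y i a. \<exists>w\<in>cocycles X i a. f i a *\<^sub>v w - z \<in> coboundaries Y i a) \<and>
     (\<forall>i a. \<forall>w\<in>cocycles X i a. f i a *\<^sub>v w \<in> coboundaries Y i a \<longrightarrow> w \<in> coboundaries X i a)"

lemma qisD:
  assumes "qis n X Y f"
  shows "cmor n X Y f"
    "z \<in> cocycles Y i a \<Longrightarrow> \<exists>w\<in>cocycles X i a. f i a *\<^sub>v w - z \<in> coboundaries Y i a"
    "w \<in> cocycles X i a \<Longrightarrow> f i a *\<^sub>v w \<in> coboundaries Y i a \<Longrightarrow> w \<in> coboundaries X i a"
  using assms by (auto simp: qis_def)

lemma equiv_cohomologous:
  assumes "is_cpx n X"
  shows "equiv (cocycles X i a) (cohomologous X i a)"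
proof -
  note Z = vsub_cocycles[OF assms, of i a] and B = vsub_coboundaries[OF assms, of i a]
  note c = vsubD(1)[OF Z]
  show ?thesis
  proof (rule equivI)
    show "refl_on (cocycles X i a) (cohomologous X i a)"
      using vsubD(2)[OF B] minus_cancel_vec[OF c] by (auto simp: refl_on_def cohomologous_def)
    show "sym (cohomologous X i a)"
      using vsub_diff_swap[OF B] c by (auto simp: sym_def cohomologous_def)
    show "trans (cohomologous X i a)"
      using vsub_diff_trans[OF B] c by (fastforce simp: trans_def cohomologous_def)
  qed (auto simp: cohomologous_def)
qed

text \<open>Since \<open>f\<close> preserves coboundaries, the images of all members of a class are
  cohomologous, so \<open>cohomology_map\<close> produces a single class.\<close>

lemma cohomology_map_class:
  assumes f: "cmor n X Y f" and w: "w \<in> cocycles X i a"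
  shows "cohomology_map Y f i a (cohomologous X i a `` {w}) = cohomologous Y i a `` {f i a *\<^sub>v w}"
proof -
  note eX = equiv_cohomologous[OF cmorD(1)[OF f], of i a]
  note eY = equiv_cohomologous[OF cmorD(2)[OF f], of i a]
  have *: "(f i a *\<^sub>v w, f i a *\<^sub>v v) \<in> cohomologous Y i a" if "(w, v) \<in> cohomologous X i a" for v
  proof -
    have v: "v \<in> cocycles X i a" and b: "w - v \<in> coboundaries X i a"
      using that by (auto simp: cohomologous_def)
    have "f i a *\<^sub>v (w - v) = f i a *\<^sub>v w - f i a *\<^sub>v v"
      using cocyclesD(1)[OF v] cocyclesD(1)[OF w] by (simp add: mat_vec_linear cmor_dims[OF f])
    then show ?thesis using cmor_coboundaries[OF f b] cmor_cocycles[OF f v] cmor_cocycles[OF f w]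
      by (simp add: cohomologous_def)
  qed
  have "w \<in> cohomologous X i a `` {w}" by (rule equiv_class_self[OF eX w])
  then show ?thesis
    unfolding cohomology_map_def using * eY
    by (auto simp: Image_iff) (meson equivE transE symE)+
qed

lemma quasi_iso_iff:
  assumes "is_cpx n X" "is_cpx n Y"
  shows "quasi_iso X Y f \<longleftrightarrow> qis n X Y f"
proof (cases "chain_map X Y f")
  case False
  then show ?thesis by (auto simp: quasi_iso_def qis_def cmor_def)
next
  case True
  then have f: "cmor n X Y f" using assms by (auto simp: cmor_def)
  note cl = cohomology_map_class[OF f]
  have "bij_betw (cohomology_map Y f i a) (cohomology X i a) (cohomology Y i a) \<longleftrightarrow>
    (\<forall>z\<in>cocycles Y i a. \<exists>w\<in>cocycles X i a. f i a *\<^sub>v w - z \<in> coboundaries Y i a) \<and>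
    (\<forall>w\<in>cocycles X i a. f i a *\<^sub>v w \<in> coboundaries Y i a \<longrightarrow> w \<in> coboundaries X i a)" for i a
  proof -
    note eX = equiv_cohomologous[OF assms(1), of i a] and eY = equiv_cohomologous[OF assms(2), of i a]
    note ZX = vsub_cocycles[OF assms(1), of i a] and BX = vsub_coboundaries[OF assms(1), of i a]
    note ZY = vsub_cocycles[OF assms(2), of i a] and BY = vsub_coboundaries[OF assms(2), of i a]
    have img: "cohomology_map Y f i a ` cohomology X i a = cohomology Y i a \<longleftrightarrow>
      (\<forall>z\<in>cocycles Y i a. \<exists>w\<in>cocycles X i a. f i a *\<^sub>v w - z \<in> coboundaries Y i a)" (is "?L \<longleftrightarrow> ?R")
    proof
      assume L: ?L
      show ?R
      proof
        fix z assume z: "z \<in> cocycles Y i a"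
        then have "cohomologous Y i a `` {z} \<in> cohomology_map Y f i a ` cohomology X i a"
          unfolding L by (auto simp: cohomology_def quotientI)
        then obtain w where w: "w \<in> cocycles X i a" "cohomologous Y i a `` {z} = cohomologous Y i a `` {f i a *\<^sub>v w}"
          by (auto simp: cohomology_def elim!: quotientE simp: cl)
        then have "(f i a *\<^sub>v w, z) \<in> cohomologous Y i a"
          using eq_equiv_class[OF w(2)[symmetric] eY z] by simp
        then show "\<exists>w\<in>cocycles X i a. f i a *\<^sub>v w - z \<in> coboundaries Y i a"
          using w(1) by (auto simp: cohomologous_def)
      qed
    next
      assume R: ?R
      show ?L
      proof
        show "cohomology_map Y f i a ` cohomology X i a \<subseteq> cohomology Y i a"
          by (auto simp: cohomology_def cl elim!: quotientE intro!: quotientI cmor_cocycles[OF f])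
        show "cohomology Y i a \<subseteq> cohomology_map Y f i a ` cohomology X i a"
        proof
          fix C assume "C \<in> cohomology Y i a"
          then obtain z where z: "z \<in> cocycles Y i a" "C = cohomologous Y i a `` {z}"
            by (auto simp: cohomology_def elim!: quotientE)
          obtain w where w: "w \<in> cocycles X i a" "f i a *\<^sub>v w - z \<in> coboundaries Y i a"
            using R z by blast
          have "(f i a *\<^sub>v w, z) \<in> cohomologous Y i a"
            using w z cmor_cocycles[OF f] by (auto simp: cohomologous_def)
          then have "C = cohomology_map Y f i a (cohomologous X i a `` {w})"
            using cl[OF w(1)] z(2) equiv_class_eq[OF eY] by metis
          then show "C \<in> cohomology_map Y f i a ` cohomology X i a"
            using w(1) by (auto simp: cohomology_def intro!: imageI quotientI)
        qed
      qed
    qed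
    \<comment> \<open>Injectivity against trivial kernel: one direction compares \<open>w\<close>
      with the zero cocycle, the other applies the kernel condition to the difference of two
      representatives.\<close>
    have inj: "inj_on (cohomology_map Y f i a) (cohomology X i a) \<longleftrightarrow>
      (\<forall>w\<in>cocycles X i a. f i a *\<^sub>v w \<in> coboundaries Y i a \<longrightarrow> w \<in> coboundaries X i a)" (is "?L \<longleftrightarrow> ?R")
    proof
      assume L: ?L
      show ?R
      proof (intro ballI impI)
        fix w assume w: "w \<in> cocycles X i a" and b: "f i a *\<^sub>v w \<in> coboundaries Y i a"
        let ?z = "0\<^sub>v (rdim (obj X i) a)"
        have z: "?z \<in> cocycles X i a" using vsubD(2)[OF ZX] .
        have "f i a *\<^sub>v ?z = 0\<^sub>v (rdim (obj Y i) a)" by (simp add: cmor_dims[OF f])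
        then have "(f i a *\<^sub>v w, f i a *\<^sub>v ?z) \<in> cohomologous Y i a"
          using b cmor_cocycles[OF f w] cmor_cocycles[OF f z] by (simp add: cohomologous_def cocyclesD)
        then have "cohomology_map Y f i a (cohomologous X i a `` {w}) =
            cohomology_map Y f i a (cohomologous X i a `` {?z})"
          unfolding cl[OF w] cl[OF z] by (rule equiv_class_eq[OF eY])
        then have "cohomologous X i a `` {w} = cohomologous X i a `` {?z}"
          using L w z by (auto simp: inj_on_def cohomology_def quotientI)
        then have "(w, ?z) \<in> cohomologous X i a" using eq_equiv_class[OF _ eX z] by blast
        then show "w \<in> coboundaries X i a" using w by (simp add: cohomologous_def cocyclesD)
      qed
    next
      assume R: ?R
      show ?L
      proof (rule inj_onI)
        fix C D assume "C \<in> cohomology X i a" "D \<in> cohomology X i a"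
          and eq: "cohomology_map Y f i a C = cohomology_map Y f i a D"
        then obtain w v where w: "w \<in> cocycles X i a" "C = cohomologous X i a `` {w}"
          and v: "v \<in> cocycles X i a" "D = cohomologous X i a `` {v}"
          by (auto simp: cohomology_def elim!: quotientE)
        have "(f i a *\<^sub>v w, f i a *\<^sub>v v) \<in> cohomologous Y i a"
          using eq unfolding w v cl[OF w(1)] cl[OF v(1)]
          using eq_equiv_class[OF _ eY cmor_cocycles[OF f v(1)]] by blast
        then have "f i a *\<^sub>v (w - v) \<in> coboundaries Y i a"
          using cocyclesD(1)[OF w(1)] cocyclesD(1)[OF v(1)]
          by (simp add: cohomologous_def mat_vec_linear cmor_dims[OF f])
        then have "w - v \<in> coboundaries X i a" using R vsubD(6)[OF ZX w(1) v(1)] by blast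
        then have "(w, v) \<in> cohomologous X i a" using w v by (auto simp: cohomologous_def)
        then show "C = D" unfolding w v by (rule equiv_class_eq[OF eX])
      qed
    qed
    show ?thesis unfolding bij_betw_def img inj by blast
  qed
  then show ?thesis using f True by (auto simp: quasi_iso_def qis_def)
qed

lemma comp_vec:
  assumes "cmor n X Y f" "cmor n Y Z g" "v \<in> carrier_vec (rdim (obj X i) a)"
  shows "cmap_comp g f i a *\<^sub>v v = g i a *\<^sub>v (f i a *\<^sub>v v)"
  using assms(3) unfolding cmap_comp_def
  by (intro mult_assoc_dim_vec) (simp_all add: cmor_dims[OF assms(1)] cmor_dims[OF assms(2)])

text \<open>On a cocycle the summand of the homotopy formula that begins with the differential of
  \<open>X\<close> vanishes, and the other summand is a coboundary of \<open>Y\<close>.\<close>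

lemma chtpy_coboundaries:
  assumes "chtpy n X Y f g" "w \<in> cocycles X i a"
  shows "f i a *\<^sub>v w - g i a *\<^sub>v w \<in> coboundaries Y i a"
proof -
  note f = chtpyD(1)[OF assms(1)] and g = chtpyD(2)[OF assms(1)] and w = cocyclesD[OF assms(2)]
  note [simp] = is_cpx_dims[OF cmorD(1)[OF f]] is_cpx_dims[OF cmorD(2)[OF f]] cmor_dims[OF f] cmor_dims[OF g]
  obtain h where h0: "\<forall>i. is_repmap (obj X i) (obj Y (i - 1)) (h i)"
    "\<forall>i a. f i a - g i a = diff Y (i - 1) a * h i a + h (i + 1) a * diff X i a"
    using chtpyD(3)[OF assms(1)] unfolding homotopic_def by blast
  note h = h0[rule_format]
  note [simp] = is_repmap_dims[OF h(1)]
  have "f i a *\<^sub>v w - g i a *\<^sub>v w = (f i a - g i a) *\<^sub>v w"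
    using w(1) by (simp add: mat_vec_linear_mats)
  also have "\<dots> = diff Y (i - 1) a * h i a *\<^sub>v w + h (i + 1) a * diff X i a *\<^sub>v w"
    unfolding h(2) using w(1) by (intro mat_vec_linear_mats) simp_all
  also have "\<dots> = diff Y (i - 1) a *\<^sub>v (h i a *\<^sub>v w) + h (i + 1) a *\<^sub>v (diff X i a *\<^sub>v w)"
    using w(1) by (simp add: mult_assoc_dim_vec)
  also have "\<dots> = diff Y (i - 1) a *\<^sub>v (h i a *\<^sub>v w)"
    using w by (simp add: cpx_vec_simps[OF cmorD(2)[OF f]])
  finally show ?thesis using coboundariesI[of "h i a *\<^sub>v w" Y i a] by (simp add: mult_mat_vec_carrier_dim)
qed

lemma qis_chtpy:
  assumes "chtpy n X Y f g" "qis n X Y f"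
  shows "qis n X Y g"
proof -
  note g = chtpyD(2)[OF assms(1)] and f = chtpyD(1)[OF assms(1)]
  note Y = cmorD(2)[OF g]
  note B = vsub_coboundaries[OF Y]
  note car = cmor_vec_carrier[OF f] cmor_vec_carrier[OF g]
  show ?thesis unfolding qis_def
  proof (intro conjI allI ballI impI g)
    fix i a z assume z: "z \<in> cocycles Y i a"
    then obtain w where w: "w \<in> cocycles X i a" "f i a *\<^sub>v w - z \<in> coboundaries Y i a"
      using qisD(2)[OF assms(2)] by blast
    have "g i a *\<^sub>v w - f i a *\<^sub>v w \<in> coboundaries Y i a"
      using chtpy_coboundaries[OF chtpy_sym[OF assms(1)] w(1)] .
    then have "g i a *\<^sub>v w - z \<in> coboundaries Y i a"
      using vsub_diff_trans[OF B] w(2) car cocyclesD(1)[OF z] by blast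
    then show "\<exists>w\<in>cocycles X i a. g i a *\<^sub>v w - z \<in> coboundaries Y i a" using w(1) by blast
  next
    fix i a w assume w: "w \<in> cocycles X i a" "g i a *\<^sub>v w \<in> coboundaries Y i a"
    have "f i a *\<^sub>v w - g i a *\<^sub>v w \<in> coboundaries Y i a"
      using chtpy_coboundaries[OF assms(1) w(1)] .
    then have "f i a *\<^sub>v w - g i a *\<^sub>v w + g i a *\<^sub>v w \<in> coboundaries Y i a"
      using vsubD(3)[OF B] w(2) by blast
    then have "f i a *\<^sub>v w \<in> coboundaries Y i a"
      using vec_arith(1)[OF car(1) car(2) car(1)] by metis
    then show "w \<in> coboundaries X i a" using qisD(3)[OF assms(2) w(1)] by blast
  qed
qed

lemma qis_id: assumes "is_cpx n X" shows "qis n X X (cmap_id X)"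
proof -
  have "cmap_id X i a *\<^sub>v v = v" if "v \<in> cocycles X i a" for i a v
    using cocyclesD[OF that] by (simp add: cmap_id_def)
  moreover have "v - v \<in> coboundaries X i a" if "v \<in> cocycles X i a" for i a v
    using cocyclesD[OF that] vsubD(2)[OF vsub_coboundaries[OF assms]] by simp
  ultimately show ?thesis unfolding qis_def using cmor_id[OF assms] by metis
qed

lemma qis_comp:
  assumes "qis n X Y f" "qis n Y Z g"
  shows "qis n X Z (cmap_comp g f)"
proof -
  note f = qisD(1)[OF assms(1)] and g = qisD(1)[OF assms(2)]
  note Y = cmorD(1)[OF g] and Z = cmorD(2)[OF g]
  show ?thesis unfolding qis_def
  proof (intro conjI allI ballI impI cmor_comp[OF f g])
    fix i a z assume z: "z \<in> cocycles Z i a"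
    obtain y where y: "y \<in> cocycles Y i a" "g i a *\<^sub>v y - z \<in> coboundaries Z i a"
      using qisD(2)[OF assms(2) z] by blast
    obtain x where x: "x \<in> cocycles X i a" "f i a *\<^sub>v x - y \<in> coboundaries Y i a"
      using qisD(2)[OF assms(1) y(1)] by blast
    have "g i a *\<^sub>v (f i a *\<^sub>v x) - g i a *\<^sub>v y \<in> coboundaries Z i a"
      using cmor_coboundaries[OF g x(2)] cocyclesD(1)[OF y(1)] cmor_vec_carrier[OF f, of i a x]
      by (simp add: mat_vec_linear cmor_dims[OF g])
    then have "g i a *\<^sub>v (f i a *\<^sub>v x) - z \<in> coboundaries Z i a"
      using vsub_diff_trans[OF vsub_coboundaries[OF Z]] y(2) cmor_vec_carrier[OF g] cocyclesD(1)[OF z] by blast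
    then show "\<exists>w\<in>cocycles X i a. cmap_comp g f i a *\<^sub>v w - z \<in> coboundaries Z i a"
      using x(1) comp_vec[OF f g cocyclesD(1)[OF x(1)]] by (intro bexI[of _ x]) simp_all
  next
    fix i a w assume w: "w \<in> cocycles X i a" "cmap_comp g f i a *\<^sub>v w \<in> coboundaries Z i a"
    then show "w \<in> coboundaries X i a"
      using qisD(3)[OF assms(1) w(1)] qisD(3)[OF assms(2) cmor_cocycles[OF f w(1)]]
        comp_vec[OF f g cocyclesD(1)[OF w(1)]] by simp
  qed
qed

text \<open>The instance of two-out-of-three by which a lift of a quasi-isomorphism along a
  quasi-isomorphism is one again.\<close>

lemma qis_cancel_left:
  assumes f: "cmor n X Y f" and g: "qis n Y Z g" and gf: "qis n X Z (cmap_comp g f)"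
  shows "qis n X Y f"
proof -
  note g' = qisD(1)[OF g]
  note Y = cmorD(1)[OF g'] and Z = cmorD(2)[OF g']
  show ?thesis unfolding qis_def
  proof (intro conjI allI ballI impI f)
    fix i a y assume y: "y \<in> cocycles Y i a"
    obtain x where x: "x \<in> cocycles X i a" "cmap_comp g f i a *\<^sub>v x - g i a *\<^sub>v y \<in> coboundaries Z i a"
      using qisD(2)[OF gf cmor_cocycles[OF g' y]] by blast
    then have "g i a *\<^sub>v (f i a *\<^sub>v x - y) \<in> coboundaries Z i a"
      using comp_vec[OF f g' cocyclesD(1)[OF x(1)]] cocyclesD(1)[OF y] cmor_vec_carrier[OF f, of i a x]
      by (simp add: mat_vec_linear cmor_dims[OF g'])
    then have "f i a *\<^sub>v x - y \<in> coboundaries Y i a"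
      using qisD(3)[OF g] vsubD(6)[OF vsub_cocycles[OF Y]] cmor_cocycles[OF f x(1)] y by blast
    then show "\<exists>w\<in>cocycles X i a. f i a *\<^sub>v w - y \<in> coboundaries Y i a" using x(1) by blast
  next
    fix i a w assume w: "w \<in> cocycles X i a" "f i a *\<^sub>v w \<in> coboundaries Y i a"
    have "cmap_comp g f i a *\<^sub>v w \<in> coboundaries Z i a"
      using cmor_coboundaries[OF g' w(2)] comp_vec[OF f g' cocyclesD(1)[OF w(1)]] by simp
    then show "w \<in> coboundaries X i a" using qisD(3)[OF gf w(1)] by blast
  qed
qed

lemma qis_htpy_equiv:
  assumes "cmor n X Y f" "cmor n Y X g"
    "chtpy n X X (cmap_comp g f) (cmap_id X)" "chtpy n Y Y (cmap_comp f g) (cmap_id Y)"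
  shows "qis n X Y f"
proof -
  note X = cmorD(1)[OF assms(1)] and Y = cmorD(2)[OF assms(1)]
  have gf: "qis n X X (cmap_comp g f)" using qis_chtpy[OF chtpy_sym[OF assms(3)] qis_id[OF X]] .
  have fg: "qis n Y Y (cmap_comp f g)" using qis_chtpy[OF chtpy_sym[OF assms(4)] qis_id[OF Y]] .
  show ?thesis unfolding qis_def
  proof (intro conjI allI ballI impI assms(1))
    fix i a z assume "z \<in> cocycles Y i a"
    then obtain w where "w \<in> cocycles Y i a" "cmap_comp f g i a *\<^sub>v w - z \<in> coboundaries Y i a"
      using qisD(2)[OF fg] by blast
    then show "\<exists>w\<in>cocycles X i a. f i a *\<^sub>v w - z \<in> coboundaries Y i a"
      using comp_vec[OF assms(2,1) cocyclesD(1)] cmor_cocycles[OF assms(2)] by metis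
  next
    fix i a w assume w: "w \<in> cocycles X i a" "f i a *\<^sub>v w \<in> coboundaries Y i a"
    then show "w \<in> coboundaries X i a"
      using qisD(3)[OF gf w(1)] cmor_coboundaries[OF assms(2) w(2)]
        comp_vec[OF assms(1,2) cocyclesD(1)[OF w(1)]] by simp
  qed
qed

section \<open>K-projective complexes and morphisms in the derived category\<close>

text \<open>Allows homotopies to be studied only for null-homotopic maps, as in the second clause of
  \<open>kproj\<close> and in \<open>Pcx_null_iff\<close>.\<close>

lemma chtpy_iff_diff:
  assumes f: "cmor n X Y f" and g: "cmor n X Y g"
  shows "chtpy n X Y f g \<longleftrightarrow> chtpy n X Y (cmap_add f (cmap_smult (- 1) g)) (cmap_zero X Y)"
proof -
  have eq: "cmap_add f (cmap_smult (- 1) g) i a - cmap_zero X Y i a = f i a - g i a" for i a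
    by (intro eq_matI) (simp_all add: cmap_add_def cmap_smult_def cmap_zero_def cmor_dims[OF f] cmor_dims[OF g])
  have "cmor n X Y (cmap_add f (cmap_smult (- 1) g))" using cmor_lin f g by blast
  then show ?thesis using f g cmor_zero[OF cmorD(1,2)[OF f]]
    by (simp add: chtpy_def homotopic_def eq)
qed

text \<open>K-projectivity relative to bounded complexes: composition with a quasi-isomorphism
  \<open>t\<close> is bijective on homotopy classes of chain maps out of \<open>P\<close>, split
  into surjectivity and trivial kernel. It is phrased by lifts rather than by maps into acyclic
  complexes, since roofs are turned into chain maps by lifting along their denominators.\<close>

definition kproj :: "nat \<Rightarrow> 'k::field cpx \<Rightarrow> bool" where
  "kproj n P \<longleftrightarrow> is_cpx n P \<and> (\<forall>W Y t. qis n W Y t \<longrightarrow>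
     (\<forall>g. cmor n P Y g \<longrightarrow> (\<exists>f. cmor n P W f \<and> chtpy n P Y (cmap_comp t f) g)) \<and>
     (\<forall>f. cmor n P W f \<and> chtpy n P Y (cmap_comp t f) (cmap_zero P Y) \<longrightarrow> chtpy n P W f (cmap_zero P W)))"

lemma kproj_cpx: "kproj n P \<Longrightarrow> is_cpx n P"
  by (simp add: kproj_def)

lemma kproj_lift:
  assumes "kproj n P" "qis n W Y t" "cmor n P Y g"
  obtains f where "cmor n P W f" "chtpy n P Y (cmap_comp t f) g"
  using assms unfolding kproj_def by blast

lemma kproj_null:
  assumes "kproj n P" "qis n W Y t" "cmor n P W f" "chtpy n P Y (cmap_comp t f) (cmap_zero P Y)"
  shows "chtpy n P W f (cmap_zero P W)"
  using assms unfolding kproj_def by blast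

lemma kproj_cancel:
  assumes P: "kproj n P" and t: "qis n W Y t" and f: "cmor n P W f" and g: "cmor n P W g"
    and h: "chtpy n P Y (cmap_comp t f) (cmap_comp t g)"
  shows "chtpy n P W f g"
proof -
  note t' = qisD(1)[OF t]
  have tf: "cmor n P Y (cmap_comp t f)" and tg: "cmor n P Y (cmap_comp t g)"
    using cmor_comp[OF f t'] cmor_comp[OF g t'] .
  have g': "cmor n P W (cmap_smult (- 1) g)" using cmor_lin[OF g g] by blast
  have "chtpy n P Y (cmap_add (cmap_comp t f) (cmap_smult (- 1) (cmap_comp t g))) (cmap_zero P Y)"
    using chtpy_iff_diff[OF tf tg] h by blast
  then have "chtpy n P Y (cmap_comp t (cmap_add f (cmap_smult (- 1) g))) (cmap_zero P Y)"
    unfolding comp_add[OF f g' t'] comp_smult[OF g t'] .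
  then have "chtpy n P W (cmap_add f (cmap_smult (- 1) g)) (cmap_zero P W)"
    using kproj_null[OF P t] cmor_lin(1)[OF f g'] by blast
  then show ?thesis using chtpy_iff_diff[OF f g] by blast
qed

section \<open>Roofs evaluated on a resolution of the source\<close>

lemma roofs_iff:
  assumes "is_cpx n X" "is_cpx n Y"
  shows "(Z, s, f) \<in> roofs n X Y \<longleftrightarrow> qis n Z X s \<and> cmor n Z Y f"
  using assms quasi_iso_iff[of n Z X s] by (auto simp: roofs_def cmor_def qis_def)

text \<open>
  Through a quasi-isomorphism \<open>q : P \<rightarrow> X\<close> from a K-projective complex, morphisms \<open>X \<rightarrow> Y\<close> in the
  derived category become homotopy classes of chain maps \<open>P \<rightarrow> Y\<close>; \<open>roof_val\<close> relates a roof to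
  the chain maps in its class.
\<close>

definition roof_val ::
  "nat \<Rightarrow> 'k::field cpx \<Rightarrow> 'k cpx \<Rightarrow> 'k cpx \<Rightarrow> 'k cmap \<Rightarrow> 'k roof \<Rightarrow> 'k cmap \<Rightarrow> bool" where
  "roof_val n X Y P q = (\<lambda>(Z, s, f) g.
     \<exists>a. cmor n P Z a \<and> chtpy n P X (cmap_comp s a) q \<and> chtpy n P Y (cmap_comp f a) g)"

text \<open>The candidate for the morphism represented by the chain map \<open>g\<close>; for a
  resolution \<open>q\<close> these sets turn out to be exactly the elements of
  \<open>D_hom n X Y\<close>.\<close>

definition roof_set ::
  "nat \<Rightarrow> 'k::field cpx \<Rightarrow> 'k cpx \<Rightarrow> 'k cpx \<Rightarrow> 'k cmap \<Rightarrow> 'k cmap \<Rightarrow> 'k roof set" where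
  "roof_set n X Y P q g = {r \<in> roofs n X Y. roof_val n X Y P q r g}"

text \<open>Only the source is resolved: a chain map out of \<open>P\<close> can be lifted along the
  denominator of any roof that starts at \<open>X\<close>, while the target stays arbitrary.\<close>

locale resolved =
  fixes n :: nat and X Y P :: "'k::field cpx" and q :: "'k cmap"
  assumes kproj: "kproj n P" and q: "qis n P X q" and Y: "is_cpx n Y"
begin

lemma P: "is_cpx n P" using kproj kproj_cpx by blast

lemma X: "is_cpx n X" using qisD(1)[OF q] cmorD by blast

lemma q_mor: "cmor n P X q" using qisD(1)[OF q] .

lemma val_ex:
  assumes "r \<in> roofs n X Y"
  obtains g where "cmor n P Y g" "roof_val n X Y P q r g"
proof -
  obtain Z s f where r: "r = (Z, s, f)" by (cases r)
  then have s: "qis n Z X s" and f: "cmor n Z Y f" using assms roofs_iff[OF X Y] by auto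
  obtain a where a: "cmor n P Z a" "chtpy n P X (cmap_comp s a) q"
    using kproj_lift[OF kproj s q_mor] .
  then show ?thesis
    using that[of "cmap_comp f a"] cmor_comp[OF a(1) f] chtpy_refl[OF cmor_comp[OF a(1) f]]
    by (auto simp: roof_val_def r)
qed

lemma val_unique:
  assumes "r \<in> roofs n X Y" "roof_val n X Y P q r g" "roof_val n X Y P q r g'"
  shows "chtpy n P Y g g'"
proof -
  obtain Z s f where r: "r = (Z, s, f)" by (cases r)
  then have s: "qis n Z X s" and f: "cmor n Z Y f" using assms roofs_iff[OF X Y] by auto
  obtain a where a: "cmor n P Z a" "chtpy n P X (cmap_comp s a) q" "chtpy n P Y (cmap_comp f a) g"
    using assms(2) r by (auto simp: roof_val_def)
  obtain b where b: "cmor n P Z b" "chtpy n P X (cmap_comp s b) q" "chtpy n P Y (cmap_comp f b) g'"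
    using assms(3) r by (auto simp: roof_val_def)
  have "chtpy n P Z a b"
    using kproj_cancel[OF kproj s a(1) b(1)] chtpy_trans[OF a(2) chtpy_sym[OF b(2)]] by blast
  then have "chtpy n P Y (cmap_comp f a) (cmap_comp f b)" using chtpy_comp_left f by blast
  then show ?thesis using a(3) b(3) chtpy_sym chtpy_trans by blast
qed

lemma val_cong:
  "roof_val n X Y P q r g \<Longrightarrow> chtpy n P Y g g' \<Longrightarrow> roof_val n X Y P q r g'"
  unfolding roof_val_def using chtpy_trans by (cases r) blast

lemma val_roof:
  assumes "cmor n P Y g"
  shows "(P, q, g) \<in> roofs n X Y" "roof_val n X Y P q (P, q, g) g"
  using assms q cmor_id[OF P] comp_id[OF assms] comp_id[OF q_mor] chtpy_refl[OF assms] chtpy_refl[OF q_mor]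
  by (auto simp: roofs_iff[OF X Y] roof_val_def intro!: exI[of _ "cmap_id P"])

text \<open>If \<open>W\<close> dominates both roofs, lifting \<open>q\<close> along the denominator
  of \<open>W\<close> and continuing to both roofs gives a common value. Conversely, the lifts of
  \<open>q\<close> that witness a common value make \<open>P\<close> itself a dominating
  complex.\<close>

lemma roof_rel_iff:
  assumes r: "r \<in> roofs n X Y" and r': "r' \<in> roofs n X Y"
  shows "(r, r') \<in> roof_rel n X Y \<longleftrightarrow> (\<exists>g. roof_val n X Y P q r g \<and> roof_val n X Y P q r' g)"
proof -
  obtain Z s f where rr: "r = (Z, s, f)" by (cases r)
  obtain Z' s' f' where rr': "r' = (Z', s', f')" by (cases r')
  have s: "qis n Z X s" and f: "cmor n Z Y f" and s': "qis n Z' X s'" and f': "cmor n Z' Y f'"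
    using r r' rr rr' roofs_iff[OF X Y] by auto
  note sm = qisD(1)[OF s] and sm' = qisD(1)[OF s']
  show ?thesis
  proof
    assume "(r, r') \<in> roof_rel n X Y"
    then obtain W u u' where W: "is_cpx n W" and u: "chain_map W Z u" and u': "chain_map W Z' u'"
      and su: "quasi_iso W X (cmap_comp s u)"
      and h: "homotopic W X (cmap_comp s u) (cmap_comp s' u')"
      and k: "homotopic W Y (cmap_comp f u) (cmap_comp f' u')"
      by (auto simp: roof_rel_def rr rr')
    have u: "cmor n W Z u" and u': "cmor n W Z' u'"
      using u u' W cmorD[OF f] cmorD[OF f'] by (auto simp: cmor_def)
    have su: "qis n W X (cmap_comp s u)" using su quasi_iso_iff[OF W X] by blast
    have h: "chtpy n W X (cmap_comp s u) (cmap_comp s' u')"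
      using h cmor_comp[OF u sm] cmor_comp[OF u' sm'] by (simp add: chtpy_def)
    have k: "chtpy n W Y (cmap_comp f u) (cmap_comp f' u')"
      using k cmor_comp[OF u f] cmor_comp[OF u' f'] by (simp add: chtpy_def)
    obtain b where b: "cmor n P W b" "chtpy n P X (cmap_comp (cmap_comp s u) b) q"
      using kproj_lift[OF kproj su q_mor] .
    have ub: "cmor n P Z (cmap_comp u b)" and ub': "cmor n P Z' (cmap_comp u' b)"
      using cmor_comp b(1) u u' by blast+
    have 1: "chtpy n P X (cmap_comp s (cmap_comp u b)) q"
      using b(2) comp_assoc[OF b(1) u sm] by simp
    have "chtpy n P X (cmap_comp s (cmap_comp u b)) (cmap_comp s' (cmap_comp u' b))"
      using chtpy_comp_right[OF h b(1)] comp_assoc[OF b(1) u sm] comp_assoc[OF b(1) u' sm'] by simp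
    then have 2: "chtpy n P X (cmap_comp s' (cmap_comp u' b)) q"
      using 1 chtpy_sym chtpy_trans by blast
    have 3: "chtpy n P Y (cmap_comp f (cmap_comp u b)) (cmap_comp f' (cmap_comp u' b))"
      using chtpy_comp_right[OF k b(1)] comp_assoc[OF b(1) u f] comp_assoc[OF b(1) u' f'] by simp
    have "roof_val n X Y P q r (cmap_comp f' (cmap_comp u' b))"
      using ub 1 3 by (auto simp: roof_val_def rr)
    moreover have "roof_val n X Y P q r' (cmap_comp f' (cmap_comp u' b))"
      using ub' 2 chtpy_refl[OF cmor_comp[OF ub' f']] by (auto simp: roof_val_def rr')
    ultimately show "\<exists>g. roof_val n X Y P q r g \<and> roof_val n X Y P q r' g" by blast
  next
    assume "\<exists>g. roof_val n X Y P q r g \<and> roof_val n X Y P q r' g"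
    then obtain g a b where a: "cmor n P Z a" "chtpy n P X (cmap_comp s a) q" "chtpy n P Y (cmap_comp f a) g"
      and b: "cmor n P Z' b" "chtpy n P X (cmap_comp s' b) q" "chtpy n P Y (cmap_comp f' b) g"
      by (auto simp: roof_val_def rr rr')
    have "homotopic P X (cmap_comp s a) (cmap_comp s' b)"
      "homotopic P Y (cmap_comp f a) (cmap_comp f' b)"
      using a b chtpy_sym chtpy_trans chtpyD(3) by blast+
    moreover have "quasi_iso P X (cmap_comp s a)"
      using qis_chtpy[OF chtpy_sym[OF a(2)] q] quasi_iso_iff[OF P X] by blast
    ultimately show "(r, r') \<in> roof_rel n X Y"
      using r r' P cmorD(3)[OF a(1)] cmorD(3)[OF b(1)] unfolding rr rr' roof_rel_def by blast
  qed
qed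

text \<open>Values are unique up to homotopy, so any common value of \<open>r\<close> and
  \<open>r'\<close> may be replaced by the given \<open>g\<close>.\<close>

lemma roof_class_eq:
  assumes "r \<in> roofs n X Y" "roof_val n X Y P q r g"
  shows "roof_class n X Y r = roof_set n X Y P q g"
proof -
  have "(r, r') \<in> roof_rel n X Y \<longleftrightarrow> r' \<in> roofs n X Y \<and> roof_val n X Y P q r' g" for r'
  proof (cases "r' \<in> roofs n X Y")
    case True
    then show ?thesis using roof_rel_iff[OF assms(1) True] assms val_unique val_cong chtpy_sym by blast
  next
    case False
    then show ?thesis by (auto simp: roof_rel_def)
  qed
  then show ?thesis by (auto simp: roof_class_def roof_set_def)
qed

lemma roof_set_eq_iff:
  assumes "cmor n P Y g" "cmor n P Y g'"
  shows "roof_set n X Y P q g = roof_set n X Y P q g' \<longleftrightarrow> chtpy n P Y g g'"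
proof
  assume "roof_set n X Y P q g = roof_set n X Y P q g'"
  then have "roof_val n X Y P q (P, q, g) g'" using val_roof[OF assms(1)] by (auto simp: roof_set_def)
  then show "chtpy n P Y g g'" using val_unique val_roof[OF assms(1)] by blast
next
  assume "chtpy n P Y g g'"
  then show "roof_set n X Y P q g = roof_set n X Y P q g'"
    using val_cong chtpy_sym unfolding roof_set_def by blast
qed

lemma D_hom_eq: "D_hom n X Y = roof_set n X Y P q ` {g. cmor n P Y g}"
proof -
  have "D_hom n X Y = roof_class n X Y ` roofs n X Y"
    by (auto simp: D_hom_def quotient_def roof_class_def)
  also have "\<dots> = roof_set n X Y P q ` {g. cmor n P Y g}"
  proof (intro equalityI subsetI)
    fix C assume "C \<in> roof_class n X Y ` roofs n X Y"
    then obtain r where r: "r \<in> roofs n X Y" "C = roof_class n X Y r" by blast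
    obtain g where "cmor n P Y g" "roof_val n X Y P q r g" using val_ex[OF r(1)] .
    then show "C \<in> roof_set n X Y P q ` {g. cmor n P Y g}" using roof_class_eq r by blast
  next
    fix C assume "C \<in> roof_set n X Y P q ` {g. cmor n P Y g}"
    then show "C \<in> roof_class n X Y ` roofs n X Y" using roof_class_eq val_roof by blast
  qed
  finally show ?thesis .
qed

lemma D_zero_eq: "D_zero n X Y = roof_set n X Y P q (cmap_zero P Y)"
proof -
  have "(X, cmap_id X, cmap_zero X Y) \<in> roofs n X Y"
    using qis_id[OF X] cmor_zero[OF X Y] by (simp add: roofs_iff[OF X Y])
  moreover have "roof_val n X Y P q (X, cmap_id X, cmap_zero X Y) (cmap_zero P Y)"
    using q_mor comp_id[OF q_mor] comp_zero[OF q_mor] chtpy_refl[OF q_mor] chtpy_refl[OF cmor_zero[OF P Y]]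
    by (auto simp: roof_val_def)
  ultimately show ?thesis unfolding D_zero_def by (rule roof_class_eq)
qed

lemma D_hom_is_zero_iff:
  "D_hom_is_zero n X Y \<longleftrightarrow> (\<forall>g. cmor n P Y g \<longrightarrow> chtpy n P Y g (cmap_zero P Y))"
proof -
  have z: "cmor n P Y (cmap_zero P Y)" using cmor_zero[OF P Y] .
  show ?thesis
  proof
    assume L: "D_hom_is_zero n X Y"
    have "roof_set n X Y P q g = roof_set n X Y P q (cmap_zero P Y)" if "cmor n P Y g" for g
      using L imageI[of g "{g. cmor n P Y g}" "roof_set n X Y P q"] that
      unfolding D_hom_is_zero_def D_hom_eq D_zero_eq by auto
    then show "\<forall>g. cmor n P Y g \<longrightarrow> chtpy n P Y g (cmap_zero P Y)"
      using roof_set_eq_iff[OF _ z] by metis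
  next
    assume "\<forall>g. cmor n P Y g \<longrightarrow> chtpy n P Y g (cmap_zero P Y)"
    then have "\<forall>g. cmor n P Y g \<longrightarrow> roof_set n X Y P q g = roof_set n X Y P q (cmap_zero P Y)"
      using roof_set_eq_iff[OF _ z] by simp
    then have "roof_set n X Y P q ` {g. cmor n P Y g} \<subseteq> {roof_set n X Y P q (cmap_zero P Y)}"
      by blast
    moreover have "roof_set n X Y P q (cmap_zero P Y) \<in> roof_set n X Y P q ` {g. cmor n P Y g}"
      using z by (intro imageI) simp
    ultimately show "D_hom_is_zero n X Y"
      unfolding D_hom_is_zero_def D_hom_eq D_zero_eq by blast
  qed
qed

text \<open>Two roofs with a common denominator can be evaluated with the same lift \<open>a\<close>
  of \<open>q\<close>, hence their values add, and all choices of representatives give one class.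
  The roofs \<open>(P, q, f)\<close> and \<open>(P, q, g)\<close> show that there is such a choice,
  without which the union would be empty.\<close>

lemma D_add_eq:
  assumes f: "cmor n P Y f" and g: "cmor n P Y g"
  shows "D_add n X Y (roof_set n X Y P q f) (roof_set n X Y P q g) = roof_set n X Y P q (cmap_add f g)"
proof -
  have 1: "roof_class n X Y (Z, s, cmap_add f' g') = roof_set n X Y P q (cmap_add f g)"
    if fg: "(Z, s, f') \<in> roof_set n X Y P q f" "(Z, s, g') \<in> roof_set n X Y P q g" for Z s f' g'
  proof (rule roof_class_eq)
    have s: "qis n Z X s" and f': "cmor n Z Y f'" and g': "cmor n Z Y g'"
      using fg by (auto simp: roof_set_def roofs_iff[OF X Y])
    then show "(Z, s, cmap_add f' g') \<in> roofs n X Y"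
      using cmor_lin(1) by (auto simp: roofs_iff[OF X Y])
    obtain a where a: "cmor n P Z a" "chtpy n P X (cmap_comp s a) q" "chtpy n P Y (cmap_comp f' a) f"
      using fg(1) by (auto simp: roof_set_def roof_val_def)
    \<comment> \<open>The value \<open>g\<close> may have been witnessed by another lift than
      \<open>a\<close>; uniqueness of values makes \<open>a\<close> serve for both
      numerators.\<close>
    have "roof_val n X Y P q (Z, s, g') (cmap_comp g' a)"
      using a chtpy_refl[OF cmor_comp[OF a(1) g']] by (auto simp: roof_val_def)
    then have "chtpy n P Y (cmap_comp g' a) g"
      using val_unique[of "(Z, s, g')"] fg(2) by (auto simp: roof_set_def)
    then have "chtpy n P Y (cmap_comp (cmap_add f' g') a) (cmap_add f g)"
      unfolding add_comp[OF f' g' a(1)] by (rule chtpy_add[OF a(3)])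
    then show "roof_val n X Y P q (Z, s, cmap_add f' g') (cmap_add f g)"
      using a by (auto simp: roof_val_def)
  qed
  moreover have "(P, q, f) \<in> roof_set n X Y P q f" "(P, q, g) \<in> roof_set n X Y P q g"
    using val_roof[OF f] val_roof[OF g] by (auto simp: roof_set_def)
  ultimately have "{roof_class n X Y (Z, s, cmap_add f' g') | Z s f' g'.
      (Z, s, f') \<in> roof_set n X Y P q f \<and> (Z, s, g') \<in> roof_set n X Y P q g} = {roof_set n X Y P q (cmap_add f g)}"
    by blast
  then show ?thesis unfolding D_add_def by simp
qed

lemma D_smult_eq:
  assumes f: "cmor n P Y f"
  shows "D_smult n X Y c (roof_set n X Y P q f) = roof_set n X Y P q (cmap_smult c f)"
proof -
  have 1: "roof_class n X Y (Z, s, cmap_smult c f') = roof_set n X Y P q (cmap_smult c f)"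
    if fg: "(Z, s, f') \<in> roof_set n X Y P q f" for Z s f'
  proof (rule roof_class_eq)
    have s: "qis n Z X s" and f': "cmor n Z Y f'"
      using fg by (auto simp: roof_set_def roofs_iff[OF X Y])
    then show "(Z, s, cmap_smult c f') \<in> roofs n X Y"
      using cmor_lin(2) by (auto simp: roofs_iff[OF X Y])
    obtain a where a: "cmor n P Z a" "chtpy n P X (cmap_comp s a) q" "chtpy n P Y (cmap_comp f' a) f"
      using fg(1) by (auto simp: roof_set_def roof_val_def)
    have "chtpy n P Y (cmap_comp (cmap_smult c f') a) (cmap_smult c f)"
      unfolding smult_comp[OF f' a(1)] by (rule chtpy_smult[OF a(3)])
    then show "roof_val n X Y P q (Z, s, cmap_smult c f') (cmap_smult c f)"
      using a by (auto simp: roof_val_def)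
  qed
  moreover have "(P, q, f) \<in> roof_set n X Y P q f"
    using val_roof[OF f] by (auto simp: roof_set_def)
  ultimately have "{roof_class n X Y (Z, s, cmap_smult c f') | Z s f'.
      (Z, s, f') \<in> roof_set n X Y P q f} = {roof_set n X Y P q (cmap_smult c f)}"
    by blast
  then show ?thesis unfolding D_smult_def by simp
qed

lemma D_hom_iso_fieldI:
  assumes g: "cmor n P Y g" and all: "\<And>f. cmor n P Y f \<Longrightarrow> \<exists>c. chtpy n P Y f (cmap_smult c g)"
    and nz: "\<And>c. chtpy n P Y (cmap_smult c g) (cmap_zero P Y) \<Longrightarrow> c = 0"
  shows "D_hom_iso_field n X Y"
  unfolding D_hom_iso_field_def
proof (intro exI[of _ "\<lambda>c. roof_set n X Y P q (cmap_smult c g)"] conjI allI)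
  have cg: "cmor n P Y (cmap_smult c g)" for c using cmor_lin(2)[OF g g] .
  have add: "cmap_add (cmap_smult a g) (cmap_smult b g) = cmap_smult (a + b) g" for a b
    by (intro ext eq_matI) (simp_all add: cmap_add_def cmap_smult_def algebra_simps)
  have mult: "cmap_smult a (cmap_smult b g) = cmap_smult (a * b) g" for a b
    by (intro ext eq_matI) (simp_all add: cmap_add_def cmap_smult_def algebra_simps)
  show "roof_set n X Y P q (cmap_smult (a + b) g) =
      D_add n X Y (roof_set n X Y P q (cmap_smult a g)) (roof_set n X Y P q (cmap_smult b g))" for a b
    unfolding D_add_eq[OF cg cg] add ..
  show "roof_set n X Y P q (cmap_smult (c * a) g) =
      D_smult n X Y c (roof_set n X Y P q (cmap_smult a g))" for c a
    unfolding D_smult_eq[OF cg] mult ..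
  show "bij_betw (\<lambda>c. roof_set n X Y P q (cmap_smult c g)) UNIV (D_hom n X Y)"
    unfolding bij_betw_def
  proof
    show "inj (\<lambda>c. roof_set n X Y P q (cmap_smult c g))"
    proof (rule injI)
      fix a b assume "roof_set n X Y P q (cmap_smult a g) = roof_set n X Y P q (cmap_smult b g)"
      then have "chtpy n P Y (cmap_smult a g) (cmap_smult b g)"
        using roof_set_eq_iff[OF cg cg] by blast
      then have "chtpy n P Y (cmap_smult (a + (- 1) * b) g) (cmap_zero P Y)"
        unfolding chtpy_iff_diff[OF cg cg] mult add .
      then show "a = b" using nz by fastforce
    qed
    show "range (\<lambda>c. roof_set n X Y P q (cmap_smult c g)) = D_hom n X Y"
      unfolding D_hom_eq using roof_set_eq_iff[OF _ cg] cg all by blast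
  qed
qed

text \<open>If all maps were null-homotopic, \<open>D_hom n X Y\<close> would have one element, but
  a field has the two elements \<open>0\<close> and \<open>1\<close>.\<close>

lemma D_hom_iso_field_nontrivial:
  assumes "D_hom_iso_field n X Y"
  shows "\<exists>g. cmor n P Y g \<and> \<not> chtpy n P Y g (cmap_zero P Y)"
proof (rule ccontr)
  assume neg: "\<not> ?thesis"
  obtain \<phi> :: "'k \<Rightarrow> 'k roof set" where \<phi>: "bij_betw \<phi> UNIV (D_hom n X Y)"
    using assms by (auto simp: D_hom_iso_field_def)
  have z: "cmor n P Y (cmap_zero P Y)" using cmor_zero[OF P Y] .
  have "C = roof_set n X Y P q (cmap_zero P Y)" if "C \<in> D_hom n X Y" for C
    using that neg roof_set_eq_iff[OF _ z] unfolding D_hom_eq by blast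
  then have "\<phi> 0 = \<phi> 1" using \<phi> by (metis UNIV_I bij_betwE)
  then show False using \<phi> by (metis bij_betw_def UNIV_I inj_on_eq_iff zero_neq_one)
qed

text \<open>The one-dimensionality of the space of morphisms, in the form in which it forbids a
  second summand of an exceptional object.\<close>

lemma D_hom_iso_field_dependent:
  assumes iso: "D_hom_iso_field n X Y" and f: "cmor n P Y f" and g: "cmor n P Y g"
  shows "\<exists>a b. (a \<noteq> 0 \<or> b \<noteq> 0) \<and> chtpy n P Y (cmap_add (cmap_smult a f) (cmap_smult b g)) (cmap_zero P Y)"
proof -
  obtain \<phi> :: "'k \<Rightarrow> 'k roof set" where \<phi>: "bij_betw \<phi> UNIV (D_hom n X Y)"
    and add: "\<And>a b. \<phi> (a + b) = D_add n X Y (\<phi> a) (\<phi> b)"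
    and mult: "\<And>c a. \<phi> (c * a) = D_smult n X Y c (\<phi> a)"
    using iso unfolding D_hom_iso_field_def by blast
  let ?S = "roof_set n X Y P q"
  have z: "cmor n P Y (cmap_zero P Y)" using cmor_zero[OF P Y] .
  have cm: "cmor n P Y (cmap_smult c h)" if "cmor n P Y h" for c h using cmor_lin(2)[OF that that] .
  have surj: "range \<phi> = ?S ` {g. cmor n P Y g}" using \<phi> unfolding D_hom_eq bij_betw_def by simp
  have "?S f \<in> range \<phi>" "?S g \<in> range \<phi>" "\<phi> 0 \<in> ?S ` {g. cmor n P Y g}"
    unfolding surj using f g surj by auto
  then obtain x y h where x: "\<phi> x = ?S f" and y: "\<phi> y = ?S g" and h: "\<phi> 0 = ?S h" "cmor n P Y h"
    by (metis (no_types, lifting) imageE mem_Collect_eq)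
  \<comment> \<open>Compatibility of \<open>\<phi>\<close> is given for sums and multiples only;
    that \<open>0\<close> goes to the zero morphism is read off from multiplication by the scalar
    \<open>0\<close>.\<close>
  have "\<phi> 0 = D_smult n X Y 0 (\<phi> 0)" using mult[of 0 0] by simp
  also have "\<dots> = ?S (cmap_zero P Y)" unfolding h(1) D_smult_eq[OF h(2)] zero_smult_cmor[OF h(2)] ..
  finally have \<phi>0: "\<phi> 0 = ?S (cmap_zero P Y)" .
  have comb: "chtpy n P Y (cmap_add (cmap_smult a f) (cmap_smult b g)) (cmap_zero P Y)"
    if "a * x + b * y = 0" for a b
  proof -
    have "?S (cmap_add (cmap_smult a f) (cmap_smult b g)) = \<phi> (a * x + b * y)"
      unfolding add mult x y D_smult_eq[OF f] D_smult_eq[OF g] D_add_eq[OF cm[OF f] cm[OF g]] ..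
    also have "\<dots> = ?S (cmap_zero P Y)" using that \<phi>0 by simp
    finally show ?thesis using roof_set_eq_iff[OF cmor_lin(1)[OF cm[OF f] cm[OF g]] z] by blast
  qed
  show ?thesis
  \<comment> \<open>With coordinates \<open>x\<close> and \<open>y\<close> the relation has the
    coefficients \<open>- y\<close> and \<open>x\<close>. These could both vanish for
    \<open>x = 0\<close>, where \<open>1\<close> and \<open>0\<close> are taken instead.\<close>
  proof (cases "x = 0")
    case True
    then show ?thesis using comb[of 1 0] by (intro exI[of _ 1] exI[of _ 0]) simp
  next
    case False
    then show ?thesis using comb[of "- y" x] by (intro exI[of _ "- y"] exI[of _ x]) simp
  qed
qed

end

text \<open>Composition read on values: \<open>f0\<close> is lifted to a map \<open>\<phi>\<close>
  between the resolutions, and the composite has the value \<open>g0\<close> after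
  \<open>\<phi>\<close>, whatever Ore completion \<open>U\<close> was chosen. The point is that
  \<open>v b\<close> and \<open>a' \<phi>\<close> agree up to homotopy because they do so after the
  quasi-isomorphism \<open>t\<close>, both being homotopic to \<open>f0\<close> there.\<close>

lemma roof_val_comp:
  assumes P: "kproj n P" "qis n P X q" and V: "is_cpx n V" and q': "qis n P' Y q'"
    and r: "(Z, s, f) \<in> roofs n X Y" "roof_val n X Y P q (Z, s, f) f0"
    and r': "(W, t, g) \<in> roofs n Y V" "roof_val n Y V P' q' (W, t, g) g0"
    and u: "quasi_iso U Z u" and v: "chain_map U W v" and U: "is_cpx n U"
    and h: "homotopic U Y (cmap_comp f u) (cmap_comp t v)"
    and \<phi>: "cmor n P P' \<phi>" "chtpy n P Y (cmap_comp q' \<phi>) f0"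
  shows "(U, cmap_comp s u, cmap_comp g v) \<in> roofs n X V"
    "roof_val n X V P q (U, cmap_comp s u, cmap_comp g v) (cmap_comp g0 \<phi>)"
proof -
  have X: "is_cpx n X" and Y: "is_cpx n Y" using qisD(1)[OF P(2)] qisD(1)[OF q'] cmorD by blast+
  have s: "qis n Z X s" and f: "cmor n Z Y f" using r roofs_iff[OF X Y] by auto
  have t: "qis n W Y t" and g: "cmor n W V g" using r' roofs_iff[OF Y V] by auto
  have u: "qis n U Z u" using u quasi_iso_iff[OF U cmorD(1)[OF f]] by blast
  have v: "cmor n U W v" using v U cmorD(1)[OF g] by (simp add: cmor_def)
  note sm = qisD(1)[OF s] and tm = qisD(1)[OF t] and um = qisD(1)[OF u]
  have h: "chtpy n U Y (cmap_comp f u) (cmap_comp t v)"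
    using h cmor_comp[OF um f] cmor_comp[OF v tm] by (simp add: chtpy_def)
  show "(U, cmap_comp s u, cmap_comp g v) \<in> roofs n X V"
    using qis_comp[OF u s] cmor_comp[OF v g] by (simp add: roofs_iff[OF X V])
  obtain a where a: "cmor n P Z a" "chtpy n P X (cmap_comp s a) q" "chtpy n P Y (cmap_comp f a) f0"
    using r(2) by (auto simp: roof_val_def)
  obtain a' where a': "cmor n P' W a'" "chtpy n P' Y (cmap_comp t a') q'" "chtpy n P' V (cmap_comp g a') g0"
    using r'(2) by (auto simp: roof_val_def)
  obtain b where b: "cmor n P U b" "chtpy n P Z (cmap_comp u b) a" using kproj_lift[OF P(1) u a(1)] .
  have vb: "cmor n P W (cmap_comp v b)" and a\<phi>: "cmor n P W (cmap_comp a' \<phi>)"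
    using cmor_comp b(1) v a'(1) \<phi>(1) by blast+
  have 1: "chtpy n P X (cmap_comp (cmap_comp s u) b) q"
    using chtpy_trans[OF chtpy_comp_left[OF b(2) sm] a(2)] comp_assoc[OF b(1) um sm] by simp
  have "chtpy n P Y (cmap_comp t (cmap_comp v b)) (cmap_comp f (cmap_comp u b))"
    using chtpy_comp_right[OF chtpy_sym[OF h] b(1)] comp_assoc[OF b(1) um f] comp_assoc[OF b(1) v tm] by simp
  moreover have "chtpy n P Y (cmap_comp f (cmap_comp u b)) (cmap_comp q' \<phi>)"
    using chtpy_trans[OF chtpy_trans[OF chtpy_comp_left[OF b(2) f] a(3)] chtpy_sym[OF \<phi>(2)]] .
  moreover have "chtpy n P Y (cmap_comp q' \<phi>) (cmap_comp t (cmap_comp a' \<phi>))"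
    using chtpy_sym[OF chtpy_comp_right[OF a'(2) \<phi>(1)]] comp_assoc[OF \<phi>(1) a'(1) tm] by simp
  ultimately have "chtpy n P Y (cmap_comp t (cmap_comp v b)) (cmap_comp t (cmap_comp a' \<phi>))"
    using chtpy_trans by blast
  then have "chtpy n P W (cmap_comp v b) (cmap_comp a' \<phi>)"
    using kproj_cancel[OF P(1) t vb a\<phi>] by blast
  from chtpy_trans[OF chtpy_comp_left[OF this g]]
  have "chtpy n P V (cmap_comp (cmap_comp g v) b) (cmap_comp g0 \<phi>)"
    using chtpy_comp_right[OF a'(3) \<phi>(1)] comp_assoc[OF b(1) v g] comp_assoc[OF \<phi>(1) a'(1) g] by simp
  then show "roof_val n X V P q (U, cmap_comp s u, cmap_comp g v) (cmap_comp g0 \<phi>)"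
    using b(1) 1 by (auto simp: roof_val_def)
qed

lemma D_id_eq:
  assumes "kproj n P" "qis n P X q"
  shows "D_id n X = roof_set n X X P q q" "(X, cmap_id X, cmap_id X) \<in> roofs n X X"
    "roof_val n X X P q (X, cmap_id X, cmap_id X) q"
proof -
  note X = cmorD(2)[OF qisD(1)[OF assms(2)]]
  interpret resolved n X X P q using assms X by unfold_locales
  show 1: "(X, cmap_id X, cmap_id X) \<in> roofs n X X"
    using qis_id[OF X] cmor_id[OF X] by (simp add: roofs_iff[OF X X])
  show 2: "roof_val n X X P q (X, cmap_id X, cmap_id X) q"
    using q_mor comp_id[OF q_mor] chtpy_refl[OF q_mor] by (auto simp: roof_val_def)
  show "D_id n X = roof_set n X X P q q" unfolding D_id_def by (rule roof_class_eq[OF 1 2])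
qed

text \<open>A span of quasi-isomorphisms is inverted by exchanging its legs. A resolution
  \<open>p\<close> of \<open>Z\<close> resolves \<open>X\<close> through \<open>s\<close> and
  \<open>Y\<close> through \<open>t\<close>, so that the map between the resolutions required by
  \<open>roof_val_comp\<close> is the identity of \<open>P\<close>.\<close>

lemma D_comp_inverse_roof:
  assumes P: "kproj n P" "qis n P Z p" and s: "qis n Z X s" and t: "qis n Z Y t"
  shows "D_comp n X Y X (roof_class n Y X (Z, t, s)) (roof_class n X Y (Z, s, t)) = D_id n X"
proof -
  note X = cmorD(2)[OF qisD(1)[OF s]] and Y = cmorD(2)[OF qisD(1)[OF t]] and Z = cmorD(1)[OF qisD(1)[OF t]]
  note qX = qis_comp[OF P(2) s] and qY = qis_comp[OF P(2) t]
  interpret XY: resolved n X Y P "cmap_comp s p" using P qX Y by unfold_locales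
  interpret YX: resolved n Y X P "cmap_comp t p" using P qY X by unfold_locales
  interpret XX: resolved n X X P "cmap_comp s p" using P qX X by unfold_locales
  note rs = chtpy_refl[OF qisD(1)[OF qX]] and rt = chtpy_refl[OF qisD(1)[OF qY]]
  have 1: "(Z, s, t) \<in> roofs n X Y" "(Z, t, s) \<in> roofs n Y X"
    using s t qisD(1)[OF s] qisD(1)[OF t] by (auto simp: roofs_iff[OF X Y] roofs_iff[OF Y X])
  have 2: "roof_val n X Y P (cmap_comp s p) (Z, s, t) (cmap_comp t p)"
    "roof_val n Y X P (cmap_comp t p) (Z, t, s) (cmap_comp s p)"
    using rs rt qisD(1)[OF P(2)] by (auto simp: roof_val_def)
  have c1: "roof_class n X Y (Z, s, t) = roof_set n X Y P (cmap_comp s p) (cmap_comp t p)"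
    using XY.roof_class_eq 1 2 by blast
  have c2: "roof_class n Y X (Z, t, s) = roof_set n Y X P (cmap_comp t p) (cmap_comp s p)"
    using YX.roof_class_eq 1 2 by blast
  have all: "roof_class n X X (U, cmap_comp s' u, cmap_comp g v) = D_id n X"
    if a: "(Z', s', f) \<in> roof_class n X Y (Z, s, t)" "(W, t', g) \<in> roof_class n Y X (Z, t, s)"
      "is_cpx n U" "quasi_iso U Z' u" "chain_map U W v" "homotopic U Y (cmap_comp f u) (cmap_comp t' v)"
    for Z' s' f W t' g U u v
  proof -
    have "cmor n P P (cmap_id P)" "chtpy n P Y (cmap_comp (cmap_comp t p) (cmap_id P)) (cmap_comp t p)"
      using cmor_id[OF XY.P] rt comp_id[OF YX.q_mor] by auto
    note idP = this
    have mem: "(Z', s', f) \<in> roofs n X Y" "roof_val n X Y P (cmap_comp s p) (Z', s', f) (cmap_comp t p)"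
      "(W, t', g) \<in> roofs n Y X" "roof_val n Y X P (cmap_comp t p) (W, t', g) (cmap_comp s p)"
      using a(1,2) unfolding c1 c2 roof_set_def by auto
    note val = roof_val_comp[OF P(1) qX X qY mem a(4,5,3,6) idP, unfolded comp_id[OF XY.q_mor]]
    show ?thesis unfolding XX.roof_class_eq[OF val] D_id_eq(1)[OF P(1) qX] ..
  qed
  have refl: "(Z, s, t) \<in> roof_class n X Y (Z, s, t)" "(Z, t, s) \<in> roof_class n Y X (Z, t, s)"
    using 1 2 unfolding c1 c2 roof_set_def by auto
  \<comment> \<open>The completion by \<open>Z\<close> with identity maps shows that the family of
    composites is not empty.\<close>
  have ex: "quasi_iso Z Z (cmap_id Z)" "chain_map Z Z (cmap_id Z)"
    "homotopic Z Y (cmap_comp t (cmap_id Z)) (cmap_comp t (cmap_id Z))"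
    using qis_id[OF Z] quasi_iso_iff[OF Z Z] cmorD(3)[OF cmor_id[OF Z]]
      comp_id[OF qisD(1)[OF t]] chtpyD(3)[OF chtpy_refl[OF qisD(1)[OF t]]] by auto
  have "{roof_class n X X (U, cmap_comp s' u, cmap_comp g v) | Z' s' f W t' g U u v.
          (Z', s', f) \<in> roof_class n X Y (Z, s, t) \<and> (W, t', g) \<in> roof_class n Y X (Z, t, s) \<and>
          is_cpx n U \<and> quasi_iso U Z' u \<and> chain_map U W v \<and>
          homotopic U Y (cmap_comp f u) (cmap_comp t' v)} = {D_id n X}" (is "?S = _")
  proof (intro equalityI subsetI)
    fix C assume "C \<in> ?S"
    then show "C \<in> {D_id n X}" using all by blast
  next
    fix C assume "C \<in> {D_id n X}"
    then have "C = roof_class n X X (Z, cmap_comp s (cmap_id Z), cmap_comp s (cmap_id Z))"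
      using all[OF refl Z ex] by simp
    then show "C \<in> ?S" using refl Z ex by blast
  qed
  then show ?thesis unfolding D_comp_def by simp
qed

text \<open>An isomorphism and its inverse lift to maps \<open>\<phi>\<close> and
  \<open>\<psi>\<close> between resolutions which are inverse up to homotopy; so
  \<open>\<phi>\<close> is a quasi-isomorphism and \<open>P\<close> is the top of the required span.
  The existence of resolutions is the assumption \<open>enough\<close>, which is established by
  \<open>resolve\<close> below.\<close>

lemma D_iso_iff:
  assumes enough: "\<And>X :: 'k::field cpx. is_cpx n X \<Longrightarrow> \<exists>P q. kproj n P \<and> qis n P X q"
    and X: "is_cpx n (X :: 'k cpx)" and Y: "is_cpx n Y"
  shows "D_iso n X Y \<longleftrightarrow> (\<exists>Z s t. qis n Z X s \<and> qis n Z Y t)"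
proof
  assume "\<exists>Z s t. qis n Z X s \<and> qis n Z Y t"
  then obtain Z s t where s: "qis n Z X s" and t: "qis n Z Y t" by blast
  obtain P p where P: "kproj n P" "qis n P Z p" using enough cmorD(1)[OF qisD(1)[OF s]] by blast
  have 1: "(Z, s, t) \<in> roofs n X Y" "(Z, t, s) \<in> roofs n Y X"
    using s t qisD(1)[OF s] qisD(1)[OF t] by (auto simp: roofs_iff[OF X Y] roofs_iff[OF Y X])
  then have "roof_class n X Y (Z, s, t) \<in> D_hom n X Y" "roof_class n Y X (Z, t, s) \<in> D_hom n Y X"
    by (auto simp: D_hom_def roof_class_def quotientI)
  then show "D_iso n X Y" unfolding D_iso_def
    using D_comp_inverse_roof[OF P s t] D_comp_inverse_roof[OF P t s] by blast
next
  assume "D_iso n X Y"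
  then obtain \<alpha> \<beta> where \<alpha>: "\<alpha> \<in> D_hom n X Y" and \<beta>: "\<beta> \<in> D_hom n Y X"
    and c1: "D_comp n X Y X \<beta> \<alpha> = D_id n X" and c2: "D_comp n Y X Y \<alpha> \<beta> = D_id n Y"
    unfolding D_iso_def by blast
  obtain P q where P: "kproj n P" "qis n P X q" using enough X by blast
  obtain P' q' where P': "kproj n P'" "qis n P' Y q'" using enough Y by blast
  interpret XY: resolved n X Y P q using P Y by unfold_locales
  interpret XX: resolved n X X P q using P X by unfold_locales
  interpret YX: resolved n Y X P' q' using P' X by unfold_locales
  interpret YY: resolved n Y Y P' q' using P' Y by unfold_locales
  obtain f where f: "cmor n P Y f" "\<alpha> = roof_set n X Y P q f" using \<alpha> unfolding XY.D_hom_eq by blast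
  obtain g where g: "cmor n P' X g" "\<beta> = roof_set n Y X P' q' g" using \<beta> unfolding YX.D_hom_eq by blast
  obtain \<phi> where \<phi>: "cmor n P P' \<phi>" "chtpy n P Y (cmap_comp q' \<phi>) f" using kproj_lift[OF P(1) P'(2) f(1)] .
  obtain \<psi> where \<psi>: "cmor n P' P \<psi>" "chtpy n P' X (cmap_comp q \<psi>) g" using kproj_lift[OF P'(1) P(2) g(1)] .
  have A: "chtpy n P X (cmap_comp g \<phi>) q"
  proof -
    \<comment> \<open>The identity roof lies in one member of the union that defines the composite.
      Its value computed through that member is \<open>g\<close> after \<open>\<phi>\<close>, and
      computed directly it is \<open>q\<close>.\<close>
    have "(X, cmap_id X, cmap_id X) \<in> D_comp n X Y X \<beta> \<alpha>"
      using D_id_eq[OF P] unfolding c1 roof_set_def by auto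
    then obtain Z s f' W t g' U u v where *: "(X, cmap_id X, cmap_id X) \<in> roof_class n X X (U, cmap_comp s u, cmap_comp g' v)"
        "(Z, s, f') \<in> \<alpha>" "(W, t, g') \<in> \<beta>" "is_cpx n U" "quasi_iso U Z u" "chain_map U W v"
        "homotopic U Y (cmap_comp f' u) (cmap_comp t v)"
      unfolding D_comp_def by blast
    have **: "(U, cmap_comp s u, cmap_comp g' v) \<in> roofs n X X"
      "roof_val n X X P q (U, cmap_comp s u, cmap_comp g' v) (cmap_comp g \<phi>)"
      using roof_val_comp[OF P X P'(2) _ _ _ _ *(5,6,4,7) \<phi>] *(2,3) unfolding f g roof_set_def by auto
    have "roof_val n X X P q (X, cmap_id X, cmap_id X) (cmap_comp g \<phi>)"
      using *(1) unfolding XX.roof_class_eq[OF **] by (simp add: roof_set_def)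
    then show ?thesis using XX.val_unique D_id_eq[OF P] by blast
  qed
  have B: "chtpy n P' Y (cmap_comp f \<psi>) q'"
  proof -
    have "(Y, cmap_id Y, cmap_id Y) \<in> D_comp n Y X Y \<alpha> \<beta>"
      using D_id_eq[OF P'] unfolding c2 roof_set_def by auto
    then obtain Z s f' W t g' U u v where *: "(Y, cmap_id Y, cmap_id Y) \<in> roof_class n Y Y (U, cmap_comp s u, cmap_comp g' v)"
        "(Z, s, f') \<in> \<beta>" "(W, t, g') \<in> \<alpha>" "is_cpx n U" "quasi_iso U Z u" "chain_map U W v"
        "homotopic U X (cmap_comp f' u) (cmap_comp t v)"
      unfolding D_comp_def by blast
    have **: "(U, cmap_comp s u, cmap_comp g' v) \<in> roofs n Y Y"
      "roof_val n Y Y P' q' (U, cmap_comp s u, cmap_comp g' v) (cmap_comp f \<psi>)"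
      using roof_val_comp[OF P' Y P(2) _ _ _ _ *(5,6,4,7) \<psi>] *(2,3) unfolding f g roof_set_def by auto
    have "roof_val n Y Y P' q' (Y, cmap_id Y, cmap_id Y) (cmap_comp f \<psi>)"
      using *(1) unfolding YY.roof_class_eq[OF **] by (simp add: roof_set_def)
    then show ?thesis using YY.val_unique D_id_eq[OF P'] by blast
  qed
  have "chtpy n P X (cmap_comp q (cmap_comp \<psi> \<phi>)) (cmap_comp q (cmap_id P))"
    using chtpy_trans[OF chtpy_comp_right[OF \<psi>(2) \<phi>(1)] A]
      comp_assoc[OF \<phi>(1) \<psi>(1) XY.q_mor] comp_id[OF XY.q_mor] by simp
  then have 1: "chtpy n P P (cmap_comp \<psi> \<phi>) (cmap_id P)"
    using kproj_cancel[OF P cmor_comp[OF \<phi>(1) \<psi>(1)] cmor_id[OF XY.P]] by blast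
  have "chtpy n P' Y (cmap_comp q' (cmap_comp \<phi> \<psi>)) (cmap_comp q' (cmap_id P'))"
    using chtpy_trans[OF chtpy_comp_right[OF \<phi>(2) \<psi>(1)] B]
      comp_assoc[OF \<psi>(1) \<phi>(1) YX.q_mor] comp_id[OF YX.q_mor] by simp
  then have 2: "chtpy n P' P' (cmap_comp \<phi> \<psi>) (cmap_id P')"
    using kproj_cancel[OF P' cmor_comp[OF \<psi>(1) \<phi>(1)] cmor_id[OF YX.P]] by blast
  have "qis n P P' \<phi>" using qis_htpy_equiv[OF \<phi>(1) \<psi>(1) 1 2] .
  then have "qis n P Y f" using qis_chtpy[OF \<phi>(2)] qis_comp P'(2) by blast
  then show "\<exists>Z s t. qis n Z X s \<and> qis n Z Y t" using P(2) by blast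
qed

section \<open>Two-term complexes of projectives\<close>

text \<open>The composite of the arrow maps from the vertex \<open>j\<close> down to
  \<open>a\<close>; the value \<open>v\<close> for \<open>a > j\<close> is only a default.\<close>

function transport :: "'k::field rep \<Rightarrow> nat \<Rightarrow> nat \<Rightarrow> 'k vec \<Rightarrow> 'k vec" where
  "transport V j a v = (if a < j then rarr V a *\<^sub>v transport V j (Suc a) v else v)"
  by pat_completeness auto
termination by (relation "measure (\<lambda>(V, j, a, v). j - a)") auto

declare transport.simps [simp del]

lemma transport_step: "a < j \<Longrightarrow> transport V j a v = rarr V a *\<^sub>v transport V j (Suc a) v"
  by (subst transport.simps) simp

lemma transport_refl [simp]: "transport V j j v = v"
  by (subst transport.simps) simp

lemma transport_carrier:
  assumes "is_rep n V" "v \<in> carrier_vec (rdim V j)" "a \<le> j"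
  shows "transport V j a v \<in> carrier_vec (rdim V a)"
proof (cases "a = j")
  case False
  then show ?thesis using assms
    by (simp add: transport_step mult_mat_vec_carrier_dim is_rep_dims[OF assms(1)])
qed (use assms in simp)

lemma transport_trans:
  assumes "c \<le> a" "a \<le> j"
  shows "transport V a c (transport V j a v) = transport V j c v"
  using assms(1)
proof (induction c rule: inc_induct)
  case (step c)
  then show ?case using assms by (simp add: transport_step)
qed simp

lemma transport_linear:
  assumes V: "is_rep n V" and v: "u \<in> carrier_vec (rdim V j)" "v \<in> carrier_vec (rdim V j)" and a: "a \<le> j"
  shows "transport V j a (u + v) = transport V j a u + transport V j a v" (is ?A)
    and "transport V j a (u - v) = transport V j a u - transport V j a v" (is ?B)
    and "transport V j a (c \<cdot>\<^sub>v u) = c \<cdot>\<^sub>v transport V j a u" (is ?C)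
proof -
  have "?A \<and> ?B \<and> ?C"
    using a
  proof (induction a rule: inc_induct)
    case (step a)
    then have "transport V j (Suc a) u \<in> carrier_vec (dim_col (rarr V a))"
      "transport V j (Suc a) v \<in> carrier_vec (dim_col (rarr V a))"
      using transport_carrier[OF V v(1)] transport_carrier[OF V v(2)]
      by (simp_all add: is_rep_dims[OF V])
    then show ?case using step by (simp add: transport_step mat_vec_linear)
  qed simp
  then show ?A ?B ?C by auto
qed

lemma transport_map:
  assumes V: "is_rep n V" and W: "is_rep n W" and f: "is_repmap V W f"
    and v: "v \<in> carrier_vec (rdim V j)" and a: "a \<le> j"
  shows "f a *\<^sub>v transport V j a v = transport W j a (f j *\<^sub>v v)"
  using a
proof (induction a rule: inc_induct)
  case (step a)
  note [simp] = is_rep_dims[OF V] is_rep_dims[OF W] is_repmap_dims[OF f]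
  have c: "transport V j (Suc a) v \<in> carrier_vec (rdim V (Suc a))"
    using transport_carrier[OF V v] step by simp
  have "f a *\<^sub>v (rarr V a *\<^sub>v transport V j (Suc a) v) = (f a * rarr V a) *\<^sub>v transport V j (Suc a) v"
    using c by (simp add: mult_assoc_dim_vec)
  also have "\<dots> = rarr W a *\<^sub>v (f (Suc a) *\<^sub>v transport V j (Suc a) v)"
    unfolding is_repmapD(3)[OF f] using c by (simp add: mult_assoc_dim_vec)
  finally show ?case using step by (simp add: transport_step)
qed simp

lemma transport_zero:
  assumes "is_rep n V" "a \<le> j"
  shows "transport V j a (0\<^sub>v (rdim V j)) = 0\<^sub>v (rdim V a)"
  using assms(2)
proof (induction a rule: inc_induct)
  case (step a)
  then show ?case by (simp add: transport_step is_rep_dims[OF assms(1)])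
qed simp

lemma transport_closed:
  assumes "\<And>a v. v \<in> S (Suc a) \<Longrightarrow> rarr V a *\<^sub>v v \<in> S a" "v \<in> S j" "a \<le> j"
  shows "transport V j a v \<in> S a"
  using assms(3)
proof (induction a rule: inc_induct)
  case (step a)
  then show ?case using assms(1) by (simp add: transport_step)
qed (use assms in simp)

section \<open>Maps out of the projectives \<open>X_rep 0 j\<close>\<close>

lemma rdim_X: "rdim (X_rep i j) = X_dim i j"
  by (simp add: X_rep_def)

lemma is_rep_X: "j \<le> n \<Longrightarrow> is_rep n (X_rep i j)"
  by (auto simp: is_rep_def X_rep_def X_dim_def)

lemma mat_vec_dim0:
  "dim_col A = 0 \<Longrightarrow> dim_vec v = 0 \<Longrightarrow> (A :: 'k::field mat) *\<^sub>v v = 0\<^sub>v (dim_row A)"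
  by (intro eq_vecI) (simp_all add: scalar_prod_def)

text \<open>\<open>X_rep 0 j\<close> is the indecomposable projective at the vertex
  \<open>j\<close>; \<open>gen j a\<close> is the image of its generator at the vertex
  \<open>a\<close>, and the empty vector for \<open>a = 0\<close> and for
  \<open>a > j\<close>.\<close>

definition gen :: "nat \<Rightarrow> nat \<Rightarrow> 'k::field vec" where
  "gen j a = vec (X_dim 0 j a) (\<lambda>_. 1)"

lemma gen_carrier [simp]: "gen j a \<in> carrier_vec (X_dim 0 j a)"
  by (simp add: gen_def)

text \<open>The Yoneda map: maps from the projective at \<open>j\<close> to \<open>V\<close>
  correspond to vectors of \<open>V\<close> at \<open>j\<close>, and this one sends the generator to
  \<open>v\<close>. Its only column at \<open>a\<close> is \<open>v\<close> transported to
  \<open>a\<close>.\<close>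

definition vmap :: "'k::field rep \<Rightarrow> nat \<Rightarrow> 'k vec \<Rightarrow> 'k repmap" where
  "vmap V j v = (\<lambda>a. mat (rdim V a) (X_dim 0 j a) (\<lambda>(r, c). transport V j a v $ r))"

lemma vmap_dims [simp]: "dim_row (vmap V j v a) = rdim V a" "dim_col (vmap V j v a) = X_dim 0 j a"
  by (simp_all add: vmap_def)

lemma vmap_gen:
  assumes V: "is_rep n V" and v: "v \<in> carrier_vec (rdim V j)" and a: "a \<le> j"
  shows "vmap V j v a *\<^sub>v gen j a = transport V j a v"
proof (intro eq_vecI)
  have c: "transport V j a v \<in> carrier_vec (rdim V a)" using transport_carrier[OF V v a] .
  show "dim_vec (vmap V j v a *\<^sub>v gen j a) = dim_vec (transport V j a v)" using c by simp
  fix r assume "r < dim_vec (transport V j a v)"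
  then have r: "r < rdim V a" using c by simp
  then have "a \<noteq> 0" using is_repD(3)[OF V, of a] by (cases "a = 0") auto
  then have d: "X_dim 0 j a = Suc 0" using a by (simp add: X_dim_def)
  show "(vmap V j v a *\<^sub>v gen j a) $ r = transport V j a v $ r"
    using r by (simp add: vmap_def gen_def scalar_prod_def d)
qed

lemma one_col_mat_eq:
  assumes "dim_row A = dim_row B" "dim_col A = X_dim 0 j a" "dim_col B = X_dim 0 j a"
    "A *\<^sub>v gen j a = B *\<^sub>v gen j a"
  shows "A = (B :: 'k::field mat)"
proof (rule eq_matI)
  fix r c assume rc: "r < dim_row B" "c < dim_col B"
  then have d: "X_dim 0 j a = Suc 0" "c = 0" using assms(3) by (auto simp: X_dim_def split: if_splits)
  have "(A *\<^sub>v gen j a) $ r = A $$ (r, 0)" "(B *\<^sub>v gen j a) $ r = B $$ (r, 0)"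
    using rc assms(1-3) d by (simp_all add: gen_def scalar_prod_def)
  then show "A $$ (r, c) = B $$ (r, c)" using assms(4) d(2) by metis
qed (use assms in auto)

lemma rarr_X0_gen:
  assumes "a < j" "0 < a"
  shows "rarr (X_rep 0 j) a *\<^sub>v gen j (Suc a) = (gen j a :: 'k::field vec)"
  using assms by (intro eq_vecI) (auto simp: X_rep_def gen_def X_dim_def scalar_prod_def)

lemma transport_gen:
  assumes "a \<le> j"
  shows "transport (X_rep 0 j) j a (gen j j) = (gen j a :: 'k::field vec)"
  using assms
proof (induction a rule: inc_induct)
  case (step a)
  show ?case
  proof (cases "a = 0")
    case True
    then have "dim_row (rarr (X_rep 0 j :: 'k rep) a) = 0" "X_dim 0 j a = 0"
      by (simp_all add: X_rep_def X_dim_def)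
    then show ?thesis using step by (intro eq_vecI) (simp_all add: transport_step gen_def)
  next
    case False
    then show ?thesis using step rarr_X0_gen[of a j] by (simp add: transport_step)
  qed
qed simp

lemma is_repmap_vmap:
  assumes V: "is_rep n V" and v: "v \<in> carrier_vec (rdim V j)"
  shows "is_repmap (X_rep 0 j) V (vmap V j v)"
  unfolding is_repmap_def
proof (intro conjI allI)
  fix a
  show "vmap V j v a \<in> carrier_mat (rdim V a) (rdim (X_rep 0 j) a)" by (simp add: carrier_mat_iff rdim_X)
  have X: "is_rep j (X_rep 0 j :: 'a rep)" by (simp add: is_rep_X)
  note [simp] = is_rep_dims[OF V] is_rep_dims[OF X] rdim_X
  show "vmap V j v a * rarr (X_rep 0 j) a = rarr V a * vmap V j v (a + 1)"
  proof (rule one_col_mat_eq[where j = j and a = "a + 1"])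
    show "vmap V j v a * rarr (X_rep 0 j) a *\<^sub>v gen j (a + 1) = rarr V a * vmap V j v (a + 1) *\<^sub>v gen j (a + 1)"
    proof (cases "a < j")
      case False
      then have 1: "X_dim 0 j (Suc a) = 0" by (simp add: X_dim_def)
      show ?thesis by (intro eq_vecI) (simp_all add: scalar_prod_def gen_def 1)
    next
      case True
      have R: "rarr V a * vmap V j v (Suc a) *\<^sub>v gen j (Suc a) = transport V j a v"
        using True by (subst mult_assoc_dim_vec) (simp_all add: vmap_gen[OF V v] transport_step carrier_vecD[OF gen_carrier])
      show ?thesis
      proof (cases "a = 0")
        case True
        then show ?thesis using is_repD(3)[OF V, of 0] by (intro eq_vecI) simp_all
      next
        case False
        have "vmap V j v a * rarr (X_rep 0 j) a *\<^sub>v gen j (Suc a) = transport V j a v"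
          using True False by (subst mult_assoc_dim_vec)
            (simp_all add: vmap_gen[OF V v] rarr_X0_gen carrier_vecD[OF gen_carrier])
        then show ?thesis using R by simp
      qed
    qed
  qed simp_all
qed

lemma repmap_X0_gen:
  assumes V: "is_rep n V" and f: "is_repmap (X_rep 0 j) V f" and a: "a \<le> j"
  shows "f a *\<^sub>v gen j a = transport V j a (f j *\<^sub>v gen j j)"
proof -
  \<comment> \<open>As \<open>j\<close> and \<open>n\<close> are unrelated here, both
    representations are regarded over the larger quiver.\<close>
  have V': "is_rep (max n j) V" "is_rep (max n j) (X_rep 0 j :: 'a rep)"
    using V by (auto simp: is_rep_def X_rep_def X_dim_def)
  have "f a *\<^sub>v transport (X_rep 0 j) j a (gen j j) = transport V j a (f j *\<^sub>v gen j j)"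
    by (rule transport_map[OF V'(2,1) f _ a]) (simp add: rdim_X)
  then show ?thesis by (simp add: transport_gen[OF a])
qed

text \<open>The uniqueness half of Yoneda. The equations between maps out of \<open>Pcx\<close> are
  verified through it, on generators only.\<close>

lemma repmap_X0_eqI:
  assumes V: "is_rep n V" and f: "is_repmap (X_rep 0 j) V f" and g: "is_repmap (X_rep 0 j) V g"
    and eq: "f j *\<^sub>v gen j j = g j *\<^sub>v gen j j"
  shows "f a = g a"
proof (rule one_col_mat_eq[where j = j and a = a])
  show "f a *\<^sub>v gen j a = g a *\<^sub>v gen j a"
  proof (cases "a \<le> j")
    case True
    then show ?thesis using repmap_X0_gen[OF V f True] repmap_X0_gen[OF V g True] eq by simp
  next
    case False
    then have 1: "X_dim 0 j a = 0" by (simp add: X_dim_def)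
    show ?thesis by (intro eq_vecI)
      (simp_all add: scalar_prod_def gen_def 1 is_repmap_dims[OF f] is_repmap_dims[OF g])
  qed
qed (simp_all add: is_repmap_dims[OF f] is_repmap_dims[OF g] rdim_X)

lemma vec_X0:
  assumes "c \<in> carrier_vec (X_dim 0 j a)"
  obtains \<gamma> where "c = \<gamma> \<cdot>\<^sub>v (gen j a :: 'k::field vec)"
proof
  show "c = (c $ 0) \<cdot>\<^sub>v gen j a"
    using assms by (intro eq_vecI) (auto simp: gen_def X_dim_def split: if_splits)
qed

text \<open>The complex of projectives \<open>P\<^sub>i \<rightarrow> P\<^sub>j\<close> in degrees \<open>l - 1\<close> and \<open>l\<close>, which resolves \<open>\<Sigma>\<^sup>-\<^sup>l X\<^sub>i\<^sub>,\<^sub>j\<close>.\<close>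

definition Pobj :: "nat \<Rightarrow> nat \<Rightarrow> int \<Rightarrow> int \<Rightarrow> 'k::field rep" where
  "Pobj i j l m = (if m = l then X_rep 0 j else if m = l - 1 then X_rep 0 i else zero_rep)"

definition Pcx :: "nat \<Rightarrow> nat \<Rightarrow> int \<Rightarrow> 'k::field cpx" where
  "Pcx i j l = \<lparr>obj = Pobj i j l,
     diff = (\<lambda>m a. if m = l - 1 then vmap (X_rep 0 j) i (gen j i) a
        else 0\<^sub>m (rdim (Pobj i j l (m + 1) :: 'k rep) a) (rdim (Pobj i j l m :: 'k rep) a))\<rparr>"

lemma is_rep_zero: "is_rep n zero_rep"
  by (simp add: is_rep_def zero_rep_def)

lemma rdim_zero_rep: "rdim zero_rep a = 0"
  by (simp add: zero_rep_def)

lemma Pcx_simps: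
  "obj (Pcx i j l) l = X_rep 0 j" "obj (Pcx i j l) (l - 1) = X_rep 0 i"
  "m \<noteq> l \<Longrightarrow> m \<noteq> l - 1 \<Longrightarrow> obj (Pcx i j l) m = zero_rep"
  "diff (Pcx i j l) (l - 1) = vmap (X_rep 0 j) i (gen j i)"
  by (auto simp: Pcx_def Pobj_def)

lemma Pcx_diff_zero:
  "m \<noteq> l - 1 \<Longrightarrow> diff (Pcx i j l :: 'k::field cpx) m a =
     0\<^sub>m (rdim (obj (Pcx i j l :: 'k cpx) (m + 1)) a) (rdim (obj (Pcx i j l :: 'k cpx) m) a)"
  by (simp add: Pcx_def)

lemma is_repmap_zero:
  assumes "is_rep n V" "is_rep n W"
  shows "is_repmap V W (\<lambda>a. 0\<^sub>m (rdim W a) (rdim V a))"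
  using is_rep_dims[OF assms(1)] is_rep_dims[OF assms(2)] by (simp add: is_repmap_def)

lemma is_cpx_Pcx:
  assumes "i \<le> j" "j \<le> n"
  shows "is_cpx n (Pcx i j l :: 'k::field cpx)"
proof -
  let ?P = "Pcx i j l :: 'k cpx"
  have rep: "is_rep n (obj ?P m)" for m
    using assms by (simp add: Pcx_def Pobj_def is_rep_X is_rep_zero)
  have map: "is_repmap (obj ?P m) (obj ?P (m + 1)) (diff ?P m)" for m
  proof (cases "m = l - 1")
    case True
    have "is_repmap (X_rep 0 i) (X_rep 0 j) (vmap (X_rep 0 j) i (gen j i :: 'k vec))"
      using is_repmap_vmap[OF is_rep_X[OF assms(2)], of "gen j i" 0 i] by (simp add: rdim_X)
    then show ?thesis using True by (simp add: Pcx_simps Pcx_diff_zero)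
  next
    case False
    have "diff ?P m = (\<lambda>a. 0\<^sub>m (rdim (obj ?P (m + 1)) a) (rdim (obj ?P m) a))"
      using Pcx_diff_zero[OF False] by (rule ext)
    then show ?thesis by (simp only:) (rule is_repmap_zero[OF rep rep])
  qed
  have sq: "diff ?P (m + 1) a * diff ?P m a = 0\<^sub>m (rdim (obj ?P (m + 1 + 1)) a) (rdim (obj ?P m) a)" for m a
  proof (cases "m = l - 1")
    case True
    then have "diff ?P (m + 1) a = 0\<^sub>m (rdim (obj ?P (m + 1 + 1)) a) (rdim (obj ?P (m + 1)) a)"
      using Pcx_diff_zero[of "m + 1" l] by simp
    then show ?thesis by (simp add: is_repmap_dims[OF map])
  next
    case False
    then show ?thesis by (simp add: is_repmap_dims[OF map] Pcx_diff_zero[OF False, of i j a])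
  qed
  have "{m. \<exists>a. rdim (obj ?P m) a \<noteq> 0} \<subseteq> {l, l - 1}"
    by (auto simp: Pcx_def Pobj_def rdim_zero_rep split: if_splits)
  then have "finite {m. \<exists>a. rdim (obj ?P m) a \<noteq> 0}" using finite_subset by blast
  then show ?thesis using rep map sq by (simp add: is_cpx_def)
qed

lemma cpx_transport:
  assumes X: "is_cpx n X" and a: "a \<le> j"
  shows "v \<in> carrier_vec (rdim (obj X m) j) \<Longrightarrow> transport (obj X m) j a v \<in> carrier_vec (rdim (obj X m) a)"
    and "v \<in> carrier_vec (rdim (obj X m) j) \<Longrightarrow>
      diff X m a *\<^sub>v transport (obj X m) j a v = transport (obj X (m + 1)) j a (diff X m j *\<^sub>v v)"
    and "v \<in> carrier_vec (rdim (obj X (m - 1)) j) \<Longrightarrow>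
      diff X (m - 1) a *\<^sub>v transport (obj X (m - 1)) j a v = transport (obj X m) j a (diff X (m - 1) j *\<^sub>v v)"
    and "v \<in> cocycles X m j \<Longrightarrow> transport (obj X m) j a v \<in> cocycles X m a"
    and "v \<in> coboundaries X m j \<Longrightarrow> transport (obj X m) j a v \<in> coboundaries X m a"
proof -
  show "transport (obj X m) j a v \<in> carrier_vec (rdim (obj X m) a)" if "v \<in> carrier_vec (rdim (obj X m) j)"
    using transport_carrier[OF is_cpxD(1)[OF X] that a] .
  show *: "diff X m a *\<^sub>v transport (obj X m) j a v = transport (obj X (m + 1)) j a (diff X m j *\<^sub>v v)"
    if "v \<in> carrier_vec (rdim (obj X m) j)" for m
    using transport_map[OF is_cpxD(1)[OF X] is_cpxD(1)[OF X] is_cpxD(2)[OF X] that a] .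
  show "diff X (m - 1) a *\<^sub>v transport (obj X (m - 1)) j a v = transport (obj X m) j a (diff X (m - 1) j *\<^sub>v v)"
    if "v \<in> carrier_vec (rdim (obj X (m - 1)) j)" using *[OF that] by simp
  show "v \<in> cocycles X m j \<Longrightarrow> transport (obj X m) j a v \<in> cocycles X m a"
    by (rule transport_closed[where S = "cocycles X m"]) (auto simp: rarr_cocycles[OF X] a)
  show "v \<in> coboundaries X m j \<Longrightarrow> transport (obj X m) j a v \<in> coboundaries X m a"
    by (rule transport_closed[where S = "coboundaries X m"]) (auto simp: rarr_coboundaries[OF X] a)
qed

lemma cmor_transport:
  assumes "cmor n X Y f" "v \<in> carrier_vec (rdim (obj X m) j)" "a \<le> j"
  shows "f m a *\<^sub>v transport (obj X m) j a v = transport (obj Y m) j a (f m j *\<^sub>v v)"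
  using transport_map[OF is_cpxD(1)[OF cmorD(1)[OF assms(1)]] is_cpxD(1)[OF cmorD(2)[OF assms(1)]]
      cmor_facts(3)[OF assms(1)] assms(2,3)] .

text \<open>Chain maps \<open>Pcx i j l \<rightarrow> W\<close> are determined by the images \<open>x\<close> and \<open>y\<close> of the generators.\<close>

definition Pcx_data :: "nat \<Rightarrow> nat \<Rightarrow> int \<Rightarrow> 'k::field cpx \<Rightarrow> 'k vec \<Rightarrow> 'k vec \<Rightarrow> bool" where
  "Pcx_data i j l W x y \<longleftrightarrow> x \<in> cocycles W l j \<and> y \<in> carrier_vec (rdim (obj W (l - 1)) i) \<and>
     diff W (l - 1) i *\<^sub>v y = transport (obj W l) j i x"

definition Pcx_map :: "nat \<Rightarrow> nat \<Rightarrow> int \<Rightarrow> 'k::field cpx \<Rightarrow> 'k vec \<Rightarrow> 'k vec \<Rightarrow> 'k cmap" where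
  "Pcx_map i j l W x y = (\<lambda>m a. if m = l then vmap (obj W l) j x a
     else if m = l - 1 then vmap (obj W (l - 1)) i y a else 0\<^sub>m (rdim (obj W m) a) 0)"

text \<open>The differential sends \<open>gen i i\<close> to \<open>gen j i\<close>, which is
  \<open>gen j j\<close> transported to \<open>i\<close>; applying \<open>f\<close> yields the
  equation between the two images.\<close>

lemma Pcx_mor_data:
  fixes W :: "'k::field cpx"
  assumes f: "cmor n (Pcx i j l) W f" and ij: "i \<le> j"
  shows "Pcx_data i j l W (f l j *\<^sub>v gen j j) (f (l - 1) i *\<^sub>v gen i i)"
proof -
  note P = cmorD(1)[OF f] and W = cmorD(2)[OF f]
  let ?P = "Pcx i j l :: 'k cpx"
  have 1: "(gen j j :: 'k vec) \<in> carrier_vec (rdim (obj ?P l) j)"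
    "(gen i i :: 'k vec) \<in> carrier_vec (rdim (obj ?P (l - 1)) i)" by (simp_all add: Pcx_simps Pcx_diff_zero rdim_X)
  have "diff W l j *\<^sub>v (f l j *\<^sub>v gen j j) = 0\<^sub>v (rdim (obj W (l + 1)) j)"
    unfolding cmor_vec_eqs(1)[OF f 1(1)] by (simp add: Pcx_simps Pcx_diff_zero rdim_X cmor_dims[OF f] rdim_zero_rep mat_vec_dim0)
  moreover have "diff W (l - 1) i *\<^sub>v (f (l - 1) i *\<^sub>v gen i i) = f l i *\<^sub>v gen j i"
    unfolding cmor_vec_eqs(2)[OF f 1(2)]
    using vmap_gen[OF is_rep_X[of j j], of "gen j i :: 'k vec" 0 i i] by (simp add: Pcx_simps Pcx_diff_zero rdim_X)
  moreover have "f l i *\<^sub>v gen j i = transport (obj W l) j i (f l j *\<^sub>v gen j j)"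
    using repmap_X0_gen[OF is_cpxD(1)[OF W] _ ij] cmor_facts(3)[OF f, of l] by (simp add: Pcx_simps Pcx_diff_zero)
  ultimately show ?thesis using cmor_vec_carrier[OF f] by (simp add: Pcx_data_def cocycles_def)
qed

lemma zero_col_eq: "dim_col A = 0 \<Longrightarrow> dim_col B = 0 \<Longrightarrow> dim_row A = dim_row B \<Longrightarrow> A = B"
  by (rule eq_matI) auto

text \<open>Compatibility with the differentials is an equation between maps out of a projective. On
  generators it is the cocycle condition for \<open>x\<close> in degree \<open>l\<close> and the
  equation linking \<open>y\<close> to the transport of \<open>x\<close> in degree
  \<open>l - 1\<close>.\<close>

lemma cmor_PcxI:
  fixes W :: "'k::field cpx"
  assumes ij: "i \<le> j" "j \<le> n" and W: "is_cpx n W" and d: "Pcx_data i j l W x y"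
  shows "cmor n (Pcx i j l) W (Pcx_map i j l W x y)"
    and "Pcx_map i j l W x y l j *\<^sub>v gen j j = x" "Pcx_map i j l W x y (l - 1) i *\<^sub>v gen i i = y"
proof -
  let ?P = "Pcx i j l :: 'k cpx" and ?f = "Pcx_map i j l W x y"
  have P: "is_cpx n ?P" using is_cpx_Pcx ij by blast
  have x: "x \<in> carrier_vec (rdim (obj W l) j)" "diff W l j *\<^sub>v x = 0\<^sub>v (rdim (obj W (l + 1)) j)"
    and y: "y \<in> carrier_vec (rdim (obj W (l - 1)) i)" and xy: "diff W (l - 1) i *\<^sub>v y = transport (obj W l) j i x"
    using d by (auto simp: Pcx_data_def cocycles_def)
  note W1 = is_cpxD(1)[OF W]
  note [simp] = is_cpx_dims[OF W] is_cpx_dims[OF P]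
  note vx = is_repmap_vmap[OF W1 x(1)] and vy = is_repmap_vmap[OF W1 y]
  have fl: "?f l = vmap (obj W l) j x" "?f (l - 1) = vmap (obj W (l - 1)) i y" by (auto simp: Pcx_map_def)
  show gx: "?f l j *\<^sub>v gen j j = x" "?f (l - 1) i *\<^sub>v gen i i = y"
    using vmap_gen[OF W1 x(1), of j] vmap_gen[OF W1 y, of i] by (simp_all add: fl)
  have rep: "is_repmap (obj ?P m) (obj W m) (?f m)" for m
  proof -
    consider "m = l" | "m = l - 1" | "m \<noteq> l" "m \<noteq> l - 1" by blast
    then show ?thesis
    proof cases
      case 3
      then have "?f m = (\<lambda>a. 0\<^sub>m (rdim (obj W m) a) (rdim (obj ?P m) a))"
        by (auto simp: Pcx_map_def Pcx_simps rdim_zero_rep)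
      then show ?thesis by (simp only:) (rule is_repmap_zero[OF is_cpxD(1)[OF P] W1])
    qed (use vx vy in \<open>auto simp: fl Pcx_simps\<close>)
  qed
  have comm: "diff W m a * ?f m a = ?f (m + 1) a * diff ?P m a" for m a
  proof -
    have L: "is_repmap (obj ?P m) (obj W (m + 1)) (\<lambda>a. diff W m a * ?f m a)"
      using is_repmap_comp[OF is_cpxD(1)[OF P] W1 W1 rep is_cpxD(2)[OF W]] .
    have R: "is_repmap (obj ?P m) (obj W (m + 1)) (\<lambda>a. ?f (m + 1) a * diff ?P m a)"
      using is_repmap_comp[OF is_cpxD(1)[OF P] is_cpxD(1)[OF P] W1 is_cpxD(2)[OF P] rep] .
    consider "m = l" | "m = l - 1" | "m \<noteq> l" "m \<noteq> l - 1" by blast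
    then show ?thesis
    proof cases
      case 1
      show ?thesis unfolding 1
      proof (rule repmap_X0_eqI[OF W1 L[unfolded 1 Pcx_simps(1)] R[unfolded 1 Pcx_simps(1)]])
        show "diff W l j * ?f l j *\<^sub>v gen j j = ?f (l + 1) j * diff ?P l j *\<^sub>v gen j j"
          using is_repmap_dims[OF rep] x(2) gx
          by (simp add: mult_assoc_dim_vec Pcx_simps Pcx_diff_zero rdim_X carrier_vecD[OF gen_carrier])
      qed
    next
      case 2
      have Lm: "is_repmap (X_rep 0 i) (obj W l) (\<lambda>a. diff W (l - 1) a * ?f (l - 1) a)"
        using L by (simp add: 2 Pcx_simps)
      have Rm: "is_repmap (X_rep 0 i) (obj W l) (\<lambda>a. ?f l a * diff ?P (l - 1) a)"
        using R by (simp add: 2 Pcx_simps)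
      have "diff W (l - 1) a * ?f (l - 1) a = ?f l a * diff ?P (l - 1) a"
      proof (rule repmap_X0_eqI[OF W1 Lm Rm])
        have "vmap (X_rep 0 j) i (gen j i) i *\<^sub>v gen i i = (gen j i :: 'k vec)"
          using vmap_gen[OF is_rep_X[of j j], of "gen j i :: 'k vec" 0 i i] by (simp add: rdim_X)
        moreover have "vmap (obj W l) j x i *\<^sub>v gen j i = transport (obj W l) j i x"
          using vmap_gen[OF W1 x(1) ij(1)] .
        ultimately have "?f l i * diff ?P (l - 1) i *\<^sub>v gen i i = transport (obj W l) j i x"
          by (subst mult_assoc_dim_vec) (simp_all add: fl Pcx_simps rdim_X carrier_vecD[OF gen_carrier])
        moreover have "diff W (l - 1) i * ?f (l - 1) i *\<^sub>v gen i i = transport (obj W l) j i x"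
          using gx(2) by (subst mult_assoc_dim_vec) (simp_all add: fl carrier_vecD[OF gen_carrier] xy)
        ultimately show "diff W (l - 1) i * ?f (l - 1) i *\<^sub>v gen i i = ?f l i * diff ?P (l - 1) i *\<^sub>v gen i i"
          by simp
      qed
      then show ?thesis by (simp add: 2)
    next
      case 3
      then show ?thesis
        by (intro zero_col_eq) (simp_all add: is_repmap_dims[OF rep] Pcx_simps rdim_zero_rep)
    qed
  qed
  show "cmor n ?P W ?f" using P W rep comm by (simp add: cmor_def chain_map_def)
qed

text \<open>A homotopy is determined by the images \<open>u\<close> and \<open>w\<close> of the
  generators in the degrees \<open>l - 1\<close> and \<open>l - 2\<close> of \<open>W\<close>, and
  the two equations are the homotopy formula on the generators. Morphisms out of \<open>Pcx\<close>
  thereby become linear algebra.\<close>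

lemma Pcx_null_iff:
  fixes W :: "'k::field cpx"
  assumes f: "cmor n (Pcx i j l) W f" and ij: "i \<le> j" "j \<le> n"
  shows "chtpy n (Pcx i j l) W f (cmap_zero (Pcx i j l) W) \<longleftrightarrow>
    (\<exists>u w. u \<in> carrier_vec (rdim (obj W (l - 1)) j) \<and> w \<in> carrier_vec (rdim (obj W (l - 1 - 1)) i) \<and>
      f l j *\<^sub>v gen j j = diff W (l - 1) j *\<^sub>v u \<and>
      f (l - 1) i *\<^sub>v gen i i = diff W (l - 1 - 1) i *\<^sub>v w + transport (obj W (l - 1)) j i u)" (is "?L \<longleftrightarrow> ?R")
proof -
  let ?P = "Pcx i j l :: 'k cpx"
  note P = cmorD(1)[OF f] and W = cmorD(2)[OF f]
  note W1 = is_cpxD(1)[OF W] and P1 = is_cpxD(1)[OF P]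
  note [simp] = is_cpx_dims[OF W] is_cpx_dims[OF P] cmor_dims[OF f]
  note gd = carrier_vecD[OF gen_carrier]
  have gi: "vmap (X_rep 0 j) i (gen j i) i *\<^sub>v gen i i = (gen j i :: 'k vec)"
    using vmap_gen[OF is_rep_X[of j j], of "gen j i :: 'k vec" 0 i i] by (simp add: rdim_X)
  show ?thesis
  proof
    assume ?L
    then obtain h where h0: "\<forall>m. is_repmap (obj ?P m) (obj W (m - 1)) (h m)"
      "\<forall>m a. f m a - cmap_zero ?P W m a = diff W (m - 1) a * h m a + h (m + 1) a * diff ?P m a"
      using chtpyD(3) unfolding homotopic_def by blast
    note h = h0[rule_format]
    note [simp] = is_repmap_dims[OF h(1)]
    have eq: "f m a *\<^sub>v v = diff W (m - 1) a *\<^sub>v (h m a *\<^sub>v v) + h (m + 1) a *\<^sub>v (diff ?P m a *\<^sub>v v)"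
      if v: "v \<in> carrier_vec (rdim (obj ?P m) a)" for m a v
    proof -
      have "f m a = f m a - cmap_zero ?P W m a" by (intro eq_matI) (simp_all add: cmap_zero_def)
      then have "f m a *\<^sub>v v = (diff W (m - 1) a * h m a + h (m + 1) a * diff ?P m a) *\<^sub>v v"
        unfolding h(2)[symmetric] by simp
      also have "\<dots> = diff W (m - 1) a * h m a *\<^sub>v v + h (m + 1) a * diff ?P m a *\<^sub>v v"
        using v by (intro mat_vec_linear_mats) simp_all
      finally show ?thesis using v by (simp add: mult_assoc_dim_vec)
    qed
    let ?u = "h l j *\<^sub>v gen j j" and ?w = "h (l - 1) i *\<^sub>v gen i i"
    have c: "?u \<in> carrier_vec (rdim (obj W (l - 1)) j)" "?w \<in> carrier_vec (rdim (obj W (l - 1 - 1)) i)"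
      by (auto intro!: mult_mat_vec_carrier_dim)
    have "f l j *\<^sub>v gen j j = diff W (l - 1) j *\<^sub>v ?u"
    proof -
      have "h (l + 1) j *\<^sub>v (diff ?P l j *\<^sub>v gen j j) = 0\<^sub>v (rdim (obj W l) j)"
        by (simp add: Pcx_simps Pcx_diff_zero rdim_X)
      then show ?thesis using eq[of "gen j j" l j] cpx_vec_simps[OF W] by (simp add: Pcx_simps Pcx_diff_zero rdim_X)
    qed
    moreover have "f (l - 1) i *\<^sub>v gen i i = diff W (l - 1 - 1) i *\<^sub>v ?w + transport (obj W (l - 1)) j i ?u"
    proof -
      have "h l i *\<^sub>v gen j i = transport (obj W (l - 1)) j i ?u"
        using repmap_X0_gen[OF W1 _ ij(1)] h(1)[of l] by (simp add: Pcx_simps Pcx_diff_zero)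
      then show ?thesis using eq[of "gen i i" "l - 1" i] gi by (simp add: Pcx_simps Pcx_diff_zero rdim_X)
    qed
    ultimately show ?R using c by blast
  next
    assume ?R
    then obtain u w where u: "u \<in> carrier_vec (rdim (obj W (l - 1)) j)"
      and w: "w \<in> carrier_vec (rdim (obj W (l - 1 - 1)) i)"
      and eu: "f l j *\<^sub>v gen j j = diff W (l - 1) j *\<^sub>v u"
      and ew: "f (l - 1) i *\<^sub>v gen i i = diff W (l - 1 - 1) i *\<^sub>v w + transport (obj W (l - 1)) j i u" by blast
    define h where "h = (\<lambda>m a. if m = l then vmap (obj W (l - 1)) j u a
     else if m = l - 1 then vmap (obj W (l - 1 - 1)) i w a else 0\<^sub>m (rdim (obj W (m - 1)) a) 0)"
    have hl: "h l = vmap (obj W (l - 1)) j u" "h (l - 1) = vmap (obj W (l - 1 - 1)) i w" by (auto simp: h_def)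
    have rep: "is_repmap (obj ?P m) (obj W (m - 1)) (h m)" for m
    proof -
      consider "m = l" | "m = l - 1" | "m \<noteq> l" "m \<noteq> l - 1" by blast
      then show ?thesis
      proof cases
        case 3
        then have "h m = (\<lambda>a. 0\<^sub>m (rdim (obj W (m - 1)) a) (rdim (obj ?P m) a))"
          by (auto simp: h_def Pcx_simps rdim_zero_rep)
        then show ?thesis by (simp only:) (rule is_repmap_zero[OF P1 W1])
      qed (use is_repmap_vmap[OF W1 u] is_repmap_vmap[OF W1 w] in \<open>auto simp: hl Pcx_simps\<close>)
    qed
    have rep': "is_repmap (obj ?P (m + 1)) (obj W m) (h (m + 1))" for m
      using rep[of "m + 1"] by simp
    note [simp] = is_repmap_dims[OF rep]
    have d': "is_repmap (obj W (m - 1)) (obj W m) (diff W (m - 1))" for m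
      using is_cpxD(2)[OF W, of "m - 1"] by simp
    have R: "is_repmap (obj ?P m) (obj W m) (\<lambda>a. diff W (m - 1) a * h m a + h (m + 1) a * diff ?P m a)" for m
      using is_repmap_lin(1)[OF P1 W1 is_repmap_comp[OF P1 W1 W1 rep d'] is_repmap_comp[OF P1 P1 W1 is_cpxD(2)[OF P] rep']] .
    have "homotopic ?P W f (cmap_zero ?P W)"
    proof (rule homotopicI[OF rep])
      fix m a
      have "f m a = diff W (m - 1) a * h m a + h (m + 1) a * diff ?P m a"
      proof -
        consider "m = l" | "m = l - 1" | "m \<noteq> l" "m \<noteq> l - 1" by blast
        then show ?thesis
        proof cases
          case 1
          show ?thesis unfolding 1
          proof (rule repmap_X0_eqI[OF W1 cmor_facts(3)[OF f, of l, unfolded Pcx_simps] R[of l, unfolded Pcx_simps(1)]])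
            have "(diff W (l - 1) j * h l j + h (l + 1) j * diff ?P l j) *\<^sub>v gen j j =
              diff W (l - 1) j * h l j *\<^sub>v gen j j + h (l + 1) j * diff ?P l j *\<^sub>v gen j j"
              by (intro mat_vec_linear_mats) (simp_all add: Pcx_simps Pcx_diff_zero rdim_X)
            also have "\<dots> = diff W (l - 1) j *\<^sub>v u"
              using vmap_gen[OF W1 u, of j] cpx_vec_simps[OF W]
              by (simp add: mult_assoc_dim_vec Pcx_simps Pcx_diff_zero rdim_X gd hl)
            finally show "f l j *\<^sub>v gen j j = (diff W (l - 1) j * h l j + h (l + 1) j * diff ?P l j) *\<^sub>v gen j j"
              using eu by simp
          qed
        next
          case 2
          have Rm: "is_repmap (X_rep 0 i) (obj W (l - 1))
              (\<lambda>a. diff W (l - 1 - 1) a * h (l - 1) a + h l a * diff ?P (l - 1) a)"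
            using R[of "l - 1"] by (simp add: Pcx_simps Pcx_diff_zero)
          have "f (l - 1) a = diff W (l - 1 - 1) a * h (l - 1) a + h l a * diff ?P (l - 1) a"
          proof (rule repmap_X0_eqI[OF W1 cmor_facts(3)[OF f, of "l - 1", unfolded Pcx_simps] Rm])
            have 1: "diff W (l - 1 - 1) i * h (l - 1) i *\<^sub>v gen i i = diff W (l - 1 - 1) i *\<^sub>v w"
              using vmap_gen[OF W1 w, of i] by (subst mult_assoc_dim_vec) (simp_all add: hl gd)
            have 2: "h l i * diff ?P (l - 1) i *\<^sub>v gen i i = transport (obj W (l - 1)) j i u"
              using vmap_gen[OF W1 u ij(1)] gi
              by (subst mult_assoc_dim_vec) (simp_all add: hl Pcx_simps rdim_X gd)
            have "(diff W (l - 1 - 1) i * h (l - 1) i + h l i * diff ?P (l - 1) i) *\<^sub>v gen i i =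
              diff W (l - 1 - 1) i * h (l - 1) i *\<^sub>v gen i i + h l i * diff ?P (l - 1) i *\<^sub>v gen i i"
              by (intro mat_vec_linear_mats) (simp_all add: Pcx_simps Pcx_diff_zero rdim_X)
            then show "f (l - 1) i *\<^sub>v gen i i =
                (diff W (l - 1 - 1) i * h (l - 1) i + h l i * diff ?P (l - 1) i) *\<^sub>v gen i i"
              unfolding 1 2 ew by simp
          qed
          then show ?thesis by (simp add: 2)
        next
          case 3
          then show ?thesis by (intro zero_col_eq) (simp_all add: Pcx_simps Pcx_diff_zero rdim_zero_rep)
        qed
      qed
      moreover have "f m a = f m a - cmap_zero ?P W m a" by (intro eq_matI) (simp_all add: cmap_zero_def)
      ultimately show "f m a - cmap_zero ?P W m a = diff W (m - 1) a * h m a + h (m + 1) a * diff ?P m a" by simp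
    qed
    then show ?L using f cmor_zero[OF P W] by (simp add: chtpy_def)
  qed
qed

lemma vec_rearrange:
  fixes a b e s t u w x y :: "'a::ab_group_add vec"
  assumes "a \<in> carrier_vec d" "b \<in> carrier_vec d" "e \<in> carrier_vec d" "s \<in> carrier_vec d"
  shows "a - b = e \<Longrightarrow> a = b + e" "a - b = e \<Longrightarrow> a = e + b"
    "a - (b - (e + s)) = w \<Longrightarrow> w \<in> carrier_vec d \<Longrightarrow> b - a - e = - w + s"
    "a - (b - e) = s \<Longrightarrow> b - a = e - s" "(a + b) - (b - s) = a + s"
  using assms by (auto simp: vec_eq_iff algebra_simps)

lemma sub_vec:
  assumes f: "cmor n X Y f" and g: "cmor n X Y g" and v: "v \<in> carrier_vec (rdim (obj X i) a)"
  shows "cmap_add f (cmap_smult (- 1) g) i a *\<^sub>v v = f i a *\<^sub>v v - g i a *\<^sub>v v"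
proof -
  have "cmap_add f (cmap_smult (- 1) g) i a = f i a - g i a"
    by (intro eq_matI) (simp_all add: cmap_add_def cmap_smult_def cmor_dims[OF f] cmor_dims[OF g])
  then show ?thesis using v by (simp add: mat_vec_linear_mats cmor_dims[OF f] cmor_dims[OF g])
qed

lemma Pcx_gens:
  "(gen j j :: 'k::field vec) \<in> carrier_vec (rdim (obj (Pcx i j l :: 'k cpx) l) j)"
  "(gen i i :: 'k::field vec) \<in> carrier_vec (rdim (obj (Pcx i j l :: 'k cpx) (l - 1)) i)"
  by (simp_all add: Pcx_simps rdim_X)

text \<open>A chase on the images \<open>x\<close> and \<open>y\<close> of the generators: the
  failure of a choice to be compatible is a cocycle in the next lower degree, and it is corrected by
  the surjectivity or injectivity of \<open>t\<close> on cohomology there.\<close>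

lemma kproj_Pcx:
  assumes ij: "i \<le> j" "j \<le> n"
  shows "kproj n (Pcx i j l :: 'k::field cpx)"
  unfolding kproj_def
proof (intro conjI allI impI)
  let ?P = "Pcx i j l :: 'k cpx"
  show P: "is_cpx n ?P" using is_cpx_Pcx[OF ij] .
  fix W Y :: "'k cpx" and t assume t: "qis n W Y t"
  note tm = qisD(1)[OF t]
  note W = cmorD(1)[OF tm] and Y = cmorD(2)[OF tm]
  note [simp] = is_cpx_dims[OF W] is_cpx_dims[OF Y] cmor_dims[OF tm]
  note cW = cpx_vec_simps[OF W] and cY = cpx_vec_simps[OF Y] and ct = cmor_vec_carrier[OF tm]
  note trW = cpx_transport[OF W ij(1)] and trY = cpx_transport[OF Y ij(1)]
  note linY = transport_linear[OF is_cpxD(1)[OF Y] _ _ ij(1)]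
  note linW = transport_linear[OF is_cpxD(1)[OF W] _ _ ij(1)]
  {
    fix g assume g: "cmor n ?P Y g"
    define x y where "x = g l j *\<^sub>v gen j j" and "y = g (l - 1) i *\<^sub>v gen i i"
    have "Pcx_data i j l Y x y" using Pcx_mor_data[OF g ij(1)] by (simp add: x_def y_def)
    then have x: "x \<in> cocycles Y l j" "x \<in> carrier_vec (rdim (obj Y l) j)"
      and y: "y \<in> carrier_vec (rdim (obj Y (l - 1)) i)"
      and xy: "diff Y (l - 1) i *\<^sub>v y = transport (obj Y l) j i x" by (auto simp: Pcx_data_def cocycles_def)
    obtain x' where x': "x' \<in> cocycles W l j" "t l j *\<^sub>v x' - x \<in> coboundaries Y l j"
      using qisD(2)[OF t x(1)] by blast
    note x'c = cocyclesD[OF x'(1)]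
    obtain u where u: "u \<in> carrier_vec (rdim (obj Y (l - 1)) j)" "t l j *\<^sub>v x' - x = diff Y (l - 1) j *\<^sub>v u"
      using coboundariesE[OF x'(2)] .
    define p where "p = transport (obj W l) j i x'"
    define s where "s = transport (obj Y (l - 1)) j i u"
    have s: "s \<in> carrier_vec (rdim (obj Y (l - 1)) i)" using trY(1)[OF u(1)] by (simp add: s_def)
    have p: "p \<in> cocycles W l i" using trW(4)[OF x'(1)] by (simp add: p_def)
    have "t l i *\<^sub>v p = transport (obj Y l) j i (t l j *\<^sub>v x')"
      using cmor_transport[OF tm x'c(1) ij(1)] by (simp add: p_def)
    also have "t l j *\<^sub>v x' = x + diff Y (l - 1) j *\<^sub>v u"
      using vec_rearrange(1)[OF _ _ _ _ u(2)] x(2) ct cY by blast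
    also have "transport (obj Y l) j i \<dots> = diff Y (l - 1) i *\<^sub>v y + diff Y (l - 1) i *\<^sub>v s"
      using linY(1)[OF x(2)] trY(3)[OF u(1)] xy cY by (simp add: s_def)
    also have "\<dots> = diff Y (l - 1) i *\<^sub>v (y + s)" using y s by (simp add: mat_vec_linear)
    finally have tp: "t l i *\<^sub>v p = diff Y (l - 1) i *\<^sub>v (y + s)" .
    then have "p \<in> coboundaries W l i" using qisD(3)[OF t p] y s by (simp add: coboundariesI)
    then obtain y' where y': "y' \<in> carrier_vec (rdim (obj W (l - 1)) i)" "p = diff W (l - 1) i *\<^sub>v y'"
      by (rule coboundariesE)
    \<comment> \<open>The primitive \<open>y'\<close> of the transport of \<open>x'\<close> need not
      map to \<open>y + s\<close>. The defect \<open>e\<close> is a cocycle, hence up to a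
      coboundary the image of a cocycle \<open>y''\<close>, and \<open>y' - y''\<close> is the right
      second datum.\<close>
    define e where "e = t (l - 1) i *\<^sub>v y' - (y + s)"
    have "diff Y (l - 1) i *\<^sub>v e = 0\<^sub>v (rdim (obj Y l) i)"
      using tp y' ct y s cmor_vec_eqs(2)[OF tm y'(1)] cY
      by (simp add: e_def mat_vec_linear)
    then have "e \<in> cocycles Y (l - 1) i" using ct y s by (simp add: e_def cocycles_def)
    then obtain y'' where y'': "y'' \<in> cocycles W (l - 1) i" "t (l - 1) i *\<^sub>v y'' - e \<in> coboundaries Y (l - 1) i"
      using qisD(2)[OF t] by blast
    note y''c = cocyclesD[OF y''(1)]
    obtain w where w: "w \<in> carrier_vec (rdim (obj Y (l - 1 - 1)) i)"
      "t (l - 1) i *\<^sub>v y'' - e = diff Y (l - 1 - 1) i *\<^sub>v w"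
      using coboundariesE[OF y''(2)] .
    have "Pcx_data i j l W x' (y' - y'')"
      using x'(1) y' y''c cW by (simp add: Pcx_data_def mat_vec_linear p_def)
    note f = cmor_PcxI[OF ij W this]
    let ?f = "Pcx_map i j l W x' (y' - y'')"
    have tf: "cmor n ?P Y (cmap_comp t ?f)" using cmor_comp[OF f(1) tm] .
    have "chtpy n ?P Y (cmap_comp t ?f) g"
      unfolding chtpy_iff_diff[OF tf g]
    proof (subst Pcx_null_iff[OF cmor_lin(1)[OF tf cmor_lin(2)[OF g g]] ij], intro exI conjI)
      show "u \<in> carrier_vec (rdim (obj Y (l - 1)) j)" by fact
      show "- w \<in> carrier_vec (rdim (obj Y (l - 1 - 1)) i)" using w(1) by simp
      show "cmap_add (cmap_comp t ?f) (cmap_smult (- 1) g) l j *\<^sub>v gen j j = diff Y (l - 1) j *\<^sub>v u"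
        unfolding sub_vec[OF tf g Pcx_gens(1)] comp_vec[OF f(1) tm Pcx_gens(1)] f(2) x_def[symmetric] u(2) ..
      have "t (l - 1) i *\<^sub>v (y' - y'') - y = t (l - 1) i *\<^sub>v y' - t (l - 1) i *\<^sub>v y'' - y"
        using y'(1) y''c(1) by (simp add: mat_vec_linear)
      also have "\<dots> = - (diff Y (l - 1 - 1) i *\<^sub>v w) + s"
        using vec_rearrange(3)[OF _ _ _ _ w(2)[unfolded e_def]] ct y s cY by blast
      also have "- (diff Y (l - 1 - 1) i *\<^sub>v w) = diff Y (l - 1 - 1) i *\<^sub>v (- w)"
        using w(1) by (simp add: mat_vec_linear)
      finally show "cmap_add (cmap_comp t ?f) (cmap_smult (- 1) g) (l - 1) i *\<^sub>v gen i i =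
          diff Y (l - 1 - 1) i *\<^sub>v (- w) + transport (obj Y (l - 1)) j i u"
        unfolding sub_vec[OF tf g Pcx_gens(2)] comp_vec[OF f(1) tm Pcx_gens(2)] f(3) y_def[symmetric] s_def .
    qed
    then show "\<exists>f. cmor n ?P W f \<and> chtpy n ?P Y (cmap_comp t f) g" using f(1) by blast
  next
    fix f assume "cmor n ?P W f \<and> chtpy n ?P Y (cmap_comp t f) (cmap_zero ?P Y)"
    then have f: "cmor n ?P W f" and null: "chtpy n ?P Y (cmap_comp t f) (cmap_zero ?P Y)" by auto
    define x y where "x = f l j *\<^sub>v gen j j" and "y = f (l - 1) i *\<^sub>v gen i i"
    have "Pcx_data i j l W x y" using Pcx_mor_data[OF f ij(1)] by (simp add: x_def y_def)
    then have x: "x \<in> cocycles W l j" "x \<in> carrier_vec (rdim (obj W l) j)"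
      and y: "y \<in> carrier_vec (rdim (obj W (l - 1)) i)"
      and xy: "diff W (l - 1) i *\<^sub>v y = transport (obj W l) j i x" by (auto simp: Pcx_data_def cocycles_def)
    obtain u w where u: "u \<in> carrier_vec (rdim (obj Y (l - 1)) j)"
      and w: "w \<in> carrier_vec (rdim (obj Y (l - 1 - 1)) i)"
      and eu: "t l j *\<^sub>v x = diff Y (l - 1) j *\<^sub>v u"
      and ew: "t (l - 1) i *\<^sub>v y = diff Y (l - 1 - 1) i *\<^sub>v w + transport (obj Y (l - 1)) j i u"
      using null unfolding Pcx_null_iff[OF cmor_comp[OF f tm] ij]
        comp_vec[OF f tm Pcx_gens(1)] comp_vec[OF f tm Pcx_gens(2)] x_def[symmetric] y_def[symmetric] by blast
    have "x \<in> coboundaries W l j" using qisD(3)[OF t x(1)] u by (simp add: eu coboundariesI)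
    then obtain v where v: "v \<in> carrier_vec (rdim (obj W (l - 1)) j)" "x = diff W (l - 1) j *\<^sub>v v"
      by (rule coboundariesE)
    \<comment> \<open>The primitive \<open>v\<close> of \<open>x\<close> is first corrected at the
      vertex \<open>j\<close>: for \<open>v0 = v - v'\<close> the image under \<open>t\<close>
      differs from \<open>u\<close> by a coboundary. This makes \<open>t\<close> send
      \<open>y - r\<close> to a coboundary, where \<open>r\<close> is the transport of
      \<open>v0\<close>.\<close>
    define e where "e = t (l - 1) j *\<^sub>v v - u"
    have "diff Y (l - 1) j *\<^sub>v e = 0\<^sub>v (rdim (obj Y l) j)"
      using cmor_vec_eqs(2)[OF tm v(1)] ct u eu v(2) cY by (simp add: e_def mat_vec_linear)
    then have "e \<in> cocycles Y (l - 1) j" using ct u by (simp add: e_def cocycles_def)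
    then obtain v' where v': "v' \<in> cocycles W (l - 1) j" "t (l - 1) j *\<^sub>v v' - e \<in> coboundaries Y (l - 1) j"
      using qisD(2)[OF t] by blast
    note v'c = cocyclesD[OF v'(1)]
    obtain w1 where w1: "w1 \<in> carrier_vec (rdim (obj Y (l - 1 - 1)) j)"
      "t (l - 1) j *\<^sub>v v' - e = diff Y (l - 1 - 1) j *\<^sub>v w1"
      using coboundariesE[OF v'(2)] .
    define v0 where "v0 = v - v'"
    have v0: "v0 \<in> carrier_vec (rdim (obj W (l - 1)) j)" using v v'c by (simp add: v0_def)
    have xv0: "x = diff W (l - 1) j *\<^sub>v v0" using v v'c cW by (simp add: v0_def mat_vec_linear)
    have "t (l - 1) j *\<^sub>v v0 = t (l - 1) j *\<^sub>v v - t (l - 1) j *\<^sub>v v'"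
      using v v'c by (simp add: v0_def mat_vec_linear)
    also have "\<dots> = u - diff Y (l - 1 - 1) j *\<^sub>v w1"
      using vec_rearrange(4)[OF _ _ _ _ w1(2)[unfolded e_def]] ct u cY by blast
    finally have tv0: "t (l - 1) j *\<^sub>v v0 = u - diff Y (l - 1 - 1) j *\<^sub>v w1" .
    define r where "r = transport (obj W (l - 1)) j i v0"
    have r: "r \<in> carrier_vec (rdim (obj W (l - 1)) i)" using trW(1)[OF v0] by (simp add: r_def)
    have dr: "diff W (l - 1) i *\<^sub>v r = transport (obj W l) j i x"
      using trW(3)[OF v0] by (simp add: r_def xv0)
    have q: "y - r \<in> cocycles W (l - 1) i"
      using y r xy dr trW(1)[OF x(2)] by (simp add: cocycles_def mat_vec_linear)
    define r1 where "r1 = transport (obj Y (l - 1 - 1)) j i w1"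
    have r1: "r1 \<in> carrier_vec (rdim (obj Y (l - 1 - 1)) i)" using trY(1)[OF w1(1)] by (simp add: r1_def)
    have "t (l - 1) i *\<^sub>v r = transport (obj Y (l - 1)) j i u - transport (obj Y (l - 1)) j i (diff Y (l - 1 - 1) j *\<^sub>v w1)"
      using cmor_transport[OF tm v0 ij(1)] linY(2)[OF u cY(2)] unfolding r_def tv0 by metis
    also have "transport (obj Y (l - 1)) j i (diff Y (l - 1 - 1) j *\<^sub>v w1) = diff Y (l - 1 - 1) i *\<^sub>v r1"
      using trY(3)[OF w1(1)] by (simp add: r1_def)
    finally have tr: "t (l - 1) i *\<^sub>v r = transport (obj Y (l - 1)) j i u - diff Y (l - 1 - 1) i *\<^sub>v r1" .
    have "t (l - 1) i *\<^sub>v (y - r) = t (l - 1) i *\<^sub>v y - t (l - 1) i *\<^sub>v r"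
      using y r by (simp add: mat_vec_linear)
    also have "\<dots> = diff Y (l - 1 - 1) i *\<^sub>v w + diff Y (l - 1 - 1) i *\<^sub>v r1"
      unfolding ew tr by (rule vec_rearrange(5)[OF cY(2) trY(1)[OF u] cY(2) cY(2)])
    also have "\<dots> = diff Y (l - 1 - 1) i *\<^sub>v (w + r1)"
      using w r1 by (simp add: mat_vec_linear)
    finally have "y - r \<in> coboundaries W (l - 1) i"
      using qisD(3)[OF t q] coboundariesI[of "w + r1" Y "l - 1" i] w r1 by simp
    then obtain w' where w': "w' \<in> carrier_vec (rdim (obj W (l - 1 - 1)) i)"
      "y - r = diff W (l - 1 - 1) i *\<^sub>v w'" by (rule coboundariesE)
    have "y = diff W (l - 1 - 1) i *\<^sub>v w' + r"
      by (rule vec_rearrange(2)[OF y r cW(2) r w'(2)])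
    then show "chtpy n ?P W f (cmap_zero ?P W)"
      unfolding Pcx_null_iff[OF f ij] x_def[symmetric] y_def[symmetric]
      using v0 xv0 w'(1) r_def by blast
  }
qed

text \<open>Later arguments on direct sums use these equations and not the block matrices of
  \<open>cpx_dsum\<close>.\<close>

definition cpx_biprod :: "nat \<Rightarrow> 'k::field cpx \<Rightarrow> 'k cpx \<Rightarrow> 'k cpx \<Rightarrow> 'k cmap \<Rightarrow> 'k cmap \<Rightarrow> 'k cmap \<Rightarrow> 'k cmap \<Rightarrow> bool" where
  "cpx_biprod n A B S ia ib pa pb \<longleftrightarrow> cmor n A S ia \<and> cmor n B S ib \<and> cmor n S A pa \<and> cmor n S B pb \<and>
     cmap_comp pa ia = cmap_id A \<and> cmap_comp pb ib = cmap_id B \<and>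
     cmap_comp pa ib = cmap_zero B A \<and> cmap_comp pb ia = cmap_zero A B \<and>
     cmap_add (cmap_comp ia pa) (cmap_comp ib pb) = cmap_id S"

lemma add_zero_zero: "cmap_add (cmap_zero X Y) (cmap_zero X Y) = cmap_zero X Y"
  by (simp add: cmap_add_def cmap_zero_def)

text \<open>A map out of \<open>S\<close> is the sum of its restrictions composed with the
  projections, so lifts and null-homotopies are found on each summand separately.\<close>

lemma kproj_biprod:
  assumes bi: "cpx_biprod n A B S ia ib pa pb" and A: "kproj n A" and B: "kproj n B"
  shows "kproj n S"
  unfolding kproj_def
proof (intro conjI allI impI)
  have ia: "cmor n A S ia" and ib: "cmor n B S ib" and pa: "cmor n S A pa" and pb: "cmor n S B pb"
    and sum: "cmap_add (cmap_comp ia pa) (cmap_comp ib pb) = cmap_id S"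
    using bi by (auto simp: cpx_biprod_def)
  show "is_cpx n S" using cmorD(1)[OF pa] .
  have split: "cmap_add (cmap_comp (cmap_comp g ia) pa) (cmap_comp (cmap_comp g ib) pb) = g"
    if g: "cmor n S Y g" for Y g
    using comp_add[OF cmor_comp[OF pa ia] cmor_comp[OF pb ib] g] comp_id(1)[OF g] sum
      comp_assoc[OF pa ia g] comp_assoc[OF pb ib g] by simp
  fix W Y :: "'a cpx" and t assume t: "qis n W Y t"
  note tm = qisD(1)[OF t]
  {
    fix g assume g: "cmor n S Y g"
    obtain f1 where f1: "cmor n A W f1" "chtpy n A Y (cmap_comp t f1) (cmap_comp g ia)"
      using kproj_lift[OF A t cmor_comp[OF ia g]] .
    obtain f2 where f2: "cmor n B W f2" "chtpy n B Y (cmap_comp t f2) (cmap_comp g ib)"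
      using kproj_lift[OF B t cmor_comp[OF ib g]] .
    let ?f = "cmap_add (cmap_comp f1 pa) (cmap_comp f2 pb)"
    have c: "cmor n S W (cmap_comp f1 pa)" "cmor n S W (cmap_comp f2 pb)"
      using cmor_comp pa pb f1(1) f2(1) by blast+
    have "cmap_comp t ?f = cmap_add (cmap_comp (cmap_comp t f1) pa) (cmap_comp (cmap_comp t f2) pb)"
      unfolding comp_add[OF c tm] comp_assoc[OF pa f1(1) tm] comp_assoc[OF pb f2(1) tm] ..
    then have "chtpy n S Y (cmap_comp t ?f) g"
      using chtpy_add[OF chtpy_comp_right[OF f1(2) pa] chtpy_comp_right[OF f2(2) pb]] split[OF g] by simp
    then show "\<exists>f. cmor n S W f \<and> chtpy n S Y (cmap_comp t f) g" using cmor_lin(1)[OF c] by blast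
  next
    fix f assume "cmor n S W f \<and> chtpy n S Y (cmap_comp t f) (cmap_zero S Y)"
    then have f: "cmor n S W f" and null: "chtpy n S Y (cmap_comp t f) (cmap_zero S Y)" by auto
    note S = cmorD(1)[OF f] and Y = cmorD(2)[OF tm]
    have "chtpy n A Y (cmap_comp t (cmap_comp f ia)) (cmap_zero A Y)"
      using chtpy_comp_right[OF null ia] comp_assoc[OF ia f tm] comp_zero(2)[OF ia] by simp
    then have 1: "chtpy n A W (cmap_comp f ia) (cmap_zero A W)"
      using kproj_null[OF A t cmor_comp[OF ia f]] by blast
    have "chtpy n B Y (cmap_comp t (cmap_comp f ib)) (cmap_zero B Y)"
      using chtpy_comp_right[OF null ib] comp_assoc[OF ib f tm] comp_zero(2)[OF ib] by simp
    then have 2: "chtpy n B W (cmap_comp f ib) (cmap_zero B W)"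
      using kproj_null[OF B t cmor_comp[OF ib f]] by blast
    show "chtpy n S W f (cmap_zero S W)"
      using chtpy_add[OF chtpy_comp_right[OF 1 pa] chtpy_comp_right[OF 2 pb]] split[OF f]
        comp_zero(2)[OF pa] comp_zero(2)[OF pb] by (simp add: add_zero_zero)
  }
qed

section \<open>Direct sums of matrices, representations and complexes\<close>

definition mat_inl :: "nat \<Rightarrow> nat \<Rightarrow> 'k::field mat" where
  "mat_inl d e = mat (d + e) d (\<lambda>(r, c). if r = c then 1 else 0)"

definition mat_inr :: "nat \<Rightarrow> nat \<Rightarrow> 'k::field mat" where
  "mat_inr d e = mat (d + e) e (\<lambda>(r, c). if r = c + d then 1 else 0)"

definition mat_prl :: "nat \<Rightarrow> nat \<Rightarrow> 'k::field mat" where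
  "mat_prl d e = mat d (d + e) (\<lambda>(r, c). if r = c then 1 else 0)"

definition mat_prr :: "nat \<Rightarrow> nat \<Rightarrow> 'k::field mat" where
  "mat_prr d e = mat e (d + e) (\<lambda>(r, c). if c = r + d then 1 else 0)"

lemma mat_inl_dims [simp]:
  "dim_row (mat_inl d e) = d + e" "dim_col (mat_inl d e) = d"
  "dim_row (mat_inr d e) = d + e" "dim_col (mat_inr d e) = e"
  "dim_row (mat_prl d e) = d" "dim_col (mat_prl d e) = d + e"
  "dim_row (mat_prr d e) = e" "dim_col (mat_prr d e) = d + e"
  by (simp_all add: mat_inl_def mat_inr_def mat_prl_def mat_prr_def)

lemma mat_biprod:
  "mat_prl d e * mat_inl d e = (1\<^sub>m d :: 'k::field mat)"
  "mat_prr d e * mat_inr d e = (1\<^sub>m e :: 'k::field mat)"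
  "mat_prl d e * mat_inr d e = (0\<^sub>m d e :: 'k::field mat)"
  "mat_prr d e * mat_inl d e = (0\<^sub>m e d :: 'k::field mat)"
  "mat_inl d e * mat_prl d e + mat_inr d e * mat_prr d e = (1\<^sub>m (d + e) :: 'k::field mat)"
proof -
  have *: "(\<Sum>x = 0..<N. (if x = a then 1 else 0) * (g x :: 'k)) = (if a < N then g a else 0)" for N a :: nat and g
  proof -
    have "(\<Sum>x = 0..<N. (if x = a then 1 else 0) * (g x :: 'k)) = (\<Sum>x = 0..<N. if x = a then g x else 0)"
      by (intro sum.cong) auto
    then show ?thesis by simp
  qed
  have **: "(\<Sum>x = 0..<N. (if a = x then 1 else 0) * (g x :: 'k)) = (if a < N then g a else 0)" for N a :: nat and g
    using *[where N = N and a = a and g = g] by (simp add: eq_commute[of a])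
  note defs = mat_inl_def mat_inr_def mat_prl_def mat_prr_def scalar_prod_def * **
  show "mat_prl d e * mat_inl d e = (1\<^sub>m d :: 'k::field mat)"
    "mat_prr d e * mat_inr d e = (1\<^sub>m e :: 'k::field mat)"
    "mat_prl d e * mat_inr d e = (0\<^sub>m d e :: 'k::field mat)"
    "mat_prr d e * mat_inl d e = (0\<^sub>m e d :: 'k::field mat)"
    by (intro eq_matI; simp add: defs)+
  have R: "(\<Sum>x = 0..<e. (if r = x + d then 1 else 0) * (if c = x + d then 1 else (0::'k))) =
      (if r = c \<and> d \<le> r then 1 else 0)" if "r < d + e" "c < d + e" for r c
  proof (cases "d \<le> r")
    case True
    then have "(\<Sum>x = 0..<e. (if r = x + d then 1 else 0) * (if c = x + d then 1 else (0::'k))) =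
       (\<Sum>x = 0..<e. (if r - d = x then 1 else 0) * (if c = x + d then 1 else (0::'k)))"
      by (intro sum.cong) auto
    also have "\<dots> = (if r = c \<and> d \<le> r then 1 else 0)" unfolding ** using True that by auto
    finally show ?thesis .
  next
    case False
    then show ?thesis by (intro trans[OF sum.neutral]) auto
  qed
  show "mat_inl d e * mat_prl d e + mat_inr d e * mat_prr d e = (1\<^sub>m (d + e) :: 'k::field mat)"
  proof (rule eq_matI)
    fix r c assume "r < dim_row (1\<^sub>m (d + e) :: 'k mat)" "c < dim_col (1\<^sub>m (d + e) :: 'k mat)"
    then show "(mat_inl d e * mat_prl d e + mat_inr d e * mat_prr d e) $$ (r, c) = (1\<^sub>m (d + e) :: 'k mat) $$ (r, c)"
      using R[of r c] by (simp add: defs)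
  qed simp_all
qed

text \<open>The block diagonal matrix, written with inclusions and projections so that products
  reduce to the equations \<open>mat_biprod\<close> and not to computations with indices.\<close>

definition mat_dsum :: "nat \<Rightarrow> nat \<Rightarrow> nat \<Rightarrow> nat \<Rightarrow> 'k::field mat \<Rightarrow> 'k mat \<Rightarrow> 'k mat" where
  "mat_dsum d' e' d e A B = mat_inl d' e' * (A * mat_prl d e) + mat_inr d' e' * (B * mat_prr d e)"

lemma mat_dsum_dims [simp]:
  "dim_row (mat_dsum d' e' d e A B) = d' + e'" "dim_col (mat_dsum d' e' d e A B) = d + e"
  by (simp_all add: mat_dsum_def)

lemma biprod_cancel:
  fixes M :: "'k::field mat"
  shows "dim_row M = d \<Longrightarrow> mat_prl d e * (mat_inl d e * M) = M"
  "dim_row M = e \<Longrightarrow> mat_prr d e * (mat_inr d e * M) = M"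
  "dim_row M = e \<Longrightarrow> mat_prl d e * (mat_inr d e * M) = 0\<^sub>m d (dim_col M)"
  "dim_row M = d \<Longrightarrow> mat_prr d e * (mat_inl d e * M) = 0\<^sub>m e (dim_col M)"
  by (simp_all add: mult_assoc_dim[symmetric] mat_biprod)

lemma add_zero_mat_dim:
  "dim_row A = r \<Longrightarrow> dim_col A = c \<Longrightarrow> A + 0\<^sub>m r c = (A :: 'k::field mat)"
  "dim_row A = r \<Longrightarrow> dim_col A = c \<Longrightarrow> 0\<^sub>m r c + A = (A :: 'k::field mat)"
  by (auto intro!: eq_matI)

lemma mat_dsum_mult:
  assumes A: "dim_row A = d'" "dim_col A = d" and B: "dim_row B = e'" "dim_col B = e"
  shows "mat_dsum d' e' d e A B * mat_inl d e = mat_inl d' e' * A"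
    "mat_dsum d' e' d e A B * mat_inr d e = mat_inr d' e' * B"
    "mat_prl d' e' * mat_dsum d' e' d e A B = A * mat_prl d e"
    "mat_prr d' e' * mat_dsum d' e' d e A B = B * mat_prr d e"
  using assms unfolding mat_dsum_def
  by (simp_all add: mult_assoc_dim add_mult_dim mult_add_dim mat_biprod biprod_cancel add_zero_mat_dim)

lemma mat_dsum_comp:
  assumes "dim_row A = d'" "dim_col A = d" "dim_row B = e'" "dim_col B = e"
    "dim_row A' = d''" "dim_col A' = d'" "dim_row B' = e''" "dim_col B' = e'"
  shows "mat_dsum d'' e'' d' e' A' B' * mat_dsum d' e' d e A B = mat_dsum d'' e'' d e (A' * A) (B' * B)"
  using assms unfolding mat_dsum_def[of d'' e'']
  by (simp add: mult_assoc_dim add_mult_dim mat_dsum_mult)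

lemma mat_dsum_zero:
  "mat_dsum d' e' d e (0\<^sub>m d' d) (0\<^sub>m e' e) = 0\<^sub>m (d' + e') (d + e)"
  by (simp add: mat_dsum_def)

definition rep_dsum :: "'k::field rep \<Rightarrow> 'k rep \<Rightarrow> 'k rep" where
  "rep_dsum V W = \<lparr>rdim = (\<lambda>a. rdim V a + rdim W a),
     rarr = (\<lambda>a. mat_dsum (rdim V a) (rdim W a) (rdim V (Suc a)) (rdim W (Suc a)) (rarr V a) (rarr W a))\<rparr>"

lemma is_rep_dsum: "is_rep n V \<Longrightarrow> is_rep n W \<Longrightarrow> is_rep n (rep_dsum V W)"
  unfolding is_rep_def by (auto simp: rep_dsum_def intro!: carrier_matI)

definition cpx_dsum :: "'k::field cpx \<Rightarrow> 'k cpx \<Rightarrow> 'k cpx" where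
  "cpx_dsum A B = \<lparr>obj = (\<lambda>m. rep_dsum (obj A m) (obj B m)),
     diff = (\<lambda>m a. mat_dsum (rdim (obj A (m + 1)) a) (rdim (obj B (m + 1)) a)
        (rdim (obj A m) a) (rdim (obj B m) a) (diff A m a) (diff B m a))\<rparr>"

lemma is_cpx_dsum:
  assumes A: "is_cpx n A" and B: "is_cpx n B"
  shows "is_cpx n (cpx_dsum A B)"
proof -
  note [simp] = is_cpx_dims[OF A] is_cpx_dims[OF B]
  have "is_repmap (obj (cpx_dsum A B) m) (obj (cpx_dsum A B) (m + 1)) (diff (cpx_dsum A B) m)" for m
    unfolding is_repmap_def
    by (simp add: cpx_dsum_def rep_dsum_def mat_dsum_comp carrier_mat_iff is_cpxD(8)[OF A] is_cpxD(8)[OF B])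
  moreover have "diff (cpx_dsum A B) (m + 1) a * diff (cpx_dsum A B) m a =
      0\<^sub>m (rdim (obj (cpx_dsum A B) (m + 1 + 1)) a) (rdim (obj (cpx_dsum A B) m) a)" for m a
    using is_cpxD(3)[OF A, of m a] is_cpxD(3)[OF B, of m a]
    by (simp add: cpx_dsum_def rep_dsum_def mat_dsum_comp mat_dsum_zero)
  moreover have "{m. \<exists>a. rdim (obj (cpx_dsum A B) m) a \<noteq> 0} \<subseteq>
      {m. \<exists>a. rdim (obj A m) a \<noteq> 0} \<union> {m. \<exists>a. rdim (obj B m) a \<noteq> 0}"
    by (auto simp: cpx_dsum_def rep_dsum_def)
  then have "finite {m. \<exists>a. rdim (obj (cpx_dsum A B) m) a \<noteq> 0}"
    using A B finite_subset unfolding is_cpx_def by blast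
  ultimately show ?thesis using is_cpxD(1)[OF A] is_cpxD(1)[OF B]
    by (simp add: is_cpx_def is_rep_dsum) (simp add: cpx_dsum_def is_rep_dsum)
qed

lemma cpx_biprod_dsum:
  assumes A: "is_cpx n A" and B: "is_cpx n B"
  shows "cpx_biprod n A B (cpx_dsum A B)
    (\<lambda>m a. mat_inl (rdim (obj A m) a) (rdim (obj B m) a)) (\<lambda>m a. mat_inr (rdim (obj A m) a) (rdim (obj B m) a))
    (\<lambda>m a. mat_prl (rdim (obj A m) a) (rdim (obj B m) a)) (\<lambda>m a. mat_prr (rdim (obj A m) a) (rdim (obj B m) a))"
proof -
  note [simp] = is_cpx_dims[OF A] is_cpx_dims[OF B]
  show ?thesis using A B is_cpx_dsum[OF A B]
    by (simp add: cpx_biprod_def cmor_def chain_map_def is_repmap_def carrier_mat_iff cpx_dsum_def rep_dsum_def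
        mat_dsum_mult cmap_comp_def cmap_id_def cmap_zero_def cmap_add_def mat_biprod)
qed

section \<open>Projective resolutions of complexes\<close>

text \<open>\<open>nat \<Rightarrow> 'k\<close> is a vector space for the locale \<open>vector_space\<close>, whose bases are used below.\<close>

definition vec_emb :: "'k::field vec \<Rightarrow> nat \<Rightarrow> 'k" where
  "vec_emb v = (\<lambda>i. if i < dim_vec v then v $ i else 0)"

lemma vec_emb_linear:
  assumes "u \<in> carrier_vec d" "v \<in> carrier_vec d"
  shows "vec_emb (u + v) = vec_emb u + vec_emb v" "vec_emb (c \<cdot>\<^sub>v u) = (\<lambda>i. c * vec_emb u i)"
  using assms by (auto simp: vec_emb_def fun_eq_iff)

lemma vec_emb_inj: "u \<in> carrier_vec d \<Longrightarrow> v \<in> carrier_vec d \<Longrightarrow> vec_emb u = vec_emb v \<Longrightarrow> u = v"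
  by (auto simp: vec_emb_def fun_eq_iff vec_eq_iff split: if_splits)

lemma vector_space_fun: "vector_space (\<lambda>(c::'k::field) (f :: nat \<Rightarrow> 'k) i. c * f i)"
  by unfold_locales (auto simp: fun_eq_iff algebra_simps)

lemma subspace_vec_emb:
  fixes S :: "'k::field vec set"
  assumes "vsub d S"
  shows "module.subspace (\<lambda>(c::'k) (f :: nat \<Rightarrow> 'k) i. c * f i) (vec_emb ` S)"
proof -
  interpret V: vector_space "\<lambda>(c::'k) (f :: nat \<Rightarrow> 'k) i. c * f i" by (rule vector_space_fun)
  have "vec_emb (0\<^sub>v d :: 'k vec) = 0" by (auto simp: vec_emb_def fun_eq_iff)
  then have "0 \<in> vec_emb ` S" using vsubD(2)[OF assms] by (metis imageI)
  moreover have "vec_emb u + vec_emb v \<in> vec_emb ` S" if "u \<in> S" "v \<in> S" for u v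
    using vec_emb_linear(1)[of u d v] vsubD[OF assms] that by (metis imageI)
  moreover have "(\<lambda>i. c * vec_emb u i) \<in> vec_emb ` S" if "u \<in> S" for u c
    using vec_emb_linear(2)[of u d u c] vsubD[OF assms] that by (metis imageI)
  ultimately show ?thesis unfolding V.subspace_def by blast
qed

text \<open>A basis of \<open>S\<close> stays independent when \<open>h\<close> is added, and a
  linear map can be prescribed on it as \<open>0\<close> on the basis and \<open>1\<close> on
  \<open>h\<close>. This functional provides the complement of an interval in
  \<open>resolve_sub\<close>.\<close>

lemma separating_functional:
  fixes S :: "'k::field vec set"
  assumes S: "vsub d S" and h: "h \<in> carrier_vec d" "h \<notin> S"
  obtains \<mu> :: "'k vec \<Rightarrow> 'k" where
    "\<And>u v. u \<in> carrier_vec d \<Longrightarrow> v \<in> carrier_vec d \<Longrightarrow> \<mu> (u + v) = \<mu> u + \<mu> v"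
    "\<And>c u. u \<in> carrier_vec d \<Longrightarrow> \<mu> (c \<cdot>\<^sub>v u) = c * \<mu> u"
    "\<And>s. s \<in> S \<Longrightarrow> \<mu> s = 0" "\<mu> h = 1"
proof -
  let ?sc = "\<lambda>(c::'k) (f :: nat \<Rightarrow> 'k) i. c * f i"
  interpret V: vector_space ?sc by (rule vector_space_fun)
  interpret F: vector_space "(*) :: 'k \<Rightarrow> 'k \<Rightarrow> 'k" by unfold_locales (auto simp: algebra_simps)
  interpret VF: vector_space_pair ?sc "(*) :: 'k \<Rightarrow> 'k \<Rightarrow> 'k" by unfold_locales
  have sub: "V.subspace (vec_emb ` S)" using subspace_vec_emb[OF S] .
  obtain B where B: "B \<subseteq> vec_emb ` S" "V.independent B" "vec_emb ` S \<subseteq> V.span B"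
    using V.basis_exists by metis
  have "V.span B = vec_emb ` S" using V.span_minimal[OF B(1) sub] B(3) by blast
  moreover have "vec_emb h \<notin> vec_emb ` S"
    using vec_emb_inj[OF h(1)] h(2) vsubD(1)[OF S] by blast
  ultimately have "V.independent (insert (vec_emb h) B)" using V.independent_insertI B(2) by metis
  then obtain g where g: "Vector_Spaces.linear ?sc (*) g"
    "\<forall>x\<in>insert (vec_emb h) B. g x = (if x = vec_emb h then 1 else 0)"
    using VF.linear_independent_extend[of "insert (vec_emb h) B" "\<lambda>x. if x = vec_emb h then 1 else 0"] by blast
  interpret g: Vector_Spaces.linear ?sc "(*)" g by fact
  have "vec_emb h \<notin> B" using \<open>vec_emb h \<notin> vec_emb ` S\<close> B(1) by blast
  then have "g x = 0" if "x \<in> B" for x using g(2) that by auto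
  then have "g x = 0" if "x \<in> V.span B" for x
    using VF.linear_eq_0_on_span[OF g(1)] that by blast
  then have "g (vec_emb s) = 0" if "s \<in> S" for s using that B(3) by blast
  moreover have "g (vec_emb (u + v)) = g (vec_emb u) + g (vec_emb v)"
    if "u \<in> carrier_vec d" "v \<in> carrier_vec d" for u v
    unfolding vec_emb_linear(1)[OF that] by (rule g.add)
  moreover have "g (vec_emb (c \<cdot>\<^sub>v u)) = c * g (vec_emb u)" if "u \<in> carrier_vec d" for u c
    unfolding vec_emb_linear(2)[OF that that] by (rule g.scale)
  ultimately show ?thesis using that[of "\<lambda>v. g (vec_emb v)"] g(2) by auto
qed

definition vsub_dim :: "'k::field vec set \<Rightarrow> nat" where
  "vsub_dim S = vector_space.dim (\<lambda>(c::'k) (f :: nat \<Rightarrow> 'k) i. c * f i) (vec_emb ` S)"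

text \<open>A basis of \<open>S\<close> together with a vector of \<open>T\<close> outside
  \<open>S\<close> is independent, so it is no larger than a basis of \<open>T\<close>. This drives
  the decrease of \<open>cohom_measure\<close>.\<close>

lemma vsub_dim_less:
  fixes S :: "'k::field vec set"
  assumes S: "vsub d S" and T: "vsub d T" and ST: "S \<subset> T"
  shows "vsub_dim S < vsub_dim T"
proof -
  let ?sc = "\<lambda>(c::'k) (f :: nat \<Rightarrow> 'k) i. c * f i"
  interpret V: vector_space ?sc by (rule vector_space_fun)
  let ?unit = "\<lambda>(i::nat) (k::nat). if k = i then 1 else (0::'k)"
  \<comment> \<open>The surrounding space of functions is infinite-dimensional; the first
    \<open>d\<close> unit functions ensure that bases of \<open>T\<close> are finite and
    cardinalities can be compared.\<close>
  have fin: "V.span (?unit ` {..<d}) \<supseteq> vec_emb ` T"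
  proof
    fix f assume "f \<in> vec_emb ` T"
    then obtain v where v: "v \<in> carrier_vec d" "f = vec_emb v" using vsubD(1)[OF T] by blast
    have "f = (\<Sum>i<d. ?sc (v $ i) (?unit i))"
    proof
      fix k
      have "(\<Sum>i<d. ?sc (v $ i) (?unit i)) k = (\<Sum>i<d. ?sc (v $ i) (?unit i) k)"
        by (induction d) auto
      also have "\<dots> = (\<Sum>i<d. if k = i then v $ i else 0)" by (intro sum.cong) auto
      also have "\<dots> = f k" using v by (auto simp: vec_emb_def)
      finally show "f k = (\<Sum>i<d. ?sc (v $ i) (?unit i)) k" ..
    qed
    also have "\<dots> \<in> V.span (?unit ` {..<d})"
      by (intro V.span_sum V.span_scale V.span_base) auto
    finally show "f \<in> V.span (?unit ` {..<d})" .
  qed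
  obtain B where B: "B \<subseteq> vec_emb ` S" "V.independent B" "vec_emb ` S \<subseteq> V.span B" "card B = V.dim (vec_emb ` S)"
    using V.basis_exists by metis
  obtain C where C: "C \<subseteq> vec_emb ` T" "V.independent C" "vec_emb ` T \<subseteq> V.span C" "card C = V.dim (vec_emb ` T)"
    using V.basis_exists by metis
  have finC: "finite C" using V.independent_span_bound[OF _ C(2)] C(1) fin by blast
  obtain x where x: "x \<in> T" "x \<notin> S" using ST by blast
  have "vec_emb x \<notin> vec_emb ` S"
    using vec_emb_inj vsubD(1)[OF S] vsubD(1)[OF T] x by blast
  then have xB: "vec_emb x \<notin> V.span B"
    using V.span_minimal[OF B(1) subspace_vec_emb[OF S]] by blast
  then have ind: "V.independent (insert (vec_emb x) B)" using V.independent_insertI B(2) by metis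
  have "insert (vec_emb x) B \<subseteq> V.span C" using B(1) C(3) ST x(1) by blast
  then have le: "finite (insert (vec_emb x) B) \<and> card (insert (vec_emb x) B) \<le> card C"
    by (rule V.independent_span_bound[OF finC ind])
  moreover have "vec_emb x \<notin> B" using xB V.span_base by blast
  ultimately have "card B < card C" by auto
  then show ?thesis using B(4) C(4) by (simp add: vsub_dim_def)
qed

section \<open>The cohomology of the two-term complexes\<close>

lemma mat_vec_smult:
  fixes A :: "'k::field mat"
  assumes "u \<in> carrier_vec (dim_col A)"
  shows "A *\<^sub>v (c \<cdot>\<^sub>v u) = c \<cdot>\<^sub>v (A *\<^sub>v u)"
  using mat_vec_linear(3)[OF assms assms] .

lemma Pcx_cocycle_gen:
  assumes ij: "i \<le> j" "j \<le> n" and a: "i < a" "a \<le> j"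
  shows "\<gamma> \<cdot>\<^sub>v gen j a \<in> cocycles (Pcx i j l :: 'k::field cpx) l a"
  by (simp add: cocycles_def Pcx_simps Pcx_diff_zero rdim_X)

lemma dim0_coboundary:
  assumes "is_cpx n X" "v \<in> cocycles X m a" "rdim (obj X m) a = 0"
  shows "v \<in> coboundaries X m a"
proof -
  have "v = 0\<^sub>v (rdim (obj X m) a)" using cocyclesD(1)[OF assms(2)] assms(3) by auto
  then show ?thesis using vsubD(2)[OF vsub_coboundaries[OF assms(1)]] by simp
qed

text \<open>The map \<open>P_i \<rightarrow> P_j\<close> is injective and is bijective at the
  vertices up to \<open>i\<close>, so the only cohomology is the cokernel in degree
  \<open>l\<close>, spanned by the class of \<open>gen j a\<close> for \<open>i < a\<close> and
  \<open>a \<le> j\<close>.\<close>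

lemma Pcx_cocycle_cases:
  assumes ij: "i \<le> j" "j \<le> n" and c: "c \<in> cocycles (Pcx i j l :: 'k::field cpx) m a"
  shows "c \<in> coboundaries (Pcx i j l) m a \<or> (m = l \<and> i < a \<and> a \<le> j \<and> (\<exists>\<gamma>. c = \<gamma> \<cdot>\<^sub>v gen j a))"
proof -
  let ?P = "Pcx i j l :: 'k cpx"
  have P: "is_cpx n ?P" using is_cpx_Pcx[OF ij] .
  note d0 = dim0_coboundary[OF P c]
  have incl: "vmap (X_rep 0 j) i (gen j i) a *\<^sub>v gen i a = (gen j a :: 'k vec)" if a: "0 < a" "a \<le> i"
  proof -
    have "vmap (X_rep 0 j) i (gen j i) a *\<^sub>v gen i a = transport (X_rep 0 j) i a (gen j i :: 'k vec)"
      using vmap_gen[OF is_rep_X[of j j], of "gen j i :: 'k vec" 0 i a] a by (simp add: rdim_X)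
    also have "\<dots> = transport (X_rep 0 j) i a (transport (X_rep 0 j) j i (gen j j))"
      unfolding transport_gen[OF ij(1)] ..
    also have "\<dots> = gen j a" unfolding transport_trans[OF a(2) ij(1)] using a ij by (intro transport_gen) simp
    finally show ?thesis .
  qed
  have inj: "\<gamma> = 0" if "\<gamma> \<cdot>\<^sub>v gen j a = (0\<^sub>v (X_dim 0 j a) :: 'k vec)" "0 < a" "a \<le> j" for \<gamma>
  proof -
    have "(\<gamma> \<cdot>\<^sub>v gen j a) $ 0 = (0\<^sub>v (X_dim 0 j a) :: 'k vec) $ 0" using that(1) by simp
    then show ?thesis using that by (simp add: gen_def X_dim_def)
  qed
  consider "m \<noteq> l" "m \<noteq> l - 1" | "m = l" "a \<le> i" "0 < a" | "m = l" "i < a" "a \<le> j" | "a = 0"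
    | "m = l" "j < a" | "m = l - 1" "0 < a" "a \<le> i" | "m = l - 1" "i < a"
    by linarith
  then show ?thesis
  proof cases
    case 1
    then show ?thesis using d0 by (simp add: Pcx_simps rdim_zero_rep)
  next
    case 2
    obtain \<gamma> where \<gamma>: "c = \<gamma> \<cdot>\<^sub>v gen j a"
      using cocyclesD(1)[OF c] vec_X0[of c j a] 2 by (auto simp: Pcx_simps rdim_X)
    have "c = diff ?P (l - 1) a *\<^sub>v (\<gamma> \<cdot>\<^sub>v gen i a)"
      using incl[OF 2(3,2)] by (simp add: \<gamma> mat_vec_smult Pcx_simps)
    then show ?thesis using 2 coboundariesI[of "\<gamma> \<cdot>\<^sub>v gen i a" ?P l a] by (simp add: Pcx_simps rdim_X)
  next
    case 3
    then show ?thesis using cocyclesD(1)[OF c] vec_X0[of c j a] by (auto simp: Pcx_simps rdim_X)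
  next
    case 4
    then show ?thesis using d0 is_repD(3)[OF is_cpxD(1)[OF P], of 0] by simp
  next
    case 5
    then show ?thesis using d0 by (simp add: Pcx_simps rdim_X X_dim_def)
  next
    case 6
    obtain \<gamma> where \<gamma>: "c = \<gamma> \<cdot>\<^sub>v gen i a"
      using cocyclesD(1)[OF c] vec_X0[of c i a] 6 by (auto simp: Pcx_simps rdim_X)
    have "\<gamma> \<cdot>\<^sub>v gen j a = (0\<^sub>v (X_dim 0 j a) :: 'k vec)"
      using cocyclesD(2)[OF c] incl[OF 6(2,3)] by (simp add: \<gamma> 6 mat_vec_smult Pcx_simps rdim_X)
    then have "\<gamma> = 0" using inj 6 ij by simp
    then have "c = 0\<^sub>v (rdim (obj ?P m) a)" using \<gamma> 6 by (auto simp: Pcx_simps rdim_X gen_def)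
    then show ?thesis using vsubD(2)[OF vsub_coboundaries[OF P]] by simp
  next
    case 7
    then show ?thesis using d0 by (simp add: Pcx_simps rdim_X X_dim_def)
  qed
qed

text \<open>\<open>Pcx 0 0 0\<close> is the zero complex.\<close>

inductive proj_sum :: "nat \<Rightarrow> 'k::field cpx \<Rightarrow> bool" for n where
  zero: "proj_sum n (Pcx 0 0 0)"
| add: "i < j \<Longrightarrow> j \<le> n \<Longrightarrow> proj_sum n Q \<Longrightarrow> proj_sum n (cpx_dsum (Pcx i j l) Q)"

lemma kproj_proj_sum: "proj_sum n Q \<Longrightarrow> kproj n Q"
proof (induction rule: proj_sum.induct)
  case zero
  then show ?case by (rule kproj_Pcx) auto
next
  case (add i j Q l)
  then have ij: "i \<le> j" "j \<le> n" by auto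
  show ?case
    by (rule kproj_biprod[OF cpx_biprod_dsum[OF is_cpx_Pcx[OF ij] kproj_cpx[OF add.IH]] kproj_Pcx[OF ij] add.IH])
qed

lemma add_vec:
  assumes f: "cmor n X Y f" and g: "cmor n X Y g" and v: "v \<in> carrier_vec (rdim (obj X i) a)"
  shows "cmap_add f g i a *\<^sub>v v = f i a *\<^sub>v v + g i a *\<^sub>v v"
  using v by (simp add: cmap_add_def mat_vec_linear_mats cmor_dims[OF f] cmor_dims[OF g])

lemma biprod_vec:
  assumes bi: "cpx_biprod n A B S ia ib pa pb"
  shows "v \<in> carrier_vec (rdim (obj A m) a) \<Longrightarrow> pa m a *\<^sub>v (ia m a *\<^sub>v v) = v"
    "v \<in> carrier_vec (rdim (obj B m) a) \<Longrightarrow> pb m a *\<^sub>v (ib m a *\<^sub>v v) = v"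
    "v \<in> carrier_vec (rdim (obj A m) a) \<Longrightarrow> pb m a *\<^sub>v (ia m a *\<^sub>v v) = 0\<^sub>v (rdim (obj B m) a)"
    "v \<in> carrier_vec (rdim (obj B m) a) \<Longrightarrow> pa m a *\<^sub>v (ib m a *\<^sub>v v) = 0\<^sub>v (rdim (obj A m) a)"
    "v \<in> carrier_vec (rdim (obj S m) a) \<Longrightarrow> v = ia m a *\<^sub>v (pa m a *\<^sub>v v) + ib m a *\<^sub>v (pb m a *\<^sub>v v)"
proof -
  have ia: "cmor n A S ia" and ib: "cmor n B S ib" and pa: "cmor n S A pa" and pb: "cmor n S B pb"
    and e1: "cmap_comp pa ia = cmap_id A" and e2: "cmap_comp pb ib = cmap_id B"
    and e3: "cmap_comp pa ib = cmap_zero B A" and e4: "cmap_comp pb ia = cmap_zero A B"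
    and e5: "cmap_add (cmap_comp ia pa) (cmap_comp ib pb) = cmap_id S"
    using bi by (auto simp: cpx_biprod_def)
  show "pa m a *\<^sub>v (ia m a *\<^sub>v v) = v" if "v \<in> carrier_vec (rdim (obj A m) a)"
    using comp_vec[OF ia pa that] that unfolding e1 by (simp add: cmap_id_def)
  show "pb m a *\<^sub>v (ib m a *\<^sub>v v) = v" if "v \<in> carrier_vec (rdim (obj B m) a)"
    using comp_vec[OF ib pb that] that unfolding e2 by (simp add: cmap_id_def)
  show "pb m a *\<^sub>v (ia m a *\<^sub>v v) = 0\<^sub>v (rdim (obj B m) a)" if "v \<in> carrier_vec (rdim (obj A m) a)"
    using comp_vec[OF ia pb that] that unfolding e4 by (simp add: cmap_zero_def)
  show "pa m a *\<^sub>v (ib m a *\<^sub>v v) = 0\<^sub>v (rdim (obj A m) a)" if "v \<in> carrier_vec (rdim (obj B m) a)"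
    using comp_vec[OF ib pa that] that unfolding e3 by (simp add: cmap_zero_def)
  show "v = ia m a *\<^sub>v (pa m a *\<^sub>v v) + ib m a *\<^sub>v (pb m a *\<^sub>v v)" if v: "v \<in> carrier_vec (rdim (obj S m) a)"
  proof -
    have "v = cmap_id S m a *\<^sub>v v" using v by (simp add: cmap_id_def)
    also have "\<dots> = cmap_comp ia pa m a *\<^sub>v v + cmap_comp ib pb m a *\<^sub>v v"
      unfolding e5[symmetric] by (rule add_vec[OF cmor_comp[OF pa ia] cmor_comp[OF pb ib] v])
    finally show ?thesis unfolding comp_vec[OF pa ia v] comp_vec[OF pb ib v] .
  qed
qed

text \<open>
  \<open>S\<close> stands for the graded subrepresentation of the cohomology of \<open>X\<close> with components
  \<open>S l a / coboundaries X l a\<close>, and \<open>onto_sub\<close> says that \<open>q\<close> induces an isomorphism onto it.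
\<close>

definition sub_cohom :: "nat \<Rightarrow> 'k::field cpx \<Rightarrow> (int \<Rightarrow> nat \<Rightarrow> 'k vec set) \<Rightarrow> bool" where
  "sub_cohom n X S \<longleftrightarrow> (\<forall>l a. vsub (rdim (obj X l) a) (S l a) \<and> coboundaries X l a \<subseteq> S l a \<and>
     S l a \<subseteq> cocycles X l a \<and> (\<forall>v\<in>S l (Suc a). rarr (obj X l) a *\<^sub>v v \<in> S l a))"

definition onto_sub :: "nat \<Rightarrow> 'k::field cpx \<Rightarrow> (int \<Rightarrow> nat \<Rightarrow> 'k vec set) \<Rightarrow> 'k cpx \<Rightarrow> 'k cmap \<Rightarrow> bool" where
  "onto_sub n X S Q q \<longleftrightarrow> cmor n Q X q \<and>
     (\<forall>l a. \<forall>w\<in>cocycles Q l a. q l a *\<^sub>v w \<in> S l a) \<and>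
     (\<forall>l a. \<forall>z\<in>S l a. \<exists>w\<in>cocycles Q l a. q l a *\<^sub>v w - z \<in> coboundaries X l a) \<and>
     (\<forall>l a. \<forall>w\<in>cocycles Q l a. q l a *\<^sub>v w \<in> coboundaries X l a \<longrightarrow> w \<in> coboundaries Q l a)"

text \<open>The total dimension of \<open>S\<close>, over a finite set of degrees because
  \<open>X\<close> is bounded. The coboundaries are counted too; they are the same for all
  \<open>S\<close>, so only changes of the cohomology part matter.\<close>

definition cohom_measure :: "nat \<Rightarrow> 'k::field cpx \<Rightarrow> (int \<Rightarrow> nat \<Rightarrow> 'k vec set) \<Rightarrow> nat" where
  "cohom_measure n X S = (\<Sum>(l, a)\<in>{l. \<exists>a. rdim (obj X l) a \<noteq> 0} \<times> {1..n}. vsub_dim (S l a))"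

lemma cohom_measure_less:
  assumes X: "is_cpx n X" and S: "sub_cohom n X S" and T: "sub_cohom n X T"
    and le: "\<And>m b. T m b \<subseteq> S m b" and x: "x \<in> S l a" "x \<notin> T l a"
  shows "cohom_measure n X T < cohom_measure n X S"
  unfolding cohom_measure_def
proof (rule sum_strict_mono_ex1)
  show "finite ({l. \<exists>a. rdim (obj X l) a \<noteq> 0} \<times> {1..n})" using X by (simp add: is_cpx_def)
  have vS: "vsub (rdim (obj X l) a) (S l a)" and vT: "vsub (rdim (obj X l) a) (T l a)" for l a
    using S T by (auto simp: sub_cohom_def)
  have "vsub_dim (T l a) \<le> vsub_dim (S l a)" for l a
    using vsub_dim_less[OF vT vS, of l a] le[of l a] by (cases "T l a = S l a") (auto simp: psubset_eq intro: less_imp_le)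
  then show "\<forall>y\<in>{l. \<exists>a. rdim (obj X l) a \<noteq> 0} \<times> {1..n}.
      (case y of (l, a) \<Rightarrow> vsub_dim (T l a)) \<le> (case y of (l, a) \<Rightarrow> vsub_dim (S l a))" by auto
  have "rdim (obj X l) a \<noteq> 0"
  proof
    assume "rdim (obj X l) a = 0"
    then have "x = 0\<^sub>v (rdim (obj X l) a)" using vsubD(1)[OF vS x(1)] by auto
    then show False using x(2) vsubD(2)[OF vT, of l a] by simp
  qed
  moreover then have "a \<in> {1..n}" using is_repD(3)[OF is_cpxD(1)[OF X], of a l] by auto
  moreover have "vsub_dim (T l a) < vsub_dim (S l a)"
    using vsub_dim_less[OF vT vS, of l a] le[of l a] x by blast
  ultimately show "\<exists>y\<in>{l. \<exists>a. rdim (obj X l) a \<noteq> 0} \<times> {1..n}.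
      (case y of (l, a) \<Rightarrow> vsub_dim (T l a)) < (case y of (l, a) \<Rightarrow> vsub_dim (S l a))"
    by (intro bexI[of _ "(l, a)"]) auto
qed

lemma vsub_dim0: assumes "vsub 0 S" shows "S = {0\<^sub>v 0}"
proof -
  have "v = 0\<^sub>v 0" if "v \<in> S" for v using vsubD(1)[OF assms that] by (auto intro!: eq_vecI)
  then show ?thesis using vsubD(2)[OF assms] by blast
qed

lemma vec_cancel:
  fixes a b c s z :: "'a::ab_group_add vec"
  assumes "a \<in> carrier_vec d" "b \<in> carrier_vec d" "z \<in> carrier_vec d"
  shows "(a + b) - z = b - (z - a)" "(a + b) - a = b"
  using assms by (auto simp: vec_eq_iff algebra_simps)

text \<open>
  With \<open>j\<close> the topmost vertex at which \<open>S\<close> is nonzero in some degree \<open>l\<close>, a class \<open>x\<close> there lives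
  exactly down to \<open>i + 1\<close>. A functional at \<open>i + 1\<close> with value \<open>1\<close> on the image of \<open>x\<close>, pulled back
  to the vertices up to \<open>j\<close>, cuts out a complement \<open>T\<close> of the interval generated by \<open>x\<close>.
\<close>

lemma resolve_sub:
  assumes X: "is_cpx n (X :: 'k::field cpx)"
  shows "sub_cohom n X S \<Longrightarrow> \<exists>Q q. proj_sum n Q \<and> onto_sub n X S Q q"
proof (induction "cohom_measure n X S" arbitrary: S rule: less_induct)
  case (less S)
  note [simp] = is_cpx_dims[OF X]
  have vS: "vsub (rdim (obj X l) a) (S l a)" and BS: "coboundaries X l a \<subseteq> S l a"
    and SZ: "S l a \<subseteq> cocycles X l a" and Sr: "v \<in> S l (Suc a) \<Longrightarrow> rarr (obj X l) a *\<^sub>v v \<in> S l a" for l a v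
    using less.prems by (auto simp: sub_cohom_def)
  note vB = vsub_coboundaries[OF X] and vZ = vsub_cocycles[OF X]
  have S_dim0: "S l a = coboundaries X l a" if "rdim (obj X l) a = 0" for l a
    using vsub_dim0 vS[of l a] vB[of l a] that by metis
  show ?case
  proof (cases "\<forall>l a. S l a = coboundaries X l a")
    case True
    let ?Q = "Pcx 0 0 0 :: 'k cpx"
    have Q: "is_cpx n ?Q" by (rule is_cpx_Pcx) auto
    have d: "rdim (obj ?Q m) a = 0" for m a
      by (auto simp: Pcx_def Pobj_def rdim_X rdim_zero_rep X_dim_def)
    let ?q = "cmap_zero ?Q X"
    have q0: "?q m a *\<^sub>v w = 0\<^sub>v (rdim (obj X m) a)" if "w \<in> cocycles ?Q m a" for m a w
      using cocyclesD(1)[OF that] by (simp add: cmap_zero_def)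
    have "onto_sub n X S ?Q ?q"
      unfolding onto_sub_def
    proof (intro conjI allI ballI impI)
      show "cmor n ?Q X ?q" using cmor_zero[OF Q X] .
      fix l a
      show "?q l a *\<^sub>v w \<in> S l a" if "w \<in> cocycles ?Q l a" for w
        using q0[OF that] vsubD(2)[OF vS] by simp
      show "\<exists>w\<in>cocycles ?Q l a. ?q l a *\<^sub>v w - z \<in> coboundaries X l a" if z: "z \<in> S l a" for z
      proof -
        have w: "0\<^sub>v (rdim (obj ?Q l) a) \<in> cocycles ?Q l a" using vsubD(2)[OF vsub_cocycles[OF Q]] .
        have "z \<in> coboundaries X l a" using z True by blast
        then have "?q l a *\<^sub>v 0\<^sub>v (rdim (obj ?Q l) a) - z \<in> coboundaries X l a"
          unfolding q0[OF w] using vsubD(2)[OF vB] vsubD(6)[OF vB] by blast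
        then show ?thesis using w by blast
      qed
      show "w \<in> coboundaries ?Q l a" if "w \<in> cocycles ?Q l a" for w
        using dim0_coboundary[OF Q that d] .
    qed
    then show ?thesis using proj_sum.zero by blast
  next
    case False
    then obtain l a0 where a0: "S l a0 \<noteq> coboundaries X l a0" by blast
    define J where "J = {a. S l a \<noteq> coboundaries X l a}"
    have "J \<subseteq> {1..n}"
      using S_dim0 is_repD(3)[OF is_cpxD(1)[OF X]] unfolding J_def by blast
    then have J: "finite J" "J \<noteq> {}" using finite_subset a0 by (auto simp: J_def)
    define j where "j = Max J"
    have jJ: "j \<in> J" using Max_in[OF J] by (simp add: j_def)
    have jn: "j \<le> n" using \<open>J \<subseteq> {1..n}\<close> jJ by auto
    have "Suc j \<notin> J" using Max_ge[OF J(1), of "Suc j"] by (auto simp: j_def)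
    then have Sj: "S l (Suc j) = coboundaries X l (Suc j)" by (simp add: J_def)
    obtain x where x: "x \<in> S l j" "x \<notin> coboundaries X l j" using jJ BS[of l j] by (auto simp: J_def)
    let ?V = "obj X l"
    have V: "is_rep n ?V" using is_cpxD(1)[OF X] .
    have xZ: "x \<in> cocycles X l j" and xc: "x \<in> carrier_vec (rdim ?V j)"
      using SZ x(1) vsubD(1)[OF vS] by blast+
    define D where "D = {a. a \<le> j \<and> transport ?V j a x \<in> coboundaries X l a}"
    \<comment> \<open>The zero space at the vertex \<open>0\<close> makes \<open>D\<close> nonempty;
      \<open>i = 0\<close> is the case of a class that survives down to the vertex
      \<open>1\<close>.\<close>
    have "0 \<in> D"
    proof -
      have "rdim ?V 0 = 0" using is_repD(3)[OF V, of 0] by simp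
      then show ?thesis using dim0_coboundary[OF X cpx_transport(4)[OF X _ xZ]] by (simp add: D_def)
    qed
    then have D: "finite D" "D \<noteq> {}" by (auto simp: D_def)
    define i where "i = Max D"
    have iD: "i \<in> D" using Max_in[OF D] by (simp add: i_def)
    have "j \<notin> D" using x by (simp add: D_def)
    then have ij: "i < j" using iD by (cases "i = j") (auto simp: D_def)
    then have ij': "i \<le> j" "Suc i \<le> j" by auto
    define h where "h = transport ?V j (Suc i) x"
    have "Suc i \<notin> D" using Max_ge[OF D(1), of "Suc i"] by (auto simp: i_def)
    then have hB: "h \<notin> coboundaries X l (Suc i)" using ij by (simp add: D_def h_def)
    have hc: "h \<in> carrier_vec (rdim ?V (Suc i))" using transport_carrier[OF V xc ij'(2)] by (simp add: h_def)
    have "transport ?V j i x \<in> coboundaries X l i" using iD by (simp add: D_def)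
    \<comment> \<open>The class of \<open>x\<close> dies at \<open>i\<close>, and a primitive
      \<open>y\<close> of its transport is the second datum of the chain map from
      \<open>Pcx i j l\<close> to \<open>X\<close>.\<close>
    then obtain y where y: "y \<in> carrier_vec (rdim (obj X (l - 1)) i)" "transport ?V j i x = diff X (l - 1) i *\<^sub>v y"
      by (rule coboundariesE)
    obtain \<mu> where \<mu>: "\<And>u v. u \<in> carrier_vec (rdim ?V (Suc i)) \<Longrightarrow> v \<in> carrier_vec (rdim ?V (Suc i)) \<Longrightarrow> \<mu> (u + v) = \<mu> u + \<mu> v"
      "\<And>c u. u \<in> carrier_vec (rdim ?V (Suc i)) \<Longrightarrow> \<mu> (c \<cdot>\<^sub>v u) = c * \<mu> u"
      "\<And>s. s \<in> coboundaries X l (Suc i) \<Longrightarrow> \<mu> s = 0" "\<mu> h = 1"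
      using separating_functional[OF vB hc hB] by metis
    let ?tr = "\<lambda>a. transport ?V a (Suc i)"
    have trc: "?tr a z \<in> carrier_vec (rdim ?V (Suc i))" if "z \<in> carrier_vec (rdim ?V a)" "Suc i \<le> a" for a z
      using transport_carrier[OF V that] .
    have trB: "\<mu> (?tr a b) = 0" if "b \<in> coboundaries X l a" "Suc i \<le> a" for a b
      using \<mu>(3)[OF cpx_transport(5)[OF X that(2,1)]] .
    have lin: "\<mu> (?tr a (u + v)) = \<mu> (?tr a u) + \<mu> (?tr a v)" "\<mu> (?tr a (c \<cdot>\<^sub>v u)) = c * \<mu> (?tr a u)"
      if "u \<in> carrier_vec (rdim ?V a)" "v \<in> carrier_vec (rdim ?V a)" "Suc i \<le> a" for u v a c
      using transport_linear[OF V that] trc[OF that(1,3)] trc[OF that(2,3)] \<mu>(1,2) by simp_all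
    have lin0: "\<mu> (?tr a (0\<^sub>v (rdim ?V a))) = 0" if "Suc i \<le> a" for a
      using trB[OF vsubD(2)[OF vB] that] .
    define T where "T = (\<lambda>m a. if m = l \<and> i < a \<and> a \<le> j then {z \<in> S l a. \<mu> (?tr a z) = 0} else S m a)"
    have TS: "T m a \<subseteq> S m a" for m a by (auto simp: T_def)
    have T: "sub_cohom n X T"
      unfolding sub_cohom_def
    proof (intro allI conjI ballI)
      fix m a
      show "vsub (rdim (obj X m) a) (T m a)"
      proof (cases "m = l \<and> i < a \<and> a \<le> j")
        case True
        then have a: "Suc i \<le> a" by simp
        note c = vsubD(1)[OF vS, of _ l a]
        show ?thesis unfolding vsub_def using True
          by (auto simp: T_def vsubD[OF vS] c lin[OF c c a] lin0[OF a])
      next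
        case False
        then have "T m a = S m a" by (auto simp: T_def)
        then show ?thesis using vS by simp
      qed
      show "coboundaries X m a \<subseteq> T m a" using BS trB by (auto simp: T_def)
      show "T m a \<subseteq> cocycles X m a" using TS SZ by blast
      fix v assume v: "v \<in> T m (Suc a)"
      then have vS': "v \<in> S m (Suc a)" using TS by blast
      then have rS: "rarr (obj X m) a *\<^sub>v v \<in> S m a" using Sr by blast
      \<comment> \<open>Between \<open>i + 1\<close> and \<open>j - 1\<close> the transport from
        \<open>a + 1\<close> factors through \<open>a\<close>. At \<open>a = j\<close> the
        maximality of \<open>j\<close> is used: everything that arrives from \<open>j + 1\<close> is
        a coboundary, on which \<open>\<mu>\<close> vanishes. Elsewhere \<open>T\<close> imposes no
        condition.\<close>
      show "rarr (obj X m) a *\<^sub>v v \<in> T m a"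
      proof (cases "m = l \<and> i < a \<and> a \<le> j")
        case True
        then have a: "Suc i \<le> a" "m = l" by auto
        show ?thesis
        proof (cases "a = j")
          case True
          then have "rarr ?V a *\<^sub>v v \<in> coboundaries X l a"
            using rarr_coboundaries[OF X, of v l a] vS' Sj a(2) by simp
          then show ?thesis using trB[OF _ a(1)] rS a True ij by (simp add: T_def)
        next
          case False
          then have "\<mu> (?tr (Suc a) v) = 0" using v True by (auto simp: T_def)
          moreover have "?tr (Suc a) v = ?tr a (rarr ?V a *\<^sub>v v)"
            using transport_trans[of "Suc i" a "Suc a" ?V v] a(1) by (simp add: transport_step)
          ultimately show ?thesis using rS True by (simp add: T_def)
        qed
      next
        case False
        then have "T m a = S m a" by (auto simp: T_def)
        then show ?thesis using rS by simp
      qed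
    qed
    have xT: "x \<notin> T l j" using ij \<mu>(4) by (simp add: T_def h_def)
    have "cohom_measure n X T < cohom_measure n X S"
      using cohom_measure_less[OF X less.prems T TS x(1) xT] .
    then obtain Q q where Q: "proj_sum n Q" and q: "onto_sub n X T Q q" using less.hyps[OF _ T] by blast
    have qm: "cmor n Q X q" and q1: "\<And>m a w. w \<in> cocycles Q m a \<Longrightarrow> q m a *\<^sub>v w \<in> T m a"
      and q2: "\<And>m a z. z \<in> T m a \<Longrightarrow> \<exists>w\<in>cocycles Q m a. q m a *\<^sub>v w - z \<in> coboundaries X m a"
      and q3: "\<And>m a w. w \<in> cocycles Q m a \<Longrightarrow> q m a *\<^sub>v w \<in> coboundaries X m a \<Longrightarrow> w \<in> coboundaries Q m a"
      using q by (auto simp: onto_sub_def)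
    let ?C = "Pcx i j l :: 'k cpx"
    have C: "is_cpx n ?C" using is_cpx_Pcx[OF ij'(1) jn] .
    have data: "Pcx_data i j l X x y" using xZ y by (simp add: Pcx_data_def)
    define f where "f = Pcx_map i j l X x y"
    have f: "cmor n ?C X f" "f l j *\<^sub>v gen j j = x"
      using cmor_PcxI[OF ij'(1) jn X data] by (simp_all add: f_def)
    have f_gen: "f l a *\<^sub>v (\<gamma> \<cdot>\<^sub>v gen j a) = \<gamma> \<cdot>\<^sub>v transport ?V j a x" if "a \<le> j" for a \<gamma>
      using repmap_X0_gen[OF V _ that, of "f l"] cmor_facts(3)[OF f(1), of l] f(2)
      by (simp add: Pcx_simps mat_vec_smult cmor_dims[OF f(1)] rdim_X)
    have fS: "f m a *\<^sub>v c \<in> S m a" if c: "c \<in> cocycles ?C m a" for m a c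
      using Pcx_cocycle_cases[OF ij'(1) jn c]
    proof
      assume "c \<in> coboundaries ?C m a"
      then show ?thesis using cmor_coboundaries[OF f(1)] BS by blast
    next
      assume "m = l \<and> i < a \<and> a \<le> j \<and> (\<exists>\<gamma>. c = \<gamma> \<cdot>\<^sub>v gen j a)"
      then obtain \<gamma> where *: "m = l" "a \<le> j" "c = \<gamma> \<cdot>\<^sub>v gen j a" by blast
      have "transport ?V j a x \<in> S l a"
        by (rule transport_closed[where S = "S l"]) (use Sr x(1) *(2) in auto)
      then show ?thesis using f_gen[OF *(2)] vsubD(4)[OF vS] * by simp
    qed
    let ?R = "cpx_dsum ?C Q"
    obtain ia ib pa pb where bi: "cpx_biprod n ?C Q ?R ia ib pa pb"
      using cpx_biprod_dsum[OF C cmorD(1)[OF qm]] by blast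
    then have ia: "cmor n ?C ?R ia" and ib: "cmor n Q ?R ib" and pa: "cmor n ?R ?C pa" and pb: "cmor n ?R Q pb"
      by (auto simp: cpx_biprod_def)
    define g where "g = cmap_add (cmap_comp f pa) (cmap_comp q pb)"
    have g: "cmor n ?R X g" using cmor_lin(1)[OF cmor_comp[OF pa f(1)] cmor_comp[OF pb qm]] by (simp add: g_def)
    have gv: "g m a *\<^sub>v w = f m a *\<^sub>v (pa m a *\<^sub>v w) + q m a *\<^sub>v (pb m a *\<^sub>v w)"
      if "w \<in> carrier_vec (rdim (obj ?R m) a)" for m a w
      unfolding g_def add_vec[OF cmor_comp[OF pa f(1)] cmor_comp[OF pb qm] that]
        comp_vec[OF pa f(1) that] comp_vec[OF pb qm that] ..
    note carf = cmor_vec_carrier[OF f(1)] and carq = cmor_vec_carrier[OF qm]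
    have "onto_sub n X S ?R g"
      unfolding onto_sub_def
    proof (intro conjI allI ballI impI g)
      fix m a w assume w: "w \<in> cocycles ?R m a"
      have 1: "f m a *\<^sub>v (pa m a *\<^sub>v w) \<in> S m a" using fS cmor_cocycles[OF pa w] by blast
      have 2: "q m a *\<^sub>v (pb m a *\<^sub>v w) \<in> T m a" using q1 cmor_cocycles[OF pb w] by blast
      then show "g m a *\<^sub>v w \<in> S m a"
        unfolding gv[OF cocyclesD(1)[OF w]] using 1 TS vsubD(3)[OF vS] by blast
    next
      fix m a z assume z: "z \<in> S m a"
      have zc: "z \<in> carrier_vec (rdim (obj X m) a)" using vsubD(1)[OF vS z] .
      have "\<exists>c\<in>cocycles ?C m a. z - f m a *\<^sub>v c \<in> T m a"
      proof (cases "m = l \<and> i < a \<and> a \<le> j")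
        case True
        then have a: "Suc i \<le> a" "a \<le> j" "m = l" by auto
        let ?t = "transport ?V j a x"
        have tc: "?t \<in> carrier_vec (rdim ?V a)" using transport_carrier[OF V xc a(2)] .
        \<comment> \<open>Since \<open>\<mu>\<close> is \<open>1\<close> on \<open>h\<close>, the
          transport of \<open>x\<close> to \<open>i + 1\<close>, subtracting \<open>\<gamma>\<close>
          times the transport of \<open>x\<close> to \<open>a\<close> moves \<open>z\<close> into
          the kernel that defines \<open>T\<close>.\<close>
        define \<gamma> where "\<gamma> = \<mu> (?tr a z)"
        have c: "\<gamma> \<cdot>\<^sub>v gen j a \<in> cocycles ?C l a" by (rule Pcx_cocycle_gen[OF ij'(1) jn]) (use a in auto)
        have fc: "f l a *\<^sub>v (\<gamma> \<cdot>\<^sub>v gen j a) = \<gamma> \<cdot>\<^sub>v ?t" using f_gen[OF a(2)] .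
        have zc': "z \<in> carrier_vec (rdim ?V a)" using zc a(3) by simp
        have "?tr a ?t = h" using transport_trans[OF a(1,2)] by (simp add: h_def)
        moreover have "z - \<gamma> \<cdot>\<^sub>v ?t = z + (- \<gamma>) \<cdot>\<^sub>v ?t" using zc' tc by (auto simp: vec_eq_iff)
        ultimately have "\<mu> (?tr a (z - \<gamma> \<cdot>\<^sub>v ?t)) = 0"
          using lin(1)[OF zc' _ a(1), of "(- \<gamma>) \<cdot>\<^sub>v ?t"] lin(2)[OF tc tc a(1), of "- \<gamma>"] tc \<mu>(4) by (simp add: \<gamma>_def)
        moreover have "z - \<gamma> \<cdot>\<^sub>v ?t \<in> S l a"
          using vsubD(6)[OF vS] z fS[OF c] a(3) unfolding fc by blast
        ultimately have "z - f m a *\<^sub>v (\<gamma> \<cdot>\<^sub>v gen j a) \<in> T m a" using fc True by (simp add: T_def)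
        then show ?thesis using c a(3) by blast
      next
        case False
        then have "T m a = S m a" by (auto simp: T_def)
        moreover have "z - f m a *\<^sub>v 0\<^sub>v (rdim (obj ?C m) a) = z" using zc by (simp add: cmor_dims[OF f(1)])
        ultimately show ?thesis using z vsubD(2)[OF vsub_cocycles[OF C], of m a] by (intro bexI) auto
      qed
      then obtain c where c: "c \<in> cocycles ?C m a" "z - f m a *\<^sub>v c \<in> T m a" by blast
      obtain w where w: "w \<in> cocycles Q m a" "q m a *\<^sub>v w - (z - f m a *\<^sub>v c) \<in> coboundaries X m a"
        using q2[OF c(2)] by blast
      note cc = cocyclesD(1)[OF c(1)] and wc = cocyclesD(1)[OF w(1)]
      let ?w = "ia m a *\<^sub>v c + ib m a *\<^sub>v w"
      have W: "?w \<in> cocycles ?R m a"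
        using vsubD(3)[OF vsub_cocycles[OF cmorD(1)[OF pa]]] cmor_cocycles[OF ia c(1)] cmor_cocycles[OF ib w(1)] by blast
      have "pa m a *\<^sub>v ?w = c" "pb m a *\<^sub>v ?w = w"
        using biprod_vec[OF bi] cc wc cmor_vec_carrier[OF ia] cmor_vec_carrier[OF ib]
        by (simp_all add: mat_vec_linear cmor_dims[OF pa] cmor_dims[OF pb])
      then have "g m a *\<^sub>v ?w - z = q m a *\<^sub>v w - (z - f m a *\<^sub>v c)"
        unfolding gv[OF cocyclesD(1)[OF W]] using vec_cancel(1)[OF carf carq zc] by simp
      then show "\<exists>w\<in>cocycles ?R m a. g m a *\<^sub>v w - z \<in> coboundaries X m a" using W w(2) by metis
    next
      fix m a w assume w: "w \<in> cocycles ?R m a" and gw: "g m a *\<^sub>v w \<in> coboundaries X m a"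
      define c where "c = pa m a *\<^sub>v w"
      define v where "v = pb m a *\<^sub>v w"
      have c: "c \<in> cocycles ?C m a" and v: "v \<in> cocycles Q m a"
        using cmor_cocycles[OF pa w] cmor_cocycles[OF pb w] by (auto simp: c_def v_def)
      have gw': "f m a *\<^sub>v c + q m a *\<^sub>v v \<in> coboundaries X m a"
        using gw unfolding gv[OF cocyclesD(1)[OF w]] c_def v_def .
      \<comment> \<open>The sum of the interval and \<open>T\<close> is direct: \<open>\<mu>\<close>
        vanishes on the coboundary \<open>f c + q v\<close> and on \<open>q v\<close>, which lies in
        \<open>T\<close>, while on \<open>f c\<close> it has the value
        \<open>\<gamma>\<close>.\<close>
      have cB: "c \<in> coboundaries ?C m a"
        using Pcx_cocycle_cases[OF ij'(1) jn c]
      proof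
        assume "m = l \<and> i < a \<and> a \<le> j \<and> (\<exists>\<gamma>. c = \<gamma> \<cdot>\<^sub>v gen j a)"
        then obtain \<gamma> where a: "m = l" "Suc i \<le> a" "a \<le> j" and \<gamma>: "c = \<gamma> \<cdot>\<^sub>v gen j a" by auto
        let ?t = "transport ?V j a x"
        have tc: "?t \<in> carrier_vec (rdim ?V a)" using transport_carrier[OF V xc a(3)] .
        have fc: "f l a *\<^sub>v c = \<gamma> \<cdot>\<^sub>v ?t" using f_gen[OF a(3)] by (simp add: \<gamma>)
        have qT: "\<mu> (?tr a (q l a *\<^sub>v v)) = 0" using q1[OF v] a by (simp add: T_def)
        have "?tr a ?t = h" using transport_trans[OF a(2,3)] by (simp add: h_def)
        then have "\<mu> (?tr a (f l a *\<^sub>v c + q l a *\<^sub>v v)) = \<gamma>"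
          unfolding fc using lin(1)[OF _ carq a(2), of "\<gamma> \<cdot>\<^sub>v ?t"] lin(2)[OF tc tc a(2), of \<gamma>] tc \<mu>(4) qT by simp
        then have "\<gamma> = 0" using trB[OF _ a(2)] gw' a(1) by simp
        then have "c = 0\<^sub>v (rdim (obj ?C m) a)" using \<gamma> a by (auto simp: Pcx_simps rdim_X gen_def)
        then show ?thesis using vsubD(2)[OF vsub_coboundaries[OF C]] by simp
      qed
      then have fc: "f m a *\<^sub>v c \<in> coboundaries X m a" using cmor_coboundaries[OF f(1)] by blast
      have "f m a *\<^sub>v c + q m a *\<^sub>v v - f m a *\<^sub>v c \<in> coboundaries X m a"
        using vsubD(6)[OF vB gw' fc] .
      then have "q m a *\<^sub>v v \<in> coboundaries X m a"
        unfolding vec_cancel(2)[OF carf carq carf] .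
      then have vB': "v \<in> coboundaries Q m a" using q3[OF v] by blast
      have "w = ia m a *\<^sub>v c + ib m a *\<^sub>v v"
        using biprod_vec(5)[OF bi cocyclesD(1)[OF w]] by (simp add: c_def v_def)
      then show "w \<in> coboundaries ?R m a"
        using vsubD(3)[OF vsub_coboundaries[OF cmorD(1)[OF pa]]] cmor_coboundaries[OF ia cB]
          cmor_coboundaries[OF ib vB'] by metis
    qed
    then show ?thesis using proj_sum.add[OF ij jn Q] by blast
  qed
qed

text \<open>For \<open>S\<close> consisting of all cocycles, the condition \<open>onto_sub\<close>
  is that of a quasi-isomorphism.\<close>

theorem resolve:
  assumes X: "is_cpx n (X :: 'k::field cpx)"
  shows "\<exists>Q q. proj_sum n Q \<and> qis n Q X q"
proof -
  have "sub_cohom n X (cocycles X)"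
    using vsub_cocycles[OF X] coboundaries_cocycles[OF X] rarr_cocycles[OF X] by (auto simp: sub_cohom_def)
  then obtain Q q where "proj_sum n Q" "onto_sub n X (cocycles X) Q q" using resolve_sub[OF X] by blast
  moreover then have "qis n Q X q" by (auto simp: onto_sub_def qis_def)
  ultimately show ?thesis by blast
qed

section \<open>Shifts and stalk complexes\<close>

lemma enough_kproj:
  "is_cpx n (X :: 'k::field cpx) \<Longrightarrow> \<exists>P q. kproj n P \<and> qis n P X q"
  using resolve kproj_proj_sum by blast

text \<open>The description of isomorphisms from \<open>D_iso_iff\<close>, which is visibly
  symmetric and compatible with shifts.\<close>

definition roof_iso :: "nat \<Rightarrow> 'k::field cpx \<Rightarrow> 'k cpx \<Rightarrow> bool" where
  "roof_iso n X Y \<longleftrightarrow> (\<exists>Z s t. qis n Z X s \<and> qis n Z Y t)"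

lemma D_iso_iff_roof_iso:
  "is_cpx n X \<Longrightarrow> is_cpx n Y \<Longrightarrow> D_iso n X Y \<longleftrightarrow> roof_iso n (X :: 'k::field cpx) Y"
  unfolding roof_iso_def by (rule D_iso_iff[OF enough_kproj])

lemma roof_iso_sym: "roof_iso n X Y \<Longrightarrow> roof_iso n Y X"
  by (auto simp: roof_iso_def)

text \<open>The lift of \<open>p\<close> along \<open>s\<close> is a quasi-isomorphism, so a
  K-projective resolution of one end of a span also resolves the other end.\<close>

lemma kproj_roof_qis:
  assumes P: "kproj n P" and s: "qis n Z X s" and t: "qis n Z Y t" and p: "qis n P X p"
  shows "\<exists>q. qis n P Y q"
proof -
  obtain f where f: "cmor n P Z f" "chtpy n P X (cmap_comp s f) p"
    using kproj_lift[OF P s qisD(1)[OF p]] .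
  have "qis n P Z f" using qis_cancel_left[OF f(1) s] qis_chtpy[OF chtpy_sym[OF f(2)] p] by blast
  then show ?thesis using qis_comp[OF _ t] by blast
qed

lemma kproj_roof_iso:
  assumes "kproj n P" "roof_iso n X Y" "qis n P X p"
  shows "\<exists>q. qis n P Y q"
  using assms kproj_roof_qis unfolding roof_iso_def by blast

section \<open>Shifts of complexes\<close>

lemma shift_simps [simp]:
  "obj (shift l X) i = obj X (i + l)"
  "diff (shift l X) i a = (if even l then diff X (i + l) a else - diff X (i + l) a)"
  by (simp_all add: shift_def)

lemma shift_0 [simp]: "shift 0 X = X"
  by (simp add: shift_def)

lemma shift_shift: "shift l (shift m X) = shift (l + m) X"
  by (auto simp: shift_def algebra_simps fun_eq_iff)

lemma is_cpx_shift:
  assumes X: "is_cpx n X"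
  shows "is_cpx n (shift l X)"
proof -
  note [simp] = is_cpx_dims[OF X]
  have e: "i + 1 + l = (i + l) + 1" for i by simp
  have 1: "is_repmap (obj X (i + l)) (obj X (i + l + 1)) (\<lambda>a. - diff X (i + l) a)" for i
    using is_repmap_lin(4)[OF is_cpxD(1)[OF X] is_cpxD(1)[OF X] is_cpxD(2)[OF X] is_cpxD(2)[OF X]] .
  have "{i. \<exists>a. rdim (obj X (i + l)) a \<noteq> 0} = (\<lambda>i. i - l) ` {i. \<exists>a. rdim (obj X i) a \<noteq> 0}"
    by (force simp: image_iff intro: exI[of _ "_ + l"])
  then have "finite {i. \<exists>a. rdim (obj X (i + l)) a \<noteq> 0}" using X by (simp add: is_cpx_def)
  moreover have "diff X (i + l + 1) a * diff X (i + l) a = 0\<^sub>m (rdim (obj X (i + l + 1 + 1)) a) (rdim (obj X (i + l)) a)" for i a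
    using is_cpxD(3)[OF X] .
  moreover have "is_repmap (obj X (i + l)) (obj X (i + l + 1)) (diff (shift l X) i)" for i
    using 1 is_cpxD(2)[OF X] by (cases "even l") (simp_all add: shift_def)
  ultimately show ?thesis
    unfolding is_cpx_def shift_simps(1) e
    using is_cpxD(1)[OF X] by (simp add: e)
qed

lemma cocycles_shift:
  assumes X: "is_cpx n X"
  shows "cocycles (shift l X) i a = cocycles X (i + l) a"
proof -
  note [simp] = is_cpx_dims[OF X]
  have e: "i + 1 + l = (i + l) + 1" by simp
  have "- diff X (i + l) a *\<^sub>v v = 0\<^sub>v (rdim (obj X (i + l + 1)) a) \<longleftrightarrow>
      diff X (i + l) a *\<^sub>v v = 0\<^sub>v (rdim (obj X (i + l + 1)) a)" if "v \<in> carrier_vec (rdim (obj X (i + l)) a)" for v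
    using that uminus_zero_vec_eq[OF cpx_vec_simps(1)[OF X], of "i + l" a v] by simp
  then show ?thesis unfolding cocycles_def shift_simps e by auto
qed

text \<open>The sign of the shifted differential is absorbed by replacing \<open>w\<close> with
  \<open>- w\<close>.\<close>

lemma coboundaries_shift:
  assumes X: "is_cpx n X"
  shows "coboundaries (shift l X) i a = coboundaries X (i + l) a"
proof -
  note [simp] = is_cpx_dims[OF X]
  have e: "i - 1 + l = (i + l) - 1" by simp
  have neg: "- diff X (i + l - 1) a *\<^sub>v w = diff X (i + l - 1) a *\<^sub>v (- w)"
    if "w \<in> carrier_vec (rdim (obj X (i + l - 1)) a)" for w
    using that by (simp add: mat_vec_linear(4)[of w _ w])
  have "(\<lambda>w. - diff X (i + l - 1) a *\<^sub>v w) ` carrier_vec (rdim (obj X (i + l - 1)) a) =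
      (\<lambda>w. diff X (i + l - 1) a *\<^sub>v w) ` carrier_vec (rdim (obj X (i + l - 1)) a)"
    by (auto simp: neg intro!: image_eqI[of _ _ "- _"])
  then show ?thesis unfolding coboundaries_def shift_simps e by auto
qed

lemma qis_shift:
  assumes f: "qis n X Y f"
  shows "qis n (shift l X) (shift l Y) (\<lambda>i. f (i + l))"
proof -
  note fm = qisD(1)[OF f]
  note X = cmorD(1)[OF fm] and Y = cmorD(2)[OF fm]
  note [simp] = is_cpx_dims[OF X] is_cpx_dims[OF Y] cmor_dims[OF fm]
  have e: "i + 1 + l = (i + l) + 1" for i by simp
  have "cmor n (shift l X) (shift l Y) (\<lambda>i. f (i + l))"
    unfolding cmor_def chain_map_def
    using is_cpx_shift[OF X] is_cpx_shift[OF Y] cmor_facts(3)[OF fm]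
    by (simp add: e cmor_facts(7)[OF fm])
  then show ?thesis using qisD[OF f]
    by (simp add: qis_def cocycles_shift[OF X] cocycles_shift[OF Y] coboundaries_shift[OF X] coboundaries_shift[OF Y])
qed

lemma roof_iso_shift: "roof_iso n X Y \<Longrightarrow> roof_iso n (shift l X) (shift l Y)"
  unfolding roof_iso_def using qis_shift by blast

section \<open>Stalk complexes of the indecomposable modules\<close>

lemma stalk_simps:
  "obj (stalk V) i = (if i = 0 then V else zero_rep)"
  "diff (stalk V) i a = 0\<^sub>m (rdim (obj (stalk V) (i + 1)) a) (rdim (obj (stalk V) i) a)"
  by (simp_all add: stalk_def Let_def)

lemma is_cpx_stalk:
  assumes "is_rep n V"
  shows "is_cpx n (stalk V)"
proof -
  have rep: "is_rep n (obj (stalk V) i)" for i using assms by (simp add: stalk_simps is_rep_zero)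
  have "is_repmap (obj (stalk V) i) (obj (stalk V) (i + 1)) (diff (stalk V) i)" for i
  proof -
    have "diff (stalk V) i = (\<lambda>a. 0\<^sub>m (rdim (obj (stalk V) (i + 1)) a) (rdim (obj (stalk V) i) a))"
      by (rule ext) (rule stalk_simps(2))
    then show ?thesis by (simp only:) (rule is_repmap_zero[OF rep rep])
  qed
  moreover have "{i. \<exists>a. rdim (obj (stalk V) i) a \<noteq> 0} \<subseteq> {0}"
    by (auto simp: stalk_simps rdim_zero_rep split: if_splits)
  then have "finite {i. \<exists>a. rdim (obj (stalk V) i) a \<noteq> 0}" using finite_subset by blast
  ultimately show ?thesis using rep unfolding is_cpx_def by (simp add: stalk_simps(2))
qed

text \<open>Indexed by the cohomological degree \<open>l\<close> in which the module sits, to match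
  \<open>Pcx i j l\<close>; this accounts for the sign in the shift.\<close>

abbreviation Xcx :: "nat \<Rightarrow> nat \<Rightarrow> int \<Rightarrow> 'k::field cpx" where
  "Xcx i j l \<equiv> shift (- l) (stalk (X_rep i j))"

lemma is_cpx_Xcx: "j \<le> n \<Longrightarrow> is_cpx n (Xcx i j l)"
  using is_cpx_shift is_cpx_stalk is_rep_X by blast

lemma obj_Xcx: "obj (Xcx i j l) m = (if m = l then X_rep i j else zero_rep)"
  by (simp add: stalk_simps)

lemma diff_Xcx:
  assumes "v \<in> carrier_vec (rdim (obj (Xcx i j l :: 'k::field cpx) m) a)"
  shows "diff (Xcx i j l :: 'k cpx) m a *\<^sub>v v = 0\<^sub>v (rdim (obj (Xcx i j l :: 'k cpx) (m + 1)) a)"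
proof -
  have e: "m + 1 + - l = m + - l + 1" by simp
  show ?thesis using assms unfolding shift_simps stalk_simps(2) e by auto
qed

lemma diff_Xcx':
  assumes "v \<in> carrier_vec (rdim (obj (Xcx i j l :: 'k::field cpx) (m - 1)) a)"
  shows "diff (Xcx i j l :: 'k cpx) (m - 1) a *\<^sub>v v = 0\<^sub>v (rdim (obj (Xcx i j l :: 'k cpx) m) a)"
  using diff_Xcx[OF assms] by simp

lemma cocycles_Xcx:
  "cocycles (Xcx i j l :: 'k::field cpx) m a = carrier_vec (rdim (obj (Xcx i j l :: 'k cpx) m) a)"
  unfolding cocycles_def by (auto simp: diff_Xcx simp del: shift_simps)

lemma coboundaries_Xcx:
  "coboundaries (Xcx i j l :: 'k::field cpx) m a = {0\<^sub>v (rdim (obj (Xcx i j l :: 'k cpx) m) a)}"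
proof -
  let ?S = "Xcx i j l :: 'k cpx" and ?C = "carrier_vec (rdim (obj (Xcx i j l :: 'k cpx) (m - 1)) a) :: 'k vec set"
  have "coboundaries ?S m a = (\<lambda>w. 0\<^sub>v (rdim (obj ?S m) a)) ` ?C"
    unfolding coboundaries_def by (rule image_cong[OF refl diff_Xcx'])
  also have "\<dots> = {0\<^sub>v (rdim (obj ?S m) a)}" using zero_carrier_vec by blast
  finally show ?thesis .
qed

lemma transport_X:
  assumes "a < b" "b \<le> j" "j \<le> c" "v \<in> carrier_vec 1"
  shows "transport (X_rep a c) j b v = (v :: 'k::field vec)"
  using assms(2,1)
proof (induction b rule: inc_induct)
  case (step b)
  then have "X_dim a c b = 1" "X_dim a c (Suc b) = 1" using assms(3) by (auto simp: X_dim_def)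
  then have "rarr (X_rep a c) b *\<^sub>v v = v"
    using assms(4) by (intro eq_vecI) (auto simp: X_rep_def scalar_prod_def)
  then show ?case using step by (simp add: transport_step)
qed simp

lemma vec_dim0: "v \<in> carrier_vec d \<Longrightarrow> d = 0 \<Longrightarrow> v = 0\<^sub>v d"
  by (auto intro!: eq_vecI)

text \<open>In degree \<open>l = m\<close> the data form the kernel of the transport from
  \<open>j\<close> to \<open>i\<close> in \<open>X_rep a b\<close>, in degree
  \<open>l = m + 1\<close> its cokernel. The transport is the identity of \<open>k\<close> if both
  \<open>j\<close> and \<open>i\<close> lie in \<open>{a<..b}\<close>, so the kernel needs
  \<open>j\<close> inside and \<open>i\<close> outside, the cokernel the reverse.\<close>

lemma null_Pcx_Xcx_iff:
  assumes ij: "i < j" "j \<le> n" and ab: "a < b" "b \<le> n"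
  shows "(\<forall>f. cmor n (Pcx i j l) (Xcx a b m) f \<longrightarrow>
      chtpy n (Pcx i j l) (Xcx a b m :: 'k::field cpx) f (cmap_zero (Pcx i j l) (Xcx a b m))) \<longleftrightarrow>
    (l = m \<longrightarrow> \<not> (i \<le> a \<and> a < j \<and> j \<le> b)) \<and> (l = m + 1 \<longrightarrow> \<not> (a < i \<and> i \<le> b \<and> b < j))" (is "?L \<longleftrightarrow> ?R")
proof -
  let ?P = "Pcx i j l :: 'k cpx" and ?S = "Xcx a b m :: 'k cpx"
  let ?V = "X_rep a b :: 'k rep"
  have ij': "i \<le> j" using ij by simp
  have S: "is_cpx n ?S" using is_cpx_Xcx ab by blast
  have oS: "obj ?S d = (if d = m then ?V else zero_rep)" for d by (rule obj_Xcx)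
  have V: "is_rep n ?V" using is_rep_X ab by blast
  \<comment> \<open>Since the differentials of the stalk complex vanish, the chain map with data
    \<open>x\<close> and \<open>y\<close> is null-homotopic if and only if \<open>x\<close> is zero
    and \<open>y\<close> is the transport of some \<open>u\<close>.\<close>
  have nullI: "?L" if *: "\<And>x y. Pcx_data i j l ?S x y \<Longrightarrow>
      x = 0\<^sub>v (rdim (obj ?S l) j) \<and> (\<exists>u\<in>carrier_vec (rdim (obj ?S (l - 1)) j). y = transport (obj ?S (l - 1)) j i u)"
  proof (intro allI impI)
    fix f assume f: "cmor n ?P ?S f"
    obtain u where u: "u \<in> carrier_vec (rdim (obj ?S (l - 1)) j)"
      and fx: "f l j *\<^sub>v gen j j = 0\<^sub>v (rdim (obj ?S l) j)"
      and fy: "f (l - 1) i *\<^sub>v gen i i = transport (obj ?S (l - 1)) j i u"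
      using *[OF Pcx_mor_data[OF f ij']] by blast
    let ?w = "0\<^sub>v (rdim (obj ?S (l - 1 - 1)) i) :: 'k vec"
    have w: "?w \<in> carrier_vec (rdim (obj ?S (l - 1 - 1)) i)" by simp
    have "transport (obj ?S (l - 1)) j i u \<in> carrier_vec (rdim (obj ?S (l - 1)) i)"
      using cpx_transport(1)[OF S ij' u] .
    then have "f (l - 1) i *\<^sub>v gen i i = diff ?S (l - 1 - 1) i *\<^sub>v ?w + transport (obj ?S (l - 1)) j i u"
      unfolding fy diff_Xcx'[OF w] by simp
    moreover have "f l j *\<^sub>v gen j j = diff ?S (l - 1) j *\<^sub>v u"
      unfolding fx diff_Xcx'[OF u] ..
    ultimately show "chtpy n ?P ?S f (cmap_zero ?P ?S)"
      unfolding Pcx_null_iff[OF f ij' ij(2)] using u w by blast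
  qed
  have nullD: "x = 0\<^sub>v (rdim (obj ?S l) j) \<and> (\<exists>u\<in>carrier_vec (rdim (obj ?S (l - 1)) j). y = transport (obj ?S (l - 1)) j i u)"
    if L: ?L and d: "Pcx_data i j l ?S x y" for x y
  proof -
    note f = cmor_PcxI[OF ij' ij(2) S d]
    have "chtpy n ?P ?S (Pcx_map i j l ?S x y) (cmap_zero ?P ?S)" using L f(1) by blast
    then obtain u w where u: "u \<in> carrier_vec (rdim (obj ?S (l - 1)) j)"
      and w: "w \<in> carrier_vec (rdim (obj ?S (l - 1 - 1)) i)"
      and xy: "x = diff ?S (l - 1) j *\<^sub>v u" "y = diff ?S (l - 1 - 1) i *\<^sub>v w + transport (obj ?S (l - 1)) j i u"
      unfolding Pcx_null_iff[OF f(1) ij' ij(2)] f(2,3) by blast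
    have "x = 0\<^sub>v (rdim (obj ?S l) j)" unfolding xy(1) by (rule diff_Xcx'[OF u])
    moreover have "y = transport (obj ?S (l - 1)) j i u"
      unfolding xy(2) diff_Xcx'[OF w] using cpx_transport(1)[OF S ij' u] by simp
    ultimately show ?thesis using u by blast
  qed
  have dataD: "x \<in> carrier_vec (rdim (obj ?S l) j)" "y \<in> carrier_vec (rdim (obj ?S (l - 1)) i)"
    "transport (obj ?S l) j i x = 0\<^sub>v (rdim (obj ?S l) i)" if "Pcx_data i j l ?S x y" for x y
  proof -
    show x: "x \<in> carrier_vec (rdim (obj ?S l) j)" and y: "y \<in> carrier_vec (rdim (obj ?S (l - 1)) i)"
      using that unfolding Pcx_data_def cocycles_Xcx by auto
    show "transport (obj ?S l) j i x = 0\<^sub>v (rdim (obj ?S l) i)"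
      using that diff_Xcx'[OF y] unfolding Pcx_data_def by (simp del: shift_simps)
  qed
  have dataI: "Pcx_data i j l ?S x y" if x: "x \<in> carrier_vec (rdim (obj ?S l) j)" and y: "y \<in> carrier_vec (rdim (obj ?S (l - 1)) i)"
    and xy: "transport (obj ?S l) j i x = 0\<^sub>v (rdim (obj ?S l) i)" for x y
    unfolding Pcx_data_def cocycles_Xcx diff_Xcx'[OF y] xy using x y by blast
  have zu: "0\<^sub>v (rdim (obj ?S (l - 1)) j) \<in> carrier_vec (rdim (obj ?S (l - 1)) j)" by simp
  have tz: "transport (obj ?S d) j i (0\<^sub>v (rdim (obj ?S d) j)) = 0\<^sub>v (rdim (obj ?S d) i)" for d
    using transport_zero[OF is_cpxD(1)[OF S] ij'] .
  consider "l = m" | "l = m + 1" | "l \<noteq> m" "l \<noteq> m + 1" by blast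
  then show ?thesis
  proof cases
    case 1
    have d1: "rdim (obj ?S l) c = X_dim a b c" "rdim (obj ?S (l - 1)) c = 0" for c
      by (simp_all add: 1 oS rdim_X rdim_zero_rep del: shift_simps)
    have o1: "obj ?S l = ?V" by (simp add: 1 oS del: shift_simps)
    show ?thesis
    proof (cases "i \<le> a \<and> a < j \<and> j \<le> b")
      case True
      let ?x = "vec 1 (\<lambda>_. 1) :: 'k vec"
      have dj: "X_dim a b j = 1" "X_dim a b i = 0" using True by (auto simp: X_dim_def)
      have x: "?x \<in> carrier_vec (rdim (obj ?S l) j)" by (simp add: d1 dj del: shift_simps)
      have y: "0\<^sub>v 0 \<in> carrier_vec (rdim (obj ?S (l - 1)) i)" by (simp add: d1 del: shift_simps)
      have "transport (obj ?S l) j i ?x = 0\<^sub>v (rdim (obj ?S l) i)"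
        using vec_dim0[OF cpx_transport(1)[OF S ij' x]] d1 dj by simp
      then have d: "Pcx_data i j l ?S ?x (0\<^sub>v 0)" using dataI[OF x y] by blast
      have "?x \<noteq> 0\<^sub>v (rdim (obj ?S l) j)"
      proof
        assume "?x = 0\<^sub>v (rdim (obj ?S l) j)"
        then have "?x $ 0 = (0\<^sub>v 1 :: 'k vec) $ 0" by (simp only: d1 dj)
        then show False by simp
      qed
      then have "\<not> ?L" using nullD[OF _ d] by blast
      then show ?thesis using True 1 by simp
    next
      case False
      have ?L
      proof (rule nullI)
        fix x y assume d: "Pcx_data i j l ?S x y"
        note dD = dataD[OF d]
        have "x = 0\<^sub>v (rdim (obj ?S l) j)"
        \<comment> \<open>If \<open>j\<close> lies in the interval, then so does \<open>i\<close>
          here; the transport is the identity and cannot kill a nonzero \<open>x\<close>.\<close>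
        proof (cases "a < j \<and> j \<le> b")
          case True
          then have "a < i" "X_dim a b j = 1" "X_dim a b i = 1" using False ij by (auto simp: X_dim_def)
          then show ?thesis using transport_X[of a i j b x] dD(1,3) True ij' by (simp add: d1 o1 rdim_X del: shift_simps)
        next
          case False
          then have "X_dim a b j = 0" by (simp add: X_dim_def)
          then show ?thesis using vec_dim0[OF dD(1)] by (simp add: d1 del: shift_simps)
        qed
        moreover have "y = transport (obj ?S (l - 1)) j i (0\<^sub>v (rdim (obj ?S (l - 1)) j))"
          unfolding tz using vec_dim0[OF dD(2)] d1 by simp
        ultimately show "x = 0\<^sub>v (rdim (obj ?S l) j) \<and>
          (\<exists>u\<in>carrier_vec (rdim (obj ?S (l - 1)) j). y = transport (obj ?S (l - 1)) j i u)" using zu by blast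
      qed
      then show ?thesis using False 1 by simp
    qed
  next
    case 2
    have d1: "rdim (obj ?S (l - 1)) c = X_dim a b c" "rdim (obj ?S l) c = 0" for c
      by (simp_all add: 2 oS rdim_X rdim_zero_rep del: shift_simps)
    have o1: "obj ?S (l - 1) = ?V" by (simp add: 2 oS del: shift_simps)
    show ?thesis
    proof (cases "a < i \<and> i \<le> b \<and> b < j")
      case True
      let ?y = "vec 1 (\<lambda>_. 1) :: 'k vec"
      have dj: "X_dim a b i = 1" "X_dim a b j = 0" using True by (auto simp: X_dim_def)
      have y: "?y \<in> carrier_vec (rdim (obj ?S (l - 1)) i)" by (simp add: d1 dj del: shift_simps)
      have x: "0\<^sub>v 0 \<in> carrier_vec (rdim (obj ?S l) j)" by (simp add: d1 del: shift_simps)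
      have "transport (obj ?S l) j i (0\<^sub>v 0) = 0\<^sub>v (rdim (obj ?S l) i)"
        using vec_dim0[OF cpx_transport(1)[OF S ij' x]] d1 by simp
      then have d: "Pcx_data i j l ?S (0\<^sub>v 0) ?y" using dataI[OF x y] by blast
      have "?y \<noteq> transport (obj ?S (l - 1)) j i u" if "u \<in> carrier_vec (rdim (obj ?S (l - 1)) j)" for u
      proof
        assume "?y = transport (obj ?S (l - 1)) j i u"
        also have "u = 0\<^sub>v (rdim (obj ?S (l - 1)) j)" using vec_dim0[OF that] d1 dj by simp
        finally have "?y $ 0 = (0\<^sub>v 1 :: 'k vec) $ 0" unfolding tz by (simp only: d1 dj)
        then show False by simp
      qed
      then have "\<not> ?L" using nullD[OF _ d] by blast
      then show ?thesis using True 2 by simp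
    next
      case False
      have ?L
      proof (rule nullI)
        fix x y assume d: "Pcx_data i j l ?S x y"
        note dD = dataD[OF d]
        have "x = 0\<^sub>v (rdim (obj ?S l) j)" using vec_dim0[OF dD(1)] d1 by simp
        moreover have "\<exists>u\<in>carrier_vec (rdim (obj ?S (l - 1)) j). y = transport (obj ?S (l - 1)) j i u"
        \<comment> \<open>If \<open>i\<close> lies in the interval, then so does \<open>j\<close>
          here; the transport is the identity, and \<open>u = y\<close> is a preimage.\<close>
        proof (cases "a < i \<and> i \<le> b")
          case True
          then have "j \<le> b" "X_dim a b j = 1" "X_dim a b i = 1" using False ij by (auto simp: X_dim_def)
          then show ?thesis using transport_X[of a i j b y] dD(2) True ij'
            by (intro bexI[of _ y]) (simp_all add: d1 o1 rdim_X del: shift_simps)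
        next
          case False
          then have "X_dim a b i = 0" by (simp add: X_dim_def)
          then have "y = 0\<^sub>v (rdim (obj ?S (l - 1)) i)" using vec_dim0[OF dD(2)] by (simp add: d1 del: shift_simps)
          then show ?thesis using tz[of "l - 1"] zu by metis
        qed
        ultimately show "x = 0\<^sub>v (rdim (obj ?S l) j) \<and>
          (\<exists>u\<in>carrier_vec (rdim (obj ?S (l - 1)) j). y = transport (obj ?S (l - 1)) j i u)" by blast
      qed
      then show ?thesis using False 2 by simp
    qed
  next
    case 3
    have d1: "rdim (obj ?S (l - 1)) c = 0" "rdim (obj ?S l) c = 0" for c
      using 3 by (simp_all add: oS rdim_zero_rep del: shift_simps)
    have ?L
    proof (rule nullI)
      fix x y assume d: "Pcx_data i j l ?S x y"
      note dD = dataD[OF d]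
      have "x = 0\<^sub>v (rdim (obj ?S l) j)" using vec_dim0[OF dD(1)] d1 by simp
      moreover have "y = transport (obj ?S (l - 1)) j i (0\<^sub>v (rdim (obj ?S (l - 1)) j))"
        unfolding tz using vec_dim0[OF dD(2)] d1 by simp
      ultimately show "x = 0\<^sub>v (rdim (obj ?S l) j) \<and>
        (\<exists>u\<in>carrier_vec (rdim (obj ?S (l - 1)) j). y = transport (obj ?S (l - 1)) j i u)" using zu by blast
    qed
    then show ?thesis using 3 by simp
  qed
qed

section \<open>Exceptional objects\<close>

text \<open>At the vertices above \<open>i\<close> the term in degree \<open>l - 1\<close> is zero,
  so that zero is the only coboundary.\<close>

lemma Pcx_gen_coboundary:
  assumes ij: "i < j" "j \<le> n" and a: "i < a" "a \<le> j"
    and b: "\<gamma> \<cdot>\<^sub>v gen j a \<in> coboundaries (Pcx i j l :: 'k::field cpx) l a"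
  shows "\<gamma> = 0"
  using b
proof (rule coboundariesE)
  let ?P = "Pcx i j l :: 'k cpx"
  have P: "is_cpx n ?P" by (rule is_cpx_Pcx) (use ij in auto)
  fix w assume w: "w \<in> carrier_vec (rdim (obj ?P (l - 1)) a)" and eq: "\<gamma> \<cdot>\<^sub>v gen j a = diff ?P (l - 1) a *\<^sub>v w"
  have d0: "rdim (obj ?P (l - 1)) a = 0" using a by (simp add: Pcx_simps rdim_X X_dim_def)
  have w0: "w = 0\<^sub>v (rdim (obj ?P (l - 1)) a)" using vec_dim0[OF w d0] .
  have "\<gamma> \<cdot>\<^sub>v gen j a = (0\<^sub>v (X_dim 0 j a) :: 'k vec)"
    unfolding eq w0 using is_cpx_dims[OF P] by (simp add: Pcx_simps rdim_X)
  then have "(\<gamma> \<cdot>\<^sub>v gen j a) $ 0 = (0\<^sub>v (X_dim 0 j a) :: 'k vec) $ 0" by simp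
  then show ?thesis using a by (simp add: gen_def X_dim_def)
qed

text \<open>The support of the cohomology of \<open>E\<close>; it recovers \<open>i\<close>, \<open>j\<close> and \<open>l\<close> from \<open>Pcx i j l\<close>.\<close>

definition cohom_at :: "'k::field cpx \<Rightarrow> int \<Rightarrow> nat \<Rightarrow> bool" where
  "cohom_at E m a \<longleftrightarrow> \<not> cocycles E m a \<subseteq> coboundaries E m a"

lemma cohom_at_qis:
  assumes q: "qis n X Y q"
  shows "cohom_at X m a \<longleftrightarrow> cohom_at Y m a"
proof -
  note qm = qisD(1)[OF q]
  note B = vsub_coboundaries[OF cmorD(2)[OF qm]]
  have "cocycles X m a \<subseteq> coboundaries X m a" if "cocycles Y m a \<subseteq> coboundaries Y m a"
    using that qisD(3)[OF q] cmor_cocycles[OF qm] by blast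
  moreover have "cocycles Y m a \<subseteq> coboundaries Y m a" if X: "cocycles X m a \<subseteq> coboundaries X m a"
  proof
    fix z assume z: "z \<in> cocycles Y m a"
    then obtain w where w: "w \<in> cocycles X m a" "q m a *\<^sub>v w - z \<in> coboundaries Y m a"
      using qisD(2)[OF q] by blast
    then have qw: "q m a *\<^sub>v w \<in> coboundaries Y m a" using X cmor_coboundaries[OF qm] by blast
    have "q m a *\<^sub>v w - (q m a *\<^sub>v w - z) \<in> coboundaries Y m a" using vsubD(6)[OF B qw w(2)] .
    then show "z \<in> coboundaries Y m a"
      using vec_arith(4)[OF cmor_vec_carrier[OF qm] cocyclesD(1)[OF z] cocyclesD(1)[OF z]] by simp
  qed
  ultimately show ?thesis by (auto simp: cohom_at_def)
qed

lemma cohom_at_Pcx: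
  assumes ij: "i < j" "j \<le> n"
  shows "cohom_at (Pcx i j l :: 'k::field cpx) m a \<longleftrightarrow> m = l \<and> i < a \<and> a \<le> j"
proof
  assume "cohom_at (Pcx i j l :: 'k::field cpx) m a"
  then show "m = l \<and> i < a \<and> a \<le> j"
    using Pcx_cocycle_cases[of i j n] ij unfolding cohom_at_def by fastforce
next
  assume a: "m = l \<and> i < a \<and> a \<le> j"
  have "1 \<cdot>\<^sub>v gen j a \<in> cocycles (Pcx i j l :: 'k::field cpx) m a"
    using Pcx_cocycle_gen[of i j n a "1 :: 'k" l] ij a by simp
  moreover have "1 \<cdot>\<^sub>v gen j a \<notin> coboundaries (Pcx i j l :: 'k::field cpx) m a"
    using Pcx_gen_coboundary[OF ij, of a "1 :: 'k" l] a by auto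
  ultimately show "cohom_at (Pcx i j l :: 'k::field cpx) m a" by (auto simp: cohom_at_def)
qed

lemma qis_Pcx_unique:
  assumes "i < j" "j \<le> n" "i' < j'" "j' \<le> n" "qis n (Pcx i j l) E p" "qis n (Pcx i' j' l') (E :: 'k::field cpx) p'"
  shows "i = i' \<and> j = j' \<and> l = l'"
proof -
  have *: "m = l \<and> i < a \<and> a \<le> j \<longleftrightarrow> m = l' \<and> i' < a \<and> a \<le> j'" for m a
    using cohom_at_Pcx[OF assms(1,2), where 'k = 'k] cohom_at_Pcx[OF assms(3,4), where 'k = 'k]
      cohom_at_qis[OF assms(5)] cohom_at_qis[OF assms(6)] by metis
  show ?thesis using *[of l j] *[of l' j'] *[of l "Suc i"] *[of l' "Suc i'"] assms(1,3) by auto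
qed

text \<open>The map is the augmentation from the projective at \<open>j\<close> onto the module: the
  generator goes to \<open>1\<close>, and the datum in degree \<open>l - 1\<close> is the empty
  vector.\<close>

lemma qis_Pcx_Xcx:
  assumes ij: "i < j" "j \<le> n"
  shows "\<exists>q. qis n (Pcx i j l) (Xcx i j l :: 'k::field cpx) q"
proof -
  let ?P = "Pcx i j l :: 'k cpx" and ?S = "Xcx i j l :: 'k cpx"
  have ij': "i \<le> j" using ij by simp
  have S: "is_cpx n ?S" using is_cpx_Xcx ij by blast
  have P: "is_cpx n ?P" using is_cpx_Pcx[OF ij' ij(2)] .
  have oS: "obj ?S d = (if d = l then X_rep i j else zero_rep)" for d by (rule obj_Xcx)
  define o1 where "o1 = (vec 1 (\<lambda>_. 1) :: 'k vec)"
  have o1: "o1 \<in> carrier_vec 1" "o1 $ 0 = 1" by (auto simp: o1_def)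
  have dl: "rdim (obj ?S l) a = X_dim i j a" for a by (simp add: oS rdim_X del: shift_simps)
  have dj: "X_dim i j j = 1" "X_dim i j i = 0" using ij by (auto simp: X_dim_def)
  have dl1: "rdim (obj ?S (l - 1)) a = 0" for a by (simp add: oS rdim_zero_rep del: shift_simps)
  have x: "o1 \<in> carrier_vec (rdim (obj ?S l) j)" using o1 by (simp add: dl dj del: shift_simps)
  have y: "0\<^sub>v 0 \<in> carrier_vec (rdim (obj ?S (l - 1)) i)" by (simp add: dl1 del: shift_simps)
  have xy: "transport (obj ?S l) j i o1 = 0\<^sub>v (rdim (obj ?S l) i)"
    using vec_dim0[OF cpx_transport(1)[OF S ij' x]] dl dj by simp
  have "Pcx_data i j l ?S o1 (0\<^sub>v 0)"
    unfolding Pcx_data_def cocycles_Xcx diff_Xcx'[OF y] xy using x y by blast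
  note f = cmor_PcxI[OF ij' ij(2) S this]
  define g where "g = Pcx_map i j l ?S o1 (0\<^sub>v 0)"
  have g: "cmor n ?P ?S g" "g l j *\<^sub>v gen j j = o1" using f by (auto simp: g_def)
  have g_gen: "g l a *\<^sub>v (\<gamma> \<cdot>\<^sub>v gen j a) = \<gamma> \<cdot>\<^sub>v o1" if "i < a" "a \<le> j" for a \<gamma>
  proof -
    have "g l a *\<^sub>v gen j a = transport (obj ?S l) j a o1"
      using repmap_X0_gen[OF is_cpxD(1)[OF S, of l] _ that(2), of "g l"] cmor_facts(3)[OF g(1), of l] g(2)
      by (simp add: Pcx_simps del: shift_simps)
    also have "\<dots> = o1" using transport_X[OF that order_refl o1(1)] by (simp add: oS del: shift_simps)
    finally show ?thesis using cmor_dims[OF g(1)]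
      by (simp add: mat_vec_smult Pcx_simps rdim_X del: shift_simps)
  qed
  have "qis n ?P ?S g"
    unfolding qis_def
  proof (intro conjI allI ballI impI g)
    fix m a z assume z: "z \<in> cocycles ?S m a"
    show "\<exists>w\<in>cocycles ?P m a. g m a *\<^sub>v w - z \<in> coboundaries ?S m a"
    proof (cases "m = l \<and> i < a \<and> a \<le> j")
      case True
      let ?w = "z $ 0 \<cdot>\<^sub>v gen j a"
      have w: "?w \<in> cocycles ?P m a" using Pcx_cocycle_gen[of i j n a "z $ 0" l] ij True by simp
      have zc: "z \<in> carrier_vec 1" using cocyclesD(1)[OF z] True by (simp add: oS rdim_X X_dim_def del: shift_simps)
      then have "z $ 0 \<cdot>\<^sub>v o1 = z" using o1 by (auto simp: vec_eq_iff)
      then have "g m a *\<^sub>v ?w = z" using g_gen[of a "z $ 0"] True by simp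
      then have "g m a *\<^sub>v ?w - z = 0\<^sub>v (rdim (obj ?S m) a)" using cocyclesD(1)[OF z] by (simp del: shift_simps)
      then show ?thesis unfolding coboundaries_Xcx using w by blast
    next
      case False
      then have d0: "rdim (obj ?S m) a = 0" by (auto simp: oS rdim_X rdim_zero_rep X_dim_def simp del: shift_simps)
      let ?w = "0\<^sub>v (rdim (obj ?P m) a) :: 'k vec"
      have w: "?w \<in> cocycles ?P m a" using vsubD(2)[OF vsub_cocycles[OF P]] .
      have "g m a *\<^sub>v ?w - z \<in> carrier_vec (rdim (obj ?S m) a)"
        using cmor_vec_carrier[OF g(1)] cocyclesD(1)[OF z] by (simp del: shift_simps)
      then have "g m a *\<^sub>v ?w - z = 0\<^sub>v (rdim (obj ?S m) a)" using vec_dim0 d0 by blast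
      then show ?thesis unfolding coboundaries_Xcx using w by blast
    qed
  next
    fix m a w assume w: "w \<in> cocycles ?P m a" and gw: "g m a *\<^sub>v w \<in> coboundaries ?S m a"
    show "w \<in> coboundaries ?P m a"
      using Pcx_cocycle_cases[OF ij' ij(2) w]
    proof
      assume "m = l \<and> i < a \<and> a \<le> j \<and> (\<exists>\<gamma>. w = \<gamma> \<cdot>\<^sub>v gen j a)"
      then obtain \<gamma> where *: "m = l" "i < a" "a \<le> j" "w = \<gamma> \<cdot>\<^sub>v gen j a" by blast
      then have "rdim (obj ?S m) a = 1" by (simp add: oS rdim_X X_dim_def del: shift_simps)
      then have "\<gamma> \<cdot>\<^sub>v o1 = 0\<^sub>v 1" using gw g_gen[OF *(2,3), of \<gamma>] * unfolding coboundaries_Xcx by simp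
      then have "(\<gamma> \<cdot>\<^sub>v o1) $ 0 = (0\<^sub>v 1 :: 'k vec) $ 0" by simp
      then have "\<gamma> = 0" using o1 by simp
      then have "w = 0\<^sub>v (rdim (obj ?P m) a)" using * by (auto simp: Pcx_simps rdim_X gen_def)
      then show ?thesis using vsubD(2)[OF vsub_coboundaries[OF P]] by simp
    qed
  qed
  then show ?thesis by blast
qed

lemma roof_iso_Xcx_iff:
  assumes ij: "i < j" "j \<le> n"
  shows "roof_iso n (E :: 'k::field cpx) (Xcx i j l) \<longleftrightarrow> (\<exists>q. qis n (Pcx i j l) E q)"
proof
  obtain p where p: "qis n (Pcx i j l) (Xcx i j l :: 'k cpx) p" using qis_Pcx_Xcx[OF ij] by blast
  have K: "kproj n (Pcx i j l :: 'k cpx)" by (rule kproj_Pcx) (use ij in auto)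
  show "\<exists>q. qis n (Pcx i j l) E q" if "roof_iso n E (Xcx i j l)"
    using kproj_roof_iso[OF K roof_iso_sym[OF that] p] .
  show "roof_iso n E (Xcx i j l)" if "\<exists>q. qis n (Pcx i j l) E q"
    using that p unfolding roof_iso_def by blast
qed

lemma null_qis_iff:
  assumes P: "kproj n P" and t: "qis n Z Y t"
  shows "(\<forall>f. cmor n P Z f \<longrightarrow> chtpy n P Z f (cmap_zero P Z)) \<longleftrightarrow>
    (\<forall>f. cmor n P Y f \<longrightarrow> chtpy n P Y f (cmap_zero P Y))"
proof (intro iffI allI impI)
  note tm = qisD(1)[OF t]
  fix f assume L: "\<forall>f. cmor n P Z f \<longrightarrow> chtpy n P Z f (cmap_zero P Z)" and f: "cmor n P Y f"
  obtain g where g: "cmor n P Z g" "chtpy n P Y (cmap_comp t g) f" using kproj_lift[OF P t f] .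
  have "chtpy n P Y (cmap_comp t g) (cmap_zero P Y)"
    using chtpy_comp_left[OF _ tm] L g(1) comp_zero(1)[OF tm] by metis
  then show "chtpy n P Y f (cmap_zero P Y)" using chtpy_trans[OF chtpy_sym[OF g(2)]] by blast
next
  fix f assume R: "\<forall>f. cmor n P Y f \<longrightarrow> chtpy n P Y f (cmap_zero P Y)" and f: "cmor n P Z f"
  then show "chtpy n P Z f (cmap_zero P Z)" using kproj_null[OF P t f] cmor_comp[OF f qisD(1)[OF t]] by blast
qed

lemma null_roof_iso:
  assumes "kproj n P" "roof_iso n X Y"
  shows "(\<forall>f. cmor n P X f \<longrightarrow> chtpy n P X f (cmap_zero P X)) \<longleftrightarrow>
    (\<forall>f. cmor n P Y f \<longrightarrow> chtpy n P Y f (cmap_zero P Y))"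
  using assms null_qis_iff unfolding roof_iso_def by metis

text \<open>For odd \<open>s\<close> the complex \<open>shift s (Pcx i j l)\<close> differs from
  \<open>Pcx i j (l - s)\<close> by the sign of the differential. The detour over the stalk complex
  \<open>Xcx\<close>, on which shifts simply compose, takes care of this sign.\<close>

lemma qis_Pcx_shift:
  assumes ij: "i < j" "j \<le> n" and q: "qis n (Pcx i j l) (E :: 'k::field cpx) q"
  shows "\<exists>q. qis n (Pcx i j (l - s)) (shift s E) q"
proof -
  have "roof_iso n E (Xcx i j l)" using roof_iso_Xcx_iff[OF ij] q by blast
  then have "roof_iso n (shift s E) (shift s (Xcx i j l))" by (rule roof_iso_shift)
  then have "roof_iso n (shift s E) (Xcx i j (l - s))" by (simp add: shift_shift)
  then show ?thesis using roof_iso_Xcx_iff[OF ij] by blast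
qed

text \<open>\<open>hom_int (i, j) (a, b)\<close>: some \<open>Hom(\<Sigma>\<^sup>s X\<^sub>i\<^sub>,\<^sub>j, X\<^sub>a\<^sub>,\<^sub>b)\<close> is nonzero; the disjuncts are \<open>Hom\<close> and \<open>Ext\<^sup>1\<close>.\<close>

definition hom_int :: "nat \<times> nat \<Rightarrow> nat \<times> nat \<Rightarrow> bool" where
  "hom_int = (\<lambda>(i, j) (a, b). i \<le> a \<and> a < j \<and> j \<le> b \<or> a < i \<and> i \<le> b \<and> b < j)"

lemma D_hom_is_zero_Pcx_iff:
  assumes ij: "i < j" "j \<le> n" and ab: "a < b" "b \<le> n"
    and q: "qis n (Pcx i j l) F q" and q': "qis n (Pcx a b m) (E :: 'k::field cpx) q'"
  shows "D_hom_is_zero n F E \<longleftrightarrow>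
    (l = m \<longrightarrow> \<not> (i \<le> a \<and> a < j \<and> j \<le> b)) \<and> (l = m + 1 \<longrightarrow> \<not> (a < i \<and> i \<le> b \<and> b < j))"
proof -
  have K: "kproj n (Pcx i j l :: 'k cpx)" by (rule kproj_Pcx) (use ij in auto)
  have E: "is_cpx n E" using cmorD(2)[OF qisD(1)[OF q']] .
  interpret resolved n F E "Pcx i j l" q using K q E by unfold_locales
  have iso: "roof_iso n E (Xcx a b m)" using roof_iso_Xcx_iff[OF ab] q' by blast
  show ?thesis unfolding D_hom_is_zero_iff null_roof_iso[OF K iso] null_Pcx_Xcx_iff[OF ij ab] ..
qed

text \<open>As \<open>s\<close> varies, \<open>l - s\<close> takes all integer values:
  \<open>s = l - m\<close> tests \<open>Hom\<close>, and \<open>s = l - m - 1\<close> tests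
  \<open>Ext^1\<close>.\<close>

lemma all_D_hom_is_zero_iff:
  assumes ij: "i < j" "j \<le> n" and ab: "a < b" "b \<le> n"
    and q: "qis n (Pcx i j l) F q" and q': "qis n (Pcx a b m) (E :: 'k::field cpx) q'"
  shows "(\<forall>s. D_hom_is_zero n (shift s F) E) \<longleftrightarrow> \<not> hom_int (i, j) (a, b)"
proof -
  have "D_hom_is_zero n (shift s F) E \<longleftrightarrow>
    (l - s = m \<longrightarrow> \<not> (i \<le> a \<and> a < j \<and> j \<le> b)) \<and> (l - s = m + 1 \<longrightarrow> \<not> (a < i \<and> i \<le> b \<and> b < j))" for s
    using qis_Pcx_shift[OF ij q, of s] D_hom_is_zero_Pcx_iff[OF ij ab _ q'] by blast
  moreover have "(\<forall>s. P s) \<longleftrightarrow> (\<forall>t. P (l - t))" for P :: "int \<Rightarrow> bool"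
    by (metis diff_diff_eq2 add_diff_cancel_left')
  ultimately show ?thesis by (auto simp: hom_int_def)
      (metis diff_diff_eq2 add_diff_cancel_left')+
qed

lemma vec_smult_zero:
  "c \<cdot>\<^sub>v 0\<^sub>v d = (0\<^sub>v d :: 'k::field vec)" "v \<in> carrier_vec d \<Longrightarrow> 0 \<cdot>\<^sub>v v = (0\<^sub>v d :: 'k::field vec)"
  by (auto simp: vec_eq_iff)

text \<open>Take a resolution that is a sum of two-term complexes with first summand
  \<open>Pcx i j l\<close>. The projection to that summand and the identity are linearly dependent
  endomorphisms of \<open>E\<close>; a nonzero cohomology class in the remaining sum
  \<open>Q\<close> would make both coefficients vanish. So \<open>Q\<close> is acyclic and the first
  summand alone resolves \<open>E\<close>. The empty sum is excluded because the identity is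
  nonzero.\<close>

lemma exceptional_qis_Pcx:
  assumes E: "exceptional n (E :: 'k::field cpx)"
  obtains i j l q where "i < j" "j \<le> n" "qis n (Pcx i j l) E q"
proof -
  have Ec: "is_cpx n E" and iso: "D_hom_iso_field n E E" using E by (auto simp: exceptional_def)
  obtain R q where R: "proj_sum n R" and q: "qis n R E q" using resolve[OF Ec] by blast
  interpret resolved n E E R q using kproj_proj_sum[OF R] q Ec by unfold_locales
  from R show ?thesis
  proof cases
    case zero
    have "g = cmap_zero R E" if g: "cmor n R E g" for g
    proof (intro ext zero_col_eq)
      have "rdim (obj R m) a = 0" for m a
        by (auto simp: zero Pcx_def Pobj_def rdim_X rdim_zero_rep X_dim_def)
      then show "dim_col (g m a) = 0" "dim_col (cmap_zero R E m a) = 0" for m a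
        by (simp_all add: cmor_dims[OF g] cmap_zero_def)
      show "dim_row (g m a) = dim_row (cmap_zero R E m a)" for m a
        by (simp add: cmor_dims[OF g] cmap_zero_def)
    qed
    then have False using D_hom_iso_field_nontrivial[OF iso] chtpy_refl by blast
    then show ?thesis ..
  next
    case (add i j Q l)
    let ?C = "Pcx i j l :: 'k cpx"
    have C: "is_cpx n ?C" by (rule is_cpx_Pcx) (use add in auto)
    have Q: "is_cpx n Q" using kproj_cpx[OF kproj_proj_sum[OF add(4)]] .
    obtain ia ib pa pb where bi: "cpx_biprod n ?C Q R ia ib pa pb"
      using cpx_biprod_dsum[OF C Q] add(1) by blast
    then have ia: "cmor n ?C R ia" and ib: "cmor n Q R ib" and pa: "cmor n R ?C pa" and pb: "cmor n R Q pb"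
      by (auto simp: cpx_biprod_def)
    note B = vsub_coboundaries and bv = biprod_vec[OF bi]
    have acyclic: "cocycles Q m a \<subseteq> coboundaries Q m a" for m a
    proof (rule ccontr)
      assume "\<not> ?thesis"
      then obtain v where v: "v \<in> cocycles Q m a" "v \<notin> coboundaries Q m a" by blast
      \<comment> \<open>Seen as chain maps out of the resolution \<open>R\<close>, the projection to
        the first summand is \<open>q\<close> after \<open>ia\<close> after \<open>pa\<close>, and
        the identity of \<open>E\<close> is \<open>q\<close>.\<close>
      have fm: "cmor n R E (cmap_comp q (cmap_comp ia pa))" using cmor_comp[OF cmor_comp[OF pa ia] q_mor] .
      obtain x y where xy: "x \<noteq> 0 \<or> y \<noteq> 0" and
        h: "chtpy n R E (cmap_add (cmap_smult x (cmap_comp q (cmap_comp ia pa))) (cmap_smult y q)) (cmap_zero R E)"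
        using D_hom_iso_field_dependent[OF iso fm q_mor] by blast
      have comb: "x \<cdot>\<^sub>v (q m a *\<^sub>v (ia m a *\<^sub>v (pa m a *\<^sub>v w))) + y \<cdot>\<^sub>v (q m a *\<^sub>v w) \<in> coboundaries E m a"
        if w: "w \<in> cocycles R m a" for m a w
      proof -
        note wc = cocyclesD(1)[OF w]
        have sm: "cmap_smult c g m a *\<^sub>v w = c \<cdot>\<^sub>v (g m a *\<^sub>v w)" if "cmor n R E g" for c g
          using wc unfolding cmap_smult_def by (intro smult_mat_vec_dim) (simp add: cmor_dims[OF that])
        have "cmap_add (cmap_smult x (cmap_comp q (cmap_comp ia pa))) (cmap_smult y q) m a *\<^sub>v w =
          x \<cdot>\<^sub>v (q m a *\<^sub>v (ia m a *\<^sub>v (pa m a *\<^sub>v w))) + y \<cdot>\<^sub>v (q m a *\<^sub>v w)"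
          unfolding add_vec[OF cmor_lin(2)[OF fm fm] cmor_lin(2)[OF q_mor q_mor] wc] sm[OF fm] sm[OF q_mor]
            comp_vec[OF cmor_comp[OF pa ia] q_mor wc] comp_vec[OF pa ia wc] ..
        moreover have "cmap_zero R E m a *\<^sub>v w = 0\<^sub>v (rdim (obj E m) a)" using wc by (simp add: cmap_zero_def)
        ultimately show ?thesis using chtpy_coboundaries[OF h w] cmor_vec_carrier[OF q_mor] by simp
      qed
      have zero: "c = 0" if z: "z \<in> cocycles R m a" "z \<notin> coboundaries R m a"
        and cz: "c \<cdot>\<^sub>v (q m a *\<^sub>v z) \<in> coboundaries E m a" for c z m a
      proof (rule ccontr)
        assume c: "c \<noteq> 0"
        have "inverse c \<cdot>\<^sub>v (c \<cdot>\<^sub>v (q m a *\<^sub>v z)) \<in> coboundaries E m a" using vsubD(4)[OF B[OF Ec] cz] .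
        then have "q m a *\<^sub>v z \<in> coboundaries E m a" using c by (simp add: smult_smult_assoc)
        then show False using qisD(3)[OF q z(1)] z(2) by blast
      qed
      \<comment> \<open>The projection kills the class coming from \<open>Q\<close>, so the relation
        on it reads as a multiple by \<open>y\<close>. Once \<open>y = 0\<close>, the generator of
        the first summand, which the projection fixes, gives \<open>x = 0\<close>.\<close>
      have "y = 0"
      proof (rule zero)
        let ?w = "ib m a *\<^sub>v v"
        note vc = cocyclesD(1)[OF v(1)]
        show w: "?w \<in> cocycles R m a" using cmor_cocycles[OF ib v(1)] .
        show "?w \<notin> coboundaries R m a" using cmor_coboundaries[OF pb, of ?w m a] bv(2)[OF vc] v(2) by auto
        have "q m a *\<^sub>v (ia m a *\<^sub>v (pa m a *\<^sub>v ?w)) = 0\<^sub>v (rdim (obj E m) a)"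
          unfolding bv(4)[OF vc] by (simp add: cmor_dims[OF ia] cmor_dims[OF q_mor])
        then show "y \<cdot>\<^sub>v (q m a *\<^sub>v ?w) \<in> coboundaries E m a"
          using comb[OF w] cmor_vec_carrier[OF q_mor, of m a ?w] by (simp add: vec_smult_zero)
      qed
      moreover have "x = 0"
      proof (rule zero)
        let ?c = "1 \<cdot>\<^sub>v gen j j :: 'k vec"
        let ?w = "ia l j *\<^sub>v ?c"
        have c: "?c \<in> cocycles ?C l j" using Pcx_cocycle_gen[of i j n j "1 :: 'k" l] add by simp
        note cc = cocyclesD(1)[OF c]
        have cB: "?c \<notin> coboundaries ?C l j" using Pcx_gen_coboundary[OF add(2,3,2) order_refl, of "1 :: 'k" l] by auto
        show w: "?w \<in> cocycles R l j" using cmor_cocycles[OF ia c] .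
        show "?w \<notin> coboundaries R l j" using cmor_coboundaries[OF pa, of ?w l j] bv(1)[OF cc] cB by auto
        show "x \<cdot>\<^sub>v (q l j *\<^sub>v ?w) \<in> coboundaries E l j"
          using comb[OF w] cmor_vec_carrier[OF q_mor, of l j ?w] \<open>y = 0\<close> unfolding bv(1)[OF cc] by (simp add: vec_smult_zero)
      qed
      ultimately show False using xy by blast
    qed
    have "qis n ?C R ia"
      unfolding qis_def
    proof (intro conjI allI ballI impI ia)
      fix m a z assume z: "z \<in> cocycles R m a"
      have pz: "pa m a *\<^sub>v z \<in> cocycles ?C m a" using cmor_cocycles[OF pa z] .
      have "ib m a *\<^sub>v (pb m a *\<^sub>v z) \<in> coboundaries R m a"
        using acyclic cmor_cocycles[OF pb z] cmor_coboundaries[OF ib] by blast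
      moreover have "ib m a *\<^sub>v (pb m a *\<^sub>v z) = z - ia m a *\<^sub>v (pa m a *\<^sub>v z)"
        using bv(5)[OF cocyclesD(1)[OF z]]
          vec_arith(5)[OF cmor_vec_carrier[OF ia] cmor_vec_carrier[OF ib] cmor_vec_carrier[OF ia]]
        by metis
      ultimately have "ia m a *\<^sub>v (pa m a *\<^sub>v z) - z \<in> coboundaries R m a"
        using vsub_diff_swap[OF B[OF P]] cocyclesD(1)[OF z] cmor_vec_carrier[OF ia] by metis
      then show "\<exists>w\<in>cocycles ?C m a. ia m a *\<^sub>v w - z \<in> coboundaries R m a" using pz by blast
    next
      fix m a w assume "w \<in> cocycles ?C m a" "ia m a *\<^sub>v w \<in> coboundaries R m a"
      then show "w \<in> coboundaries ?C m a"
        using cmor_coboundaries[OF pa, of "ia m a *\<^sub>v w" m a] bv(1) cocyclesD(1) by metis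
    qed
    then have "qis n ?C E (cmap_comp q ia)" using qis_comp q by blast
    then show ?thesis using that add by blast
  qed
qed

text \<open>Up to homotopy a chain map from \<open>Pcx i j l\<close> to the stalk complex is
  determined by the scalar to which it sends the generator. The resolution \<open>q\<close> has a
  nonzero scalar, so it spans the endomorphisms.\<close>

lemma exceptional_Xcx:
  assumes ij: "i < j" "j \<le> n"
  shows "exceptional n (Xcx i j l :: 'k::field cpx)"
proof -
  let ?P = "Pcx i j l :: 'k cpx" and ?S = "Xcx i j l :: 'k cpx"
  have ij': "i \<le> j" using ij by simp
  have S: "is_cpx n ?S" using is_cpx_Xcx ij by blast
  have K: "kproj n ?P" by (rule kproj_Pcx) (use ij in auto)
  obtain q where q: "qis n ?P ?S q" using qis_Pcx_Xcx[OF ij] by blast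
  note null = D_hom_is_zero_Pcx_iff[OF ij ij _ q]
  \<comment> \<open>For equal intervals the alternative for \<open>Ext^1\<close> would require
    \<open>i < i\<close>, and the one for \<open>Hom\<close> concerns only
    \<open>s = 0\<close>.\<close>
  have 1: "D_hom_is_zero n (shift s ?S) ?S" if "s \<noteq> 0" for s
    using qis_Pcx_shift[OF ij q, of s] null that by fastforce
  interpret resolved n ?S ?S ?P q using K q S by unfold_locales
  have oS: "obj ?S d = (if d = l then X_rep i j else zero_rep)" for d by (rule obj_Xcx)
  have dj: "rdim (obj ?S l) j = 1" using ij by (simp add: oS rdim_X X_dim_def del: shift_simps)
  have dl1: "rdim (obj ?S (l - 1)) a = 0" for a by (simp add: oS rdim_zero_rep del: shift_simps)
  have null_if: "chtpy n ?P ?S f (cmap_zero ?P ?S)" if f: "cmor n ?P ?S f"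
    and f0: "f l j *\<^sub>v gen j j = 0\<^sub>v (rdim (obj ?S l) j)" for f
    unfolding Pcx_null_iff[OF f ij' ij(2)]
  proof (intro exI conjI)
    let ?u = "0\<^sub>v (rdim (obj ?S (l - 1)) j) :: 'k vec" and ?w = "0\<^sub>v (rdim (obj ?S (l - 1 - 1)) i) :: 'k vec"
    show u: "?u \<in> carrier_vec (rdim (obj ?S (l - 1)) j)" and w: "?w \<in> carrier_vec (rdim (obj ?S (l - 1 - 1)) i)"
      by simp_all
    show "f l j *\<^sub>v gen j j = diff ?S (l - 1) j *\<^sub>v ?u" unfolding f0 diff_Xcx'[OF u] ..
    have "diff ?S (l - 1 - 1) i *\<^sub>v ?w + transport (obj ?S (l - 1)) j i ?u \<in> carrier_vec (rdim (obj ?S (l - 1)) i)"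
      unfolding diff_Xcx'[OF w] using cpx_transport(1)[OF S ij' u] by (simp del: shift_simps)
    from vec_dim0[OF this dl1] vec_dim0[OF cmor_vec_carrier[OF f] dl1]
    show "f (l - 1) i *\<^sub>v gen i i = diff ?S (l - 1 - 1) i *\<^sub>v ?w + transport (obj ?S (l - 1)) j i ?u" by metis
  qed
  have nullD: "f l j *\<^sub>v gen j j = 0\<^sub>v (rdim (obj ?S l) j)" if f: "cmor n ?P ?S f"
    and n: "chtpy n ?P ?S f (cmap_zero ?P ?S)" for f
    using n diff_Xcx' unfolding Pcx_null_iff[OF f ij' ij(2)] by metis
  define x where "x = q l j *\<^sub>v gen j j"
  have xc: "x \<in> carrier_vec 1" using cmor_vec_carrier[OF q_mor, of l j "gen j j"] unfolding dj x_def .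
  \<comment> \<open>A quasi-isomorphism cannot kill the generator at \<open>j\<close>, whose class
    is nonzero in cohomology.\<close>
  have x0: "x $ 0 \<noteq> 0"
  proof
    assume "x $ 0 = 0"
    then have "x = 0\<^sub>v (rdim (obj ?S l) j)" using xc dj by (auto simp: vec_eq_iff)
    then have qx: "q l j *\<^sub>v (1 \<cdot>\<^sub>v gen j j) \<in> coboundaries ?S l j" unfolding coboundaries_Xcx x_def by simp
    have "1 \<cdot>\<^sub>v gen j j \<in> cocycles ?P l j" using Pcx_cocycle_gen[of i j n j "1 :: 'k" l] ij by simp
    then have "1 \<cdot>\<^sub>v gen j j \<in> coboundaries ?P l j" using qisD(3)[OF q _ qx] by blast
    then show False using Pcx_gen_coboundary[OF ij ij(1) order_refl] by fastforce
  qed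
  have cq: "cmor n ?P ?S (cmap_smult c q)" for c using cmor_lin(2)[OF q_mor q_mor] .
  have sm: "cmap_smult c q l j *\<^sub>v gen j j = c \<cdot>\<^sub>v x" for c
    unfolding cmap_smult_def x_def using Pcx_gens(1)[of j i l] cmor_dims(2)[OF q_mor]
    by (intro smult_mat_vec_dim) simp
  have "D_hom_iso_field n ?S ?S"
  proof (rule D_hom_iso_fieldI[OF q_mor])
    fix f assume f: "cmor n ?P ?S f"
    define z where "z = f l j *\<^sub>v gen j j"
    have zc: "z \<in> carrier_vec 1" using cmor_vec_carrier[OF f, of l j "gen j j"] unfolding dj z_def .
    let ?c = "z $ 0 / x $ 0"
    have "z - ?c \<cdot>\<^sub>v x = 0\<^sub>v (rdim (obj ?S l) j)" using zc xc x0 dj by (auto simp: vec_eq_iff)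
    then have "cmap_add f (cmap_smult (- 1) (cmap_smult ?c q)) l j *\<^sub>v gen j j = 0\<^sub>v (rdim (obj ?S l) j)"
      unfolding sub_vec[OF f cq Pcx_gens(1)] sm z_def .
    then have "chtpy n ?P ?S f (cmap_smult ?c q)"
      unfolding chtpy_iff_diff[OF f cq] using null_if cmor_lin(1)[OF f cmor_lin(2)[OF cq cq]] by blast
    then show "\<exists>c. chtpy n ?P ?S f (cmap_smult c q)" by blast
  next
    fix c assume "chtpy n ?P ?S (cmap_smult c q) (cmap_zero ?P ?S)"
    then have "c \<cdot>\<^sub>v x = 0\<^sub>v 1" using nullD[OF cq] unfolding sm dj by blast
    then have "(c \<cdot>\<^sub>v x) $ 0 = (0\<^sub>v 1 :: 'k vec) $ 0" by simp
    then show "c = 0" using xc x0 by simp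
  qed
  then show ?thesis using S 1 by (simp add: exceptional_def del: shift_simps)
qed

section \<open>Non-crossing trees and orderings\<close>

definition intervals :: "nat \<Rightarrow> (nat \<times> nat) set" where
  "intervals n = {(i, j). i < j \<and> j \<le> n}"

definition adj :: "(nat \<times> nat) set \<Rightarrow> nat rel" where
  "adj A = A \<union> A\<inverse>"

definition crossing :: "nat \<times> nat \<Rightarrow> nat \<times> nat \<Rightarrow> bool" where
  "crossing = (\<lambda>(i, j) (k, l). i < k \<and> k < j \<and> j < l \<or> k < i \<and> i < l \<and> l < j)"

text \<open>The combinatorial form of \<open>noncrossing_spanning_trees\<close>, with a chord
  encoded by its end points in increasing order.\<close>

definition nc_tree :: "nat \<Rightarrow> (nat \<times> nat) set \<Rightarrow> bool" where
  "nc_tree n A \<longleftrightarrow> A \<subseteq> intervals n \<and> card A = n \<and> (\<forall>e\<in>A. \<forall>f\<in>A. \<not> crossing e f) \<and>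
     graph_is_tree {0..n} (adj A)"

text \<open>In \<open>sorted_wrt\<close> the entry \<open>e\<close> precedes \<open>f\<close>. As in
  \<open>exceptional_pair\<close>, morphisms from the later object to the earlier one have to
  vanish, hence the exchanged arguments.\<close>

definition hom_ordered :: "(nat \<times> nat) list \<Rightarrow> bool" where
  "hom_ordered es \<longleftrightarrow> sorted_wrt (\<lambda>e f. \<not> hom_int f e) es"

lemma finite_intervals: "finite (intervals n)"
  by (rule finite_subset[of _ "{0..n} \<times> {0..n}"]) (auto simp: intervals_def)

lemma hom_int_refl: "e \<in> intervals n \<Longrightarrow> hom_int e e"
  by (auto simp: hom_int_def intervals_def)

lemma hom_int_iff:
  assumes "i < j"
  shows "hom_int (i, j) (a, b) \<longleftrightarrow> (a < i \<and> i \<le> b) \<noteq> (a < j \<and> j \<le> b)"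
  using assms by (auto simp: hom_int_def)

lemma crossing_hom_int: "crossing e f \<Longrightarrow> hom_int e f"
  by (auto simp: crossing_def hom_int_def)

lemma crossing_sym: "crossing e f \<Longrightarrow> crossing f e"
  by (auto simp: crossing_def)

lemma adj_iff: "(u, v) \<in> adj A \<longleftrightarrow> (u, v) \<in> A \<or> (v, u) \<in> A"
  by (auto simp: adj_def)

lemma adj_sym: "(u, v) \<in> adj A \<Longrightarrow> (v, u) \<in> adj A"
  by (auto simp: adj_def)

lemma adj_edge:
  assumes "A \<subseteq> intervals n" "(u, v) \<in> adj A"
  shows "(min u v, max u v) \<in> A" "u \<noteq> v" "u \<le> n" "v \<le> n"
  using assms by (auto simp: adj_def intervals_def min_def max_def)

text \<open>A repeated interval would violate the order because of \<open>hom_int e e\<close>, the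
  identity morphism.\<close>

lemma hom_ordered_distinct:
  assumes "hom_ordered es" "set es \<subseteq> intervals n"
  shows "distinct es"
  using assms(1)[unfolded hom_ordered_def] assms(2)
proof (induction es)
  case (Cons e es)
  then show ?case using hom_int_refl[of e n] by auto
qed simp

text \<open>
  For the first edge \<open>f = (a, b)\<close> of a cycle with respect to the order, whether a vertex lies in
  \<open>{a<..b}\<close> does not change along the other edges of the cycle, but it does change along \<open>f\<close>.
\<close>

lemma hom_ordered_acyclic:
  assumes es: "hom_ordered es" "set es \<subseteq> intervals n"
  shows "\<not> has_cycle (adj (set es))"
proof
  assume "has_cycle (adj (set es))"
  then obtain vs where len: "length vs \<ge> 3" and dist: "distinct vs"
    and succ: "successively (\<lambda>u v. (u, v) \<in> adj (set es)) vs" and closing: "(last vs, hd vs) \<in> adj (set es)"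
    unfolding has_cycle_def by blast
  define m where "m = length vs"
  have m: "m \<ge> 3" using len m_def by simp
  \<comment> \<open>Vertices are indexed periodically, so that the closing edge has the form
    \<open>v t\<close>, \<open>v (Suc t)\<close> like all others.\<close>
  define v where "v t = vs ! (t mod m)" for t
  have v_eq: "v s = v t \<longleftrightarrow> s mod m = t mod m" for s t
    unfolding v_def by (rule nth_eq_iff_index_eq[OF dist]) (use m in \<open>simp_all add: m_def[symmetric]\<close>)
  have step: "(v t, v (Suc t)) \<in> adj (set es)" for t
  proof (cases "Suc (t mod m) < m")
    case True
    then have "(vs ! (t mod m), vs ! Suc (t mod m)) \<in> adj (set es)"
      using succ by (simp add: successively_conv_nth m_def)
    moreover have "Suc t mod m = Suc (t mod m)" using True by (simp add: mod_Suc)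
    ultimately show ?thesis by (simp add: v_def)
  next
    case False
    then have "t mod m = m - 1" using m mod_less_divisor[of m t] by linarith
    moreover from this have "Suc t mod m = 0" using m by (simp add: mod_Suc)
    moreover have "vs \<noteq> []" using len by auto
    ultimately show ?thesis using closing by (simp add: v_def last_conv_nth hd_conv_nth m_def)
  qed
  define e where "e t = (min (v t) (v (Suc t)), max (v t) (v (Suc t)))" for t
  have eE: "e t \<in> set es" and vne: "v t \<noteq> v (Suc t)" for t
    using adj_edge[OF es(2) step] by (auto simp: e_def)
  \<comment> \<open>The position of an edge of the cycle in the list. The edge at \<open>t0\<close>
    comes first among them, so no other edge of the cycle is related to it by
    \<open>hom_int\<close>.\<close>
  define ix where "ix t = (LEAST k. k < length es \<and> es ! k = e t)" for t
  have ix: "ix t < length es" "es ! ix t = e t" for t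
  proof -
    have "\<exists>k. k < length es \<and> es ! k = e t" using eE[of t] by (simp add: in_set_conv_nth)
    then have "ix t < length es \<and> es ! ix t = e t" unfolding ix_def by (rule LeastI_ex)
    then show "ix t < length es" "es ! ix t = e t" by auto
  qed
  obtain t0 where t0: "\<And>t. ix t0 \<le> ix t"
    using ex_has_least_nat[of "\<lambda>_. True" 0 ix] by blast
  \<comment> \<open>This needs \<open>m \<ge> 3\<close>: an edge met at two positions would be
    traversed in opposite directions, which makes \<open>m\<close> a divisor of
    \<open>2\<close>.\<close>
  have e_ne: "e t \<noteq> e t0" if "t mod m \<noteq> t0 mod m" for t
  proof
    assume "e t = e t0"
    then have "v t = v (Suc t0) \<and> v (Suc t) = v t0"
      using that v_eq[of t t0] by (auto simp: e_def min_def max_def split: if_splits)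
    then have "t mod m = Suc t0 mod m" "Suc t mod m = t0 mod m" by (auto simp: v_eq)
    then have "Suc (Suc t0) mod m = t0 mod m" by (metis mod_Suc_eq)
    then have "[t0 + 2 = t0 + 0] (mod m)" by (simp add: cong_def)
    then have "[2 = 0] (mod m)" by (simp only: cong_add_lcancel_nat)
    then have "m dvd 2" by (simp add: cong_0_iff)
    then show False using m by (auto dest: dvd_imp_le)
  qed
  obtain a b where ab: "e t0 = (a, b)" by (cases "e t0")
  define inside where "inside w \<longleftrightarrow> a < w \<and> w \<le> b" for w
  have mm: "inside (fst (e t)) \<noteq> inside (snd (e t)) \<longleftrightarrow> inside (v t) \<noteq> inside (v (Suc t))" for t
    by (auto simp: e_def min_def max_def)
  have lt: "fst (e t) < snd (e t)" for t using vne[of t] by (auto simp: e_def min_def max_def)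
  have const: "inside (v t) = inside (v (Suc t))" if "t mod m \<noteq> t0 mod m" for t
  proof -
    have "ix t0 < ix t" using t0[of t] e_ne[OF that] ix by (metis le_neq_implies_less)
    then have "\<not> hom_int (e t) (e t0)"
      using es(1) ix[of t] ix[of t0] unfolding hom_ordered_def sorted_wrt_iff_nth_less by metis
    then show ?thesis using hom_int_iff[OF lt[of t], of a b] mm[of t] by (simp add: ab inside_def)
  qed
  have "hom_int (e t0) (e t0)" using hom_int_refl eE es(2) by blast
  then have change: "inside (v t0) \<noteq> inside (v (Suc t0))"
    using hom_int_iff[OF lt[of t0], of a b] mm[of t0] by (simp add: ab inside_def)
  \<comment> \<open>Starting at \<open>Suc t0\<close>, the walk returns to \<open>v t0\<close> after
    \<open>m - 1\<close> steps without using the edge at \<open>t0\<close>.\<close>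
  have "inside (v (Suc t0 + s)) = inside (v (Suc t0))" if "s < m" for s
    using that
  proof (induction s)
    case (Suc s)
    have "(Suc t0 + s) mod m \<noteq> t0 mod m"
    proof
      assume "(Suc t0 + s) mod m = t0 mod m"
      then have "[t0 + Suc s = t0 + 0] (mod m)" by (simp add: cong_def)
      then have "[Suc s = 0] (mod m)" by (simp only: cong_add_lcancel_nat)
      then have "m dvd Suc s" by (simp add: cong_0_iff)
      then show False using Suc.prems by (auto dest: dvd_imp_le)
    qed
    then show ?case using const[of "Suc t0 + s"] Suc by simp
  qed simp
  from this[of "m - 1"] have "inside (v (t0 + m)) = inside (v (Suc t0))" using m by simp
  moreover have "v (t0 + m) = v t0" by (simp add: v_eq)
  ultimately show False using change by simp
qed

section \<open>Leaves, edge counts and connectedness of forests\<close>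

lemma has_cycle_mono: "has_cycle A \<Longrightarrow> A \<subseteq> B \<Longrightarrow> has_cycle B"
  unfolding has_cycle_def by (meson subsetD successively_mono)

lemma adj_mono: "A \<subseteq> B \<Longrightarrow> adj A \<subseteq> adj B"
  by (auto simp: adj_def)

text \<open>The first vertex \<open>v\<close> of a longest path is a leaf: another neighbour of
  \<open>v\<close> would either prolong the path or, if it lies on the path, close a cycle.\<close>

lemma leaf_exists:
  assumes A: "A \<subseteq> intervals n" "A \<noteq> {}" and ac: "\<not> has_cycle (adj A)"
  obtains u v where "(u, v) \<in> adj A" "\<And>w. (w, v) \<in> adj A \<Longrightarrow> w = u"
proof -
  define good where "good vs \<longleftrightarrow> length vs \<ge> 2 \<and> distinct vs \<and> set vs \<subseteq> {0..n} \<and>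
    successively (\<lambda>u v. (u, v) \<in> adj A) vs" for vs
  obtain i j where ij: "(i, j) \<in> A" using A(2) by auto
  then have "i < j" "j \<le> n" using A(1) by (auto simp: intervals_def)
  then have g0: "good [i, j]" using ij by (auto simp: good_def adj_iff)
  have "length vs < Suc (Suc n)" if "good vs" for vs
  proof -
    have "length vs = card (set vs)" using that by (simp add: good_def distinct_card)
    also have "\<dots> \<le> card {0..n}" using that by (intro card_mono) (auto simp: good_def)
    finally show ?thesis by simp
  qed
  then obtain vs where vs: "good vs" and mx: "\<And>ws. good ws \<Longrightarrow> length ws \<le> length vs"
    using ex_has_greatest_nat[of good "[i, j]" length "Suc (Suc n)"] g0 by blast
  obtain v u rest where vs_eq: "vs = v # u # rest"
    using vs by (cases vs; cases "tl vs") (auto simp: good_def)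
  have uv: "(v, u) \<in> adj A" using vs by (simp add: good_def vs_eq)
  show ?thesis
  proof (rule that[of u v])
    show "(u, v) \<in> adj A" using adj_sym[OF uv] .
    fix w assume w: "(w, v) \<in> adj A"
    show "w = u"
    proof (rule ccontr)
      assume wu: "w \<noteq> u"
      have wv: "w \<noteq> v" and wn: "w \<le> n" using adj_edge[OF A(1) w] by auto
      show False
      proof (cases "w \<in> set vs")
        case False
        then have "good (w # vs)" using vs w wn by (simp add: good_def vs_eq)
        then show False using mx by fastforce
      next
        case True
        then have "w \<in> set rest" using wu wv vs_eq by simp
        then obtain xs ys where r: "rest = xs @ w # ys" by (meson split_list)
        let ?c = "v # u # xs @ [w]"
        have split: "vs = ?c @ ys" using r vs_eq by simp
        have "distinct ?c" using vs unfolding good_def split by simp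
        moreover have "successively (\<lambda>u v. (u, v) \<in> adj A) ?c"
          using vs unfolding good_def split successively_append_iff by blast
        moreover have "(last ?c, hd ?c) \<in> adj A" using w by simp
        moreover have "length ?c \<ge> 3" by simp
        ultimately show False using ac unfolding has_cycle_def by blast
      qed
    qed
  qed
qed

lemma leaf_edge:
  assumes A: "A \<subseteq> intervals n" and uv: "(u, v) \<in> adj A" and leaf: "\<And>w. (w, v) \<in> adj A \<Longrightarrow> w = u"
    and f: "(i, j) \<in> A" "i = v \<or> j = v"
  shows "(i, j) = (min u v, max u v)"
proof -
  have "i < j" using f A by (auto simp: intervals_def)
  then show ?thesis using f leaf[of j] leaf[of i] by (auto simp: adj_iff)
qed

text \<open>Removing a leaf takes away one edge and one vertex. The vertex set \<open>V\<close> is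
  arbitrary so that the bound applies to each of the two parts in
  \<open>forest_connected\<close>.\<close>

lemma forest_card:
  assumes "A \<subseteq> intervals n" "\<not> has_cycle (adj A)" "finite V" "V \<noteq> {}" "A \<subseteq> V \<times> V"
  shows "card A < card V"
  using assms
proof (induction "card A" arbitrary: A V)
  case 0
  then have "A = {}" using finite_subset[OF _ finite_intervals] by auto
  then show ?case using 0 by (simp add: card_gt_0_iff)
next
  case (Suc k)
  have fin: "finite A" using finite_subset[OF Suc.prems(1) finite_intervals] .
  have "A \<noteq> {}" using Suc.hyps(2) by auto
  then obtain u v where uv: "(u, v) \<in> adj A" and leaf: "\<And>w. (w, v) \<in> adj A \<Longrightarrow> w = u"
    using leaf_exists[OF Suc.prems(1) _ Suc.prems(2)] by blast
  let ?e = "(min u v, max u v)"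
  have e: "?e \<in> A" "u \<noteq> v" using adj_edge[OF Suc.prems(1) uv] by auto
  have uvV: "u \<in> V" "v \<in> V" using uv Suc.prems(5) by (auto simp: adj_iff)
  let ?A = "A - {?e}"
  have cA: "card ?A = k" using Suc.hyps(2) e(1) fin by simp
  have "\<not> has_cycle (adj ?A)" using has_cycle_mono adj_mono[of ?A A] Suc.prems(2) by blast
  moreover have "?A \<subseteq> (V - {v}) \<times> (V - {v})"
  proof
    fix f assume f: "f \<in> ?A"
    obtain i j where ij: "f = (i, j)" by (cases f)
    have "i \<noteq> v \<and> j \<noteq> v" using leaf_edge[OF Suc.prems(1) uv leaf, of i j] f ij by auto
    then show "f \<in> (V - {v}) \<times> (V - {v})" using f ij Suc.prems(5) by auto
  qed
  moreover have "V - {v} \<noteq> {}" using uvV e(2) by auto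
  ultimately have "card ?A < card (V - {v})"
    using Suc.hyps(1)[of ?A "V - {v}"] cA Suc.prems(1,3) by blast
  then show ?case using cA Suc.hyps(2) uvV Suc.prems(3) by simp
qed

text \<open>Otherwise the component \<open>V0\<close> of \<open>u\<close> and its complement
  \<open>V1\<close> are both nonempty, and the forests on them have together at most
  \<open>(n + 1) - 2\<close> edges.\<close>

lemma forest_connected:
  assumes A: "A \<subseteq> intervals n" "card A = n" and ac: "\<not> has_cycle (adj A)" and uv: "u \<le> n" "v \<le> n"
  shows "(u, v) \<in> (adj A)\<^sup>*"
proof (rule ccontr)
  assume not: "(u, v) \<notin> (adj A)\<^sup>*"
  define V0 where "V0 = {w \<in> {0..n}. (u, w) \<in> (adj A)\<^sup>*}"
  define V1 where "V1 = {0..n} - V0"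
  have closed: "x \<in> V0 \<longleftrightarrow> y \<in> V0" if "(x, y) \<in> A" for x y
  proof -
    have "(x, y) \<in> adj A" "(y, x) \<in> adj A" "x \<le> n" "y \<le> n"
      using that A(1) by (auto simp: adj_iff intervals_def)
    then show ?thesis by (auto simp: V0_def intro: rtrancl_into_rtrancl)
  qed
  have split: "A = (A \<inter> V0 \<times> V0) \<union> (A \<inter> V1 \<times> V1)"
    using A(1) closed by (force simp: V1_def intervals_def)
  have fin: "finite A" using finite_subset[OF A(1) finite_intervals] .
  have ne: "u \<in> V0" "v \<in> V1" using uv not by (auto simp: V0_def V1_def)
  have fV: "finite V0" "finite V1" by (auto simp: V0_def V1_def)
  have "card (A \<inter> V0 \<times> V0) < card V0"
    by (rule forest_card[OF _ _ fV(1)]) (use A(1) ne has_cycle_mono[OF _ adj_mono] ac in blast)+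
  moreover have "card (A \<inter> V1 \<times> V1) < card V1"
    by (rule forest_card[OF _ _ fV(2)]) (use A(1) ne has_cycle_mono[OF _ adj_mono] ac in blast)+
  moreover have "card A \<le> card (A \<inter> V0 \<times> V0) + card (A \<inter> V1 \<times> V1)"
    using split card_Un_le by metis
  moreover have "card V0 + card V1 = Suc n"
  proof -
    have "card (V0 \<union> V1) = card V0 + card V1" using fV by (intro card_Un_disjoint) (auto simp: V1_def)
    moreover have "V0 \<union> V1 = {0..n}" by (auto simp: V0_def V1_def)
    ultimately show ?thesis by simp
  qed
  ultimately show False using A(2) by linarith
qed

lemma hom_ordered_nc_tree:
  assumes es: "hom_ordered es" "set es \<subseteq> intervals n" "length es = n"
  shows "nc_tree n (set es)"
proof -
  have card: "card (set es) = n" using distinct_card[OF hom_ordered_distinct[OF es(1,2)]] es(3) by simp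
  have ac: "\<not> has_cycle (adj (set es))" using hom_ordered_acyclic[OF es(1,2)] .
  have "\<not> crossing e f" if "e \<in> set es" "f \<in> set es" for e f
  proof
    assume c: "crossing e f"
    obtain s t where st: "s < length es" "t < length es" "e = es ! s" "f = es ! t"
      using \<open>e \<in> set es\<close> \<open>f \<in> set es\<close> by (auto simp: in_set_conv_nth)
    have "e \<noteq> f" using c by (auto simp: crossing_def)
    then have "s < t \<or> t < s" using st by (metis linorder_neqE_nat)
    then have "\<not> hom_int f e \<or> \<not> hom_int e f"
      using es(1) st unfolding hom_ordered_def sorted_wrt_iff_nth_less by blast
    then show False using crossing_hom_int c crossing_sym by blast
  qed
  then show ?thesis using es(2) card ac forest_connected[OF es(2) card ac]
    by (auto simp: nc_tree_def graph_is_tree_def)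
qed

section \<open>Ordering the edges of a non-crossing forest\<close>

lemma hom_int_disjoint:
  assumes "i < j" "k < l" "\<not> crossing (i, j) (k, l)" "hom_int (i, j) (k, l)"
  shows "{i, j} \<inter> {k, l} \<noteq> {}"
  using assms by (auto simp: crossing_def hom_int_def)

text \<open>Antisymmetry and transitivity of \<open>hom_int\<close> on the edges at the vertex
  \<open>u\<close>; \<open>min\<close> and \<open>max\<close> bring the end points into increasing
  order.\<close>

lemma hom_int_star:
  assumes "w \<noteq> u" "v \<noteq> u" "x \<noteq> (u::nat)"
  shows "hom_int (min u v, max u v) (min u x, max u x) \<Longrightarrow> hom_int (min u x, max u x) (min u v, max u v) \<Longrightarrow> v = x"
    and "hom_int (min u w, max u w) (min u v, max u v) \<Longrightarrow> hom_int (min u v, max u v) (min u x, max u x) \<Longrightarrow>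
      hom_int (min u w, max u w) (min u x, max u x)"
  using assms by (auto simp: hom_int_def min_def max_def split: if_splits)

text \<open>
  The edges at a vertex are linearly ordered by \<open>hom_int\<close>, as they turn around the vertex. So the
  edge at a leaf can be inserted into an ordering of the other edges.
\<close>

lemma nc_forest_ordered:
  assumes "A \<subseteq> intervals n" "\<not> has_cycle (adj A)" "\<forall>e\<in>A. \<forall>f\<in>A. \<not> crossing e f"
  shows "\<exists>es. set es = A \<and> hom_ordered es"
  using assms
proof (induction "card A" arbitrary: A)
  case 0
  then have "A = {}" using finite_subset[OF _ finite_intervals] by auto
  then show ?case by (intro exI[of _ "[]"]) (simp add: hom_ordered_def)
next
  case (Suc k)
  have fin: "finite A" using finite_subset[OF Suc.prems(1) finite_intervals] .
  have "A \<noteq> {}" using Suc.hyps(2) by auto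
  then obtain u v where uv: "(u, v) \<in> adj A" and leaf: "\<And>w. (w, v) \<in> adj A \<Longrightarrow> w = u"
    using leaf_exists[OF Suc.prems(1) _ Suc.prems(2)] by blast
  define e where "e = (min u v, max u v)"
  have e: "e \<in> A" "u \<noteq> v" using adj_edge[OF Suc.prems(1) uv] by (auto simp: e_def)
  let ?A = "A - {e}"
  have cA: "k = card ?A" using Suc.hyps(2) e(1) fin by simp
  have "\<not> has_cycle (adj ?A)" using has_cycle_mono adj_mono[of ?A A] Suc.prems(2) by blast
  then obtain es where es: "set es = ?A" "hom_ordered es"
    using Suc.hyps(1)[OF cA] Suc.prems(1,3) by blast
  \<comment> \<open>Non-crossing edges related by \<open>hom_int\<close> share an end point, and the
    leaf \<open>v\<close> lies on no other edge than \<open>e\<close>.\<close>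
  have at_u: "\<exists>w. w \<noteq> u \<and> f = (min u w, max u w)" if f: "f \<in> ?A" "hom_int f e \<or> hom_int e f" for f
  proof -
    obtain i j where ij: "f = (i, j)" by (cases f)
    have lt: "i < j" "min u v < max u v" using f ij Suc.prems(1) e(2) by (auto simp: intervals_def)
    have "\<not> crossing f e" "\<not> crossing e f" using f e(1) Suc.prems(3) by auto
    then have "{i, j} \<inter> {min u v, max u v} \<noteq> {}"
      using f(2) hom_int_disjoint[OF lt] hom_int_disjoint[OF lt(2,1)] unfolding ij e_def by blast
    then have "i = u \<or> j = u \<or> i = v \<or> j = v" by (auto simp: min_def max_def split: if_splits)
    moreover have "i \<noteq> v \<and> j \<noteq> v" using leaf_edge[OF Suc.prems(1) uv leaf, of i j] f ij e_def by auto
    ultimately show ?thesis using lt(1) ij by (auto simp: min_def max_def)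
  qed
  \<comment> \<open>The edge \<open>e\<close> is inserted in front of the first edge
    \<open>g\<close> with \<open>hom_int e g\<close>. For an edge \<open>f\<close> behind it,
    \<open>hom_int f e\<close> would imply \<open>hom_int f g\<close> by transitivity, against the
    order of \<open>es\<close>; for \<open>f = g\<close> antisymmetry excludes it.\<close>
  define Q where "Q f \<longleftrightarrow> \<not> hom_int e f" for f
  define xs ys where "xs = takeWhile Q es" and "ys = dropWhile Q es"
  have es_eq: "es = xs @ ys" by (simp add: xs_def ys_def)
  have xs: "\<not> hom_int e f" if "f \<in> set xs" for f
    using that set_takeWhileD unfolding xs_def Q_def by fastforce
  have ys: "\<not> hom_int f e" if f: "f \<in> set ys" for f
  proof
    assume fe: "hom_int f e"
    have "ys \<noteq> []" using f by auto
    then obtain g ys' where ys_eq: "ys = g # ys'" by (cases ys) auto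
    then have eg: "hom_int e g" using hd_dropWhile[of Q es] unfolding ys_def[symmetric] Q_def by simp
    have fg: "f \<in> ?A" "g \<in> ?A" using f es(1) es_eq ys_eq by auto
    obtain w where w: "w \<noteq> u" "f = (min u w, max u w)" using at_u[OF fg(1)] fe by blast
    obtain x where x: "x \<noteq> u" "g = (min u x, max u x)" using at_u[OF fg(2)] eg by blast
    have vu: "v \<noteq> u" using e(2) by simp
    show False
    proof (cases "f = g")
      case True
      then have "v = x" using hom_int_star(1)[OF w(1) vu x(1)] fe eg unfolding x(2) e_def by blast
      then show False using fg x(2) e_def by simp
    next
      case False
      then have "\<not> hom_int f g" using es(2) f ys_eq unfolding hom_ordered_def es_eq sorted_wrt_append by auto
      then show False using hom_int_star(2)[OF w(1) vu x(1)] fe eg unfolding w(2) x(2) e_def by blast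
    qed
  qed
  have "hom_ordered (xs @ e # ys)"
    using es(2) xs ys unfolding es_eq hom_ordered_def sorted_wrt_append by auto
  moreover have "set (xs @ e # ys) = A" using es(1) e(1) unfolding es_eq by auto
  ultimately show ?case by blast
qed

lemma nc_tree_ordered:
  assumes "nc_tree n A"
  obtains es where "set es = A" "hom_ordered es" "length es = n"
proof -
  obtain es where es: "set es = A" "hom_ordered es"
    using nc_forest_ordered[of A n] assms by (auto simp: nc_tree_def graph_is_tree_def)
  have "distinct es" using hom_ordered_distinct[OF es(2), of n] assms es(1) by (simp add: nc_tree_def)
  then have "length es = n" using distinct_card es(1) assms by (fastforce simp: nc_tree_def)
  then show ?thesis using that es by blast
qed

section \<open>Chords of a circle\<close>

text \<open>Twice the signed area of the triangle, positive if \<open>a\<close>, \<open>b\<close>,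
  \<open>c\<close> run counterclockwise.\<close>

definition orient :: "complex \<Rightarrow> complex \<Rightarrow> complex \<Rightarrow> real" where
  "orient a b c = (Re b - Re a) * (Im c - Im a) - (Im b - Im a) * (Re c - Re a)"

lemma orient_rotate: "orient a b c = orient b c a"
  by (simp add: orient_def algebra_simps)

lemma orient_swap: "orient a b c = - orient a c b"
  by (simp add: orient_def algebra_simps)

lemma orient_refl [simp]: "orient a b a = 0" "orient a b b = 0"
  by (simp_all add: orient_def)

lemma orient_affine: "orient a b ((1 - t) *\<^sub>R c + t *\<^sub>R d) = (1 - t) * orient a b c + t * orient a b d"
  by (simp add: orient_def algebra_simps)

lemma sin_add_product:
  "sin (2 * a) + sin (2 * b) - sin (2 * a + 2 * b) = 4 * sin a * sin b * sin (a + b)" for a b :: real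
proof -
  have A: "cos a * cos a = 1 - sin a * sin a" and B: "cos b * cos b = 1 - sin b * sin b"
    using sin_cos_squared_add[of a] sin_cos_squared_add[of b] by (simp_all add: power2_eq_square)
  have h: "sin (2 * a + 2 * b) = 2 * (sin a * cos b + cos a * sin b) * (cos a * cos b - sin a * sin b)"
    using sin_double[of "a + b"] unfolding sin_add[of a b] cos_add[of a b] distrib_left .
  have "sin (2 * a) + sin (2 * b) - sin (2 * a + 2 * b) =
    2 * sin a * cos a * (1 - cos b * cos b + sin b * sin b) + 2 * sin b * cos b * (1 - cos a * cos a + sin a * sin a)"
    unfolding h sin_double by (simp add: algebra_simps)
  also have "\<dots> = 4 * sin a * sin b * sin (a + b)"
    unfolding A B sin_add[of a b] by (simp add: algebra_simps)
  finally show ?thesis .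
qed

text \<open>For points on a circle the area factorises into sines of half angles, from which its
  sign can be read off.\<close>

lemma orient_circle:
  "orient (z + complex_of_real r * cis \<alpha>) (z + complex_of_real r * cis \<beta>) (z + complex_of_real r * cis \<gamma>) =
    4 * r\<^sup>2 * sin ((\<beta> - \<alpha>) / 2) * sin ((\<gamma> - \<beta>) / 2) * sin ((\<gamma> - \<alpha>) / 2)"
proof -
  have "orient (z + complex_of_real r * cis \<alpha>) (z + complex_of_real r * cis \<beta>) (z + complex_of_real r * cis \<gamma>) =
     r\<^sup>2 * (sin (\<beta> - \<alpha>) + sin (\<gamma> - \<beta>) - sin (\<gamma> - \<alpha>))"
    by (simp add: orient_def sin_diff power2_eq_square algebra_simps)
  also have "sin (\<beta> - \<alpha>) + sin (\<gamma> - \<beta>) - sin (\<gamma> - \<alpha>) =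
      4 * sin ((\<beta> - \<alpha>) / 2) * sin ((\<gamma> - \<beta>) / 2) * sin ((\<gamma> - \<alpha>) / 2)"
  proof -
    define a b where "a = (\<beta> - \<alpha>) / 2" and "b = (\<gamma> - \<beta>) / 2"
    have e: "\<beta> - \<alpha> = 2 * a" "\<gamma> - \<beta> = 2 * b" "\<gamma> - \<alpha> = 2 * a + 2 * b"
      by (simp_all add: a_def b_def field_simps)
    show ?thesis unfolding e using sin_add_product[of a b] by (simp add: add_divide_distrib)
  qed
  finally show ?thesis by simp
qed

text \<open>The barycentric dependence of four points, with the coefficients of \<open>a\<close>, \<open>c\<close> on one side.\<close>

lemma orient_dependence:
  "orient b c d *\<^sub>R a + orient a b d *\<^sub>R c = orient a c d *\<^sub>R b + orient a b c *\<^sub>R d"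
  "orient b c d + orient a b d = orient a c d + orient a b c"
  by (auto simp: complex_eq_iff orient_def algebra_simps)

locale circle_points =
  fixes z :: complex and r :: real and n :: nat and p :: "nat \<Rightarrow> complex"
  assumes ccw: "ccw_on_circle z r n p"
begin

lemma r_pos: "r > 0"
  using ccw by (simp add: ccw_on_circle_def)

lemma dist_p: "a \<le> n \<Longrightarrow> dist z (p a) = r"
  using ccw by (auto simp: ccw_on_circle_def dist_norm norm_mult)

text \<open>Half the differences of the angles lie strictly between \<open>0\<close> and
  \<open>pi\<close>, where the sine is positive.\<close>

lemma orient_pos:
  assumes "a < b" "b < c" "c \<le> n"
  shows "orient (p a) (p b) (p c) > 0"
proof -
  obtain \<theta> where \<theta>: "strict_mono_on {0..n} \<theta>" "\<theta> n < \<theta> 0 + 2 * pi"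
    "\<forall>a\<le>n. p a = z + complex_of_real r * cis (\<theta> a)"
    using ccw unfolding ccw_on_circle_def by blast
  have mono: "\<theta> x < \<theta> y" if "x < y" "y \<le> n" for x y
    using \<theta>(1) that by (auto simp: strict_mono_on_def)
  have "\<theta> 0 \<le> \<theta> a" "\<theta> c \<le> \<theta> n"
    using mono[of 0 a] mono[of c n] assms by (cases "a = 0"; cases "c = n"; force)+
  then have "\<theta> c - \<theta> a < 2 * pi" using \<theta>(2) by linarith
  moreover have "\<theta> a < \<theta> b" "\<theta> b < \<theta> c" using mono assms by auto
  ultimately have "sin ((\<theta> b - \<theta> a) / 2) > 0" "sin ((\<theta> c - \<theta> b) / 2) > 0" "sin ((\<theta> c - \<theta> a) / 2) > 0"
    by (intro sin_gt_zero; simp)+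
  moreover have "p a = z + complex_of_real r * cis (\<theta> a)" "p b = z + complex_of_real r * cis (\<theta> b)"
    "p c = z + complex_of_real r * cis (\<theta> c)" using \<theta>(3) assms by auto
  ultimately show ?thesis using r_pos by (simp add: orient_circle)
qed

text \<open>There may be no third point to which \<open>orient_pos\<close> could be applied, so the
  angles are compared directly: the cosine is not \<open>1\<close> strictly between \<open>0\<close>
  and \<open>2 * pi\<close>.\<close>

lemma p_inj: "a \<le> n \<Longrightarrow> b \<le> n \<Longrightarrow> p a = p b \<Longrightarrow> a = b"
proof -
  have "p a \<noteq> p b" if "a < b" "b \<le> n" for a b
  proof
    assume eq: "p a = p b"
    obtain \<theta> where \<theta>: "strict_mono_on {0..n} \<theta>" "\<theta> n < \<theta> 0 + 2 * pi"
      "\<forall>a\<le>n. p a = z + complex_of_real r * cis (\<theta> a)"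
      using ccw unfolding ccw_on_circle_def by blast
    have mono: "\<theta> x < \<theta> y" if "x < y" "y \<le> n" for x y
      using \<theta>(1) that by (auto simp: strict_mono_on_def)
    have "\<theta> 0 \<le> \<theta> a" "\<theta> b \<le> \<theta> n"
      using mono[of 0 a] mono[of b n] that by (cases "a = 0"; cases "b = n"; force)+
    then have lt: "0 < \<theta> b - \<theta> a" "\<theta> b - \<theta> a < 2 * pi" using \<theta>(2) mono[OF that] by linarith+
    have "cis (\<theta> a) = cis (\<theta> b)" using eq \<theta>(3) that r_pos by simp
    then have "cis (\<theta> b - \<theta> a) = 1" using cis_divide[of "\<theta> b" "\<theta> a"] by simp
    then have "cos (\<theta> b - \<theta> a) = 1" by (simp add: complex_eq_iff)
    moreover define h where "h = (\<theta> b - \<theta> a) / 2"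
    then have "\<theta> b - \<theta> a = 2 * h" by simp
    moreover have "sin h > 0" using lt by (intro sin_gt_zero) (auto simp: h_def)
    moreover have "cos (2 * h) = 1 - 2 * sin h ^ 2" by (rule cos_double_sin)
    ultimately show False by simp
  qed
  then show "a \<le> n \<Longrightarrow> b \<le> n \<Longrightarrow> p a = p b \<Longrightarrow> a = b" by (metis linorder_neqE_nat)
qed

lemma chord_eq_iff:
  assumes "i \<le> n" "j \<le> n" "k \<le> n" "l \<le> n"
  shows "chord p i j = chord p k l \<longleftrightarrow> {i, j} = {k, l}"
  using assms p_inj by (auto simp: chord_def closed_segment_eq doubleton_eq_iff)

lemma orient_side:
  assumes "i < j" "j \<le> n" "k \<le> n"
  shows "i < k \<Longrightarrow> k < j \<Longrightarrow> orient (p i) (p j) (p k) < 0"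
    "k < i \<or> j < k \<Longrightarrow> orient (p i) (p j) (p k) > 0"
proof -
  show "orient (p i) (p j) (p k) < 0" if "i < k" "k < j"
    using orient_pos[of i k j] that assms orient_swap[of "p i" "p j" "p k"] by simp
  show "orient (p i) (p j) (p k) > 0" if "k < i \<or> j < k"
    using orient_pos[of i j k] orient_pos[of k i j] that assms orient_rotate[of "p k" "p i" "p j"] by auto
qed

text \<open>All four coefficients in \<open>orient_dependence\<close> are positive for points in
  cyclic order, so after division by their common sum \<open>s\<close> both sides are the same
  point, inner to both chords.\<close>

lemma crossing_chords_meet:
  assumes "a < b" "b < c" "c < d" "d \<le> n"
  shows "chord p a c \<inter> chord p b d \<inter> ball z r \<noteq> {}"
proof -
  let ?A = "orient (p b) (p c) (p d)" and ?C = "orient (p a) (p b) (p d)"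
    and ?B = "orient (p a) (p c) (p d)" and ?D = "orient (p a) (p b) (p c)"
  have pos: "?A > 0" "?B > 0" "?C > 0" "?D > 0" using assms by (auto intro!: orient_pos)
  define s where "s = ?A + ?C"
  have s: "s > 0" "s = ?B + ?D" using pos orient_dependence(2) by (auto simp: s_def)
  define x where "x = (1 - ?C / s) *\<^sub>R p a + (?C / s) *\<^sub>R p c"
  have t: "0 < ?C / s" "?C / s < 1" "0 < ?D / s" "?D / s < 1" using pos s by (auto simp: s_def)
  have A: "1 - ?C / s = ?A / s" and B: "1 - ?D / s = ?B / s" using s by (auto simp: field_simps s_def)
  have "x = (1 / s) *\<^sub>R (?A *\<^sub>R p a + ?C *\<^sub>R p c)" unfolding x_def A by (simp add: scaleR_add_right)
  also have "\<dots> = (1 / s) *\<^sub>R (?B *\<^sub>R p b + ?D *\<^sub>R p d)" unfolding orient_dependence(1) ..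
  also have "\<dots> = (1 - ?D / s) *\<^sub>R p b + (?D / s) *\<^sub>R p d" unfolding B by (simp add: scaleR_add_right)
  finally have x2: "x = (1 - ?D / s) *\<^sub>R p b + (?D / s) *\<^sub>R p d" .
  have "p a \<noteq> p c" using p_inj[of a c] assms by auto
  then have "x \<in> open_segment (p a) (p c)" unfolding in_segment x_def using t by blast
  \<comment> \<open>An inner point of a segment is closer to \<open>z\<close> than one of the end
    points, which both have distance \<open>r\<close>; so \<open>x\<close> lies in the open
    disc.\<close>
  then have "x \<in> closed_segment (p a) (p c)" "dist z x < dist z (p a) \<or> dist z x < dist z (p c)"
    using open_closed_segment dist_decreases_open_segment[of x "p a" "p c"] by auto
  moreover have "x \<in> closed_segment (p b) (p d)" unfolding in_segment x2 using t by (intro exI[of _ "?D / s"]) auto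
  ultimately show ?thesis using dist_p[of a] dist_p[of c] assms by (auto simp: chord_def)
qed

text \<open>For distinct non-crossing chords \<open>p k\<close> and \<open>p l\<close> lie on the
  same closed side of the line through \<open>p i\<close> and \<open>p j\<close>, not both on the
  line. So a point strictly between them is off that line.\<close>

lemma noncrossing_chords_disjoint:
  assumes ij: "i < j" "j \<le> n" and kl: "k < l" "l \<le> n" and nc: "\<not> crossing (i, j) (k, l)" and ne: "(i, j) \<noteq> (k, l)"
  shows "chord p i j \<inter> chord p k l \<inter> ball z r = {}"
proof (rule ccontr)
  assume "\<not> ?thesis"
  then obtain x where x: "x \<in> chord p i j" "x \<in> chord p k l" "x \<in> ball z r" by blast
  let ?g = "orient (p i) (p j)"
  obtain s where s: "0 \<le> s" "s \<le> 1" "x = (1 - s) *\<^sub>R p i + s *\<^sub>R p j"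
    using x(1) by (auto simp: chord_def in_segment)
  obtain t where t: "0 \<le> t" "t \<le> 1" "x = (1 - t) *\<^sub>R p k + t *\<^sub>R p l"
    using x(2) by (auto simp: chord_def in_segment)
  have "?g x = 0" unfolding s(3) orient_affine by simp
  then have g: "(1 - t) * ?g (p k) + t * ?g (p l) = 0" unfolding t(3) orient_affine .
  \<comment> \<open>End points lie on the circle, hence outside the open disc; the parameter
    \<open>t\<close> is therefore strictly between \<open>0\<close> and \<open>1\<close>.\<close>
  have "x \<noteq> p k" "x \<noteq> p l" using x(3) dist_p[of k] dist_p[of l] kl by auto
  then have t': "0 < t" "t < 1" using t by (auto simp: order_less_le)
  note side_k = orient_side[OF ij, of k] and side_l = orient_side[OF ij, of l]
  have pp: "(1 - t) * u + t * v > 0" if "u > 0 \<and> v \<ge> 0 \<or> u \<ge> 0 \<and> v > 0" for u v :: real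
    using that t' by (auto intro: add_pos_nonneg add_nonneg_pos)
  have nn: "(1 - t) * u + t * v < 0" if "u < 0 \<and> v \<le> 0 \<or> u \<le> 0 \<and> v < 0" for u v :: real
    using pp[of "- u" "- v"] that by auto
  have z: "?g (p i) = 0" "?g (p j) = 0" by simp_all
  consider "k < i \<or> j < k" "l < i \<or> j < l" | "k < i \<or> j < k" "l = i \<or> l = j" | "k = i \<or> k = j" "l < i \<or> j < l"
    | "i < k \<and> k < j" "i < l \<and> l < j" | "i < k \<and> k < j" "l = i \<or> l = j" | "k = i \<or> k = j" "i < l \<and> l < j"
    using ij kl nc ne by (auto simp: crossing_def) linarith+
  then show False
  proof cases
    case 1 then show False using side_k(2) side_l(2) pp g kl by fastforce
  next
    case 2 then show False using side_k(2) pp g kl z by fastforce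
  next
    case 3 then show False using side_l(2) pp g kl z by fastforce
  next
    case 4 then show False using side_k(1) side_l(1) nn g kl by fastforce
  next
    case 5 then show False using side_k(1) nn g kl z by fastforce
  next
    case 6 then show False using side_l(1) nn g kl z by fastforce
  qed
qed

lemma chords_meet_iff:
  assumes e: "(i, j) \<in> intervals n" "(k, l) \<in> intervals n" and ne: "(i, j) \<noteq> (k, l)"
  shows "chord p i j \<inter> chord p k l \<inter> ball z r = {} \<longleftrightarrow> \<not> crossing (i, j) (k, l)"
proof
  assume empty: "chord p i j \<inter> chord p k l \<inter> ball z r = {}"
  show "\<not> crossing (i, j) (k, l)"
  proof
    assume "crossing (i, j) (k, l)"
    then consider "i < k" "k < j" "j < l" | "k < i" "i < l" "l < j" by (auto simp: crossing_def)
    then show False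
      using crossing_chords_meet[of i k j l] crossing_chords_meet[of k i l j] empty e
      by cases (auto simp: intervals_def Int_ac)
  qed
next
  show "chord p i j \<inter> chord p k l \<inter> ball z r = {}" if "\<not> crossing (i, j) (k, l)"
    using noncrossing_chords_disjoint[OF _ _ _ _ that ne] e by (auto simp: intervals_def)
qed

section \<open>From sets of intervals to sets of chords and back\<close>

definition chord_set :: "(nat \<times> nat) set \<Rightarrow> complex set set" where
  "chord_set A = (\<lambda>(i, j). chord p i j) ` A"

lemma chord_setI: "(i, j) \<in> A \<Longrightarrow> chord p i j \<in> chord_set A"
  unfolding chord_set_def by (rule image_eqI[of _ _ "(i, j)"]) simp_all

lemma chord_commute: "chord p i j = chord p j i"
  by (simp add: chord_def closed_segment_commute)

lemma chord_inj_on: "inj_on (\<lambda>(i, j). chord p i j) (intervals n)"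
  by (auto simp: inj_on_def intervals_def chord_eq_iff doubleton_eq_iff)

lemma chord_set_inj:
  assumes "A \<subseteq> intervals n" "B \<subseteq> intervals n" "chord_set A = chord_set B"
  shows "A = B"
  using inj_on_image_eq_iff[OF chord_inj_on assms(1,2)] assms(3) by (simp add: chord_set_def)

lemma chord_mem_iff:
  assumes "A \<subseteq> intervals n" "(i, j) \<in> intervals n"
  shows "chord p i j \<in> chord_set A \<longleftrightarrow> (i, j) \<in> A"
  using inj_on_image_mem_iff[OF chord_inj_on assms(2,1)] by (simp add: chord_set_def)

lemma chord_adj_eq:
  assumes A: "A \<subseteq> intervals n"
  shows "chord_adj n p (chord_set A) = adj A"
proof -
  have "(u, v) \<in> chord_adj n p (chord_set A) \<longleftrightarrow> (u, v) \<in> adj A" for u v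
  proof (cases "u \<le> n \<and> v \<le> n \<and> u \<noteq> v")
    case False
    then show ?thesis using A by (auto simp: chord_adj_def adj_iff intervals_def)
  next
    case True
    have "(v, u) \<in> A \<Longrightarrow> v < u" "(u, v) \<in> A \<Longrightarrow> u < v" using A by (auto simp: intervals_def)
    then consider "(u, v) \<in> intervals n" "(v, u) \<notin> A" | "(v, u) \<in> intervals n" "(u, v) \<notin> A"
      using True by (cases "u < v") (auto simp: intervals_def)
    then show ?thesis
      using True chord_mem_iff[OF A, of u v] chord_mem_iff[OF A, of v u] chord_commute[of u v]
      by cases (simp_all add: chord_adj_def adj_iff)
  qed
  then show ?thesis by auto
qed

lemma nc_tree_chord_set:
  assumes A: "A \<subseteq> intervals n"
  shows "chord_set A \<in> noncrossing_spanning_trees z r n p \<longleftrightarrow> nc_tree n A"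
proof -
  have "chord_set A \<subseteq> chords n p"
    using A by (force simp: chord_set_def chords_def intervals_def)
  moreover have "card (chord_set A) = card A"
    unfolding chord_set_def using card_image inj_on_subset[OF chord_inj_on A] by blast
  moreover have "(\<forall>C\<in>chord_set A. \<forall>C'\<in>chord_set A. C \<noteq> C' \<longrightarrow> C \<inter> C' \<inter> ball z r = {}) \<longleftrightarrow>
      (\<forall>e\<in>A. \<forall>f\<in>A. \<not> crossing e f)"
  proof -
    let ?ch = "\<lambda>(i, j). chord p i j"
    have "(?ch e \<noteq> ?ch f \<longrightarrow> ?ch e \<inter> ?ch f \<inter> ball z r = {}) \<longleftrightarrow> \<not> crossing e f"
      if ef: "e \<in> A" "f \<in> A" for e f
    proof (cases "e = f")
      case True
      then show ?thesis by (auto simp: crossing_def)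
    next
      case False
      obtain i j k l where *: "e = (i, j)" "f = (k, l)" by (cases e; cases f)
      have "?ch e \<noteq> ?ch f" using inj_onD[OF chord_inj_on, of e f] False ef A by auto
      then show ?thesis
        using chords_meet_iff[of i j k l] False ef A by (auto simp: *)
    qed
    then show ?thesis by (simp add: chord_set_def)
  qed
  ultimately show ?thesis
    unfolding noncrossing_spanning_trees_def nc_tree_def using A chord_adj_eq[OF A] by simp
qed

lemma noncrossing_tree_cases:
  assumes "T \<in> noncrossing_spanning_trees z r n p"
  obtains A where "A \<subseteq> intervals n" "T = chord_set A" "nc_tree n A"
proof -
  define A where "A = {(i, j) \<in> intervals n. chord p i j \<in> T}"
  have A: "A \<subseteq> intervals n" by (auto simp: A_def)
  have "T \<subseteq> chords n p" using assms by (simp add: noncrossing_spanning_trees_def)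
  then have "T = chord_set A"
  proof (intro equalityI subsetI)
    fix C assume C: "C \<in> T"
    then obtain i j where ij: "i \<le> n" "j \<le> n" "i \<noteq> j" "C = chord p i j"
      using \<open>T \<subseteq> chords n p\<close> by (auto simp: chords_def)
    then have "(i, j) \<in> A \<or> (j, i) \<in> A"
      using C chord_commute[of i j] by (auto simp: A_def intervals_def)
    then show "C \<in> chord_set A" using ij(4) chord_commute[of i j] chord_setI by metis
  qed (auto simp: chord_set_def A_def)
  then show ?thesis using that A nc_tree_chord_set[OF A] assms by blast
qed

end

section \<open>Exceptional sequences and trees\<close>

text \<open>\<open>X\<^sub>i\<^sub>,\<^sub>j\<close> is the unique indecomposable module, up to shift, isomorphic to the exceptional object \<open>E\<close>.\<close>

definition interval_of :: "nat \<Rightarrow> 'k::field cpx \<Rightarrow> nat \<times> nat" where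
  "interval_of n E = (THE e. \<exists>i j l q. e = (i, j) \<and> i < j \<and> j \<le> n \<and> qis n (Pcx i j l) E q)"

lemma interval_of_eq:
  assumes "i < j" "j \<le> n" "qis n (Pcx i j l) E q"
  shows "interval_of n E = (i, j)"
  unfolding interval_of_def
proof (rule the_equality)
  show "\<exists>i' j' l q. (i, j) = (i', j') \<and> i' < j' \<and> j' \<le> n \<and> qis n (Pcx i' j' l) E q"
    using assms by blast
  fix e assume "\<exists>i j l q. e = (i, j) \<and> i < j \<and> j \<le> n \<and> qis n (Pcx i j l) E q"
  then show "e = (i, j)" using qis_Pcx_unique[OF assms(1,2) _ _ assms(3)] by blast
qed

lemma exceptional_interval_of:
  assumes "exceptional n (E :: 'k::field cpx)"
  obtains i j l q where "interval_of n E = (i, j)" "i < j" "j \<le> n" "qis n (Pcx i j l) E q"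
  using exceptional_qis_Pcx[OF assms] interval_of_eq by metis

lemma interval_of_in:
  assumes "exceptional n (E :: 'k::field cpx)"
  shows "interval_of n E \<in> intervals n"
  using exceptional_interval_of[OF assms] by (metis (no_types, lifting) intervals_def case_prodI mem_Collect_eq)

lemma D_iso_shift_interval_of:
  assumes E: "exceptional n (E :: 'k::field cpx)" and E': "exceptional n E'"
  shows "(\<exists>s. D_iso n E (shift s E')) \<longleftrightarrow> interval_of n E = interval_of n E'"
proof -
  obtain i j l q where ij: "interval_of n E = (i, j)" "i < j" "j \<le> n" "qis n (Pcx i j l) E q"
    using exceptional_interval_of[OF E] .
  obtain i' j' l' q' where ij': "interval_of n E' = (i', j')" "i' < j'" "j' \<le> n" "qis n (Pcx i' j' l') E' q'"
    using exceptional_interval_of[OF E'] .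
  have c: "is_cpx n E" "is_cpx n (shift s E')" for s
    using E E' is_cpx_shift by (auto simp: exceptional_def)
  have K: "kproj n (Pcx i' j' m :: 'k cpx)" for m by (rule kproj_Pcx) (use ij' in auto)
  show ?thesis
  proof
    assume "\<exists>s. D_iso n E (shift s E')"
    then obtain s where s: "roof_iso n E (shift s E')" using D_iso_iff_roof_iso[OF c] by blast
    obtain q1 where "qis n (Pcx i' j' (l' - s)) (shift s E') q1" using qis_Pcx_shift[OF ij'(2-4)] by blast
    then obtain q2 where "qis n (Pcx i' j' (l' - s)) E q2"
      using kproj_roof_iso[OF K roof_iso_sym[OF s]] by blast
    then show "interval_of n E = interval_of n E'" using interval_of_eq[OF ij'(2,3)] ij'(1) by metis
  next
    assume "interval_of n E = interval_of n E'"
    then have "i' = i" "j' = j" using ij(1) ij'(1) by auto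
    \<comment> \<open>The shift by \<open>l' - l\<close> moves the cohomology of \<open>E'\<close>
      from degree \<open>l'\<close> to the degree \<open>l\<close> of \<open>E\<close>.\<close>
    then obtain q1 where "qis n (Pcx i j l) (shift (l' - l) E') q1"
      using qis_Pcx_shift[OF ij'(2-4), of "l' - l"] by auto
    then have "roof_iso n E (shift (l' - l) E')" using ij(4) unfolding roof_iso_def by blast
    then show "\<exists>s. D_iso n E (shift s E')" using D_iso_iff_roof_iso[OF c] by blast
  qed
qed

text \<open>As the right-hand side is an equation for \<open>C\<close>, every exceptional object has
  exactly one chord, which justifies the definite description in \<open>Phi\<close>.\<close>

lemma is_Phi_iff:
  assumes E: "exceptional n (E :: 'k::field cpx)"
  shows "is_Phi n p E C \<longleftrightarrow> C = (\<lambda>(i, j). chord p i j) (interval_of n E)"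
proof -
  obtain a b m q where ab: "interval_of n E = (a, b)" "a < b" "b \<le> n" "qis n (Pcx a b m) E q"
    using exceptional_interval_of[OF E] .
  have Ec: "is_cpx n E" using E by (simp add: exceptional_def)
  have iff: "D_iso n E (shift l (stalk (X_rep i j))) \<longleftrightarrow> (\<exists>q. qis n (Pcx i j (- l)) E q)" if "i < j" "j \<le> n" for i j l
    using D_iso_iff_roof_iso[OF Ec is_cpx_Xcx[OF that(2), where i = i and l = "- l"]]
      roof_iso_Xcx_iff[OF that, where E = E and l = "- l"] by simp
  show ?thesis
  proof
    assume "is_Phi n p E C"
    then obtain i j l where *: "i < j" "j \<le> n" "D_iso n E (shift l (stalk (X_rep i j)))" "C = chord p i j"
      unfolding is_Phi_def by blast
    then have "interval_of n E = (i, j)" using iff[OF *(1,2)] interval_of_eq[OF *(1,2)] by blast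
    then show "C = (\<lambda>(i, j). chord p i j) (interval_of n E)" using *(4) by simp
  next
    assume "C = (\<lambda>(i, j). chord p i j) (interval_of n E)"
    then have "C = chord p a b" using ab(1) by simp
    moreover have "D_iso n E (shift (- m) (stalk (X_rep a b)))" using iff[OF ab(2,3), of "- m"] ab(4) by auto
    ultimately show "is_Phi n p E C" unfolding is_Phi_def using ab(2,3) by blast
  qed
qed

lemma exceptional_pair_iff:
  assumes E: "exceptional n (E :: 'k::field cpx)" and F: "exceptional n F"
  shows "exceptional_pair n E F \<longleftrightarrow> \<not> hom_int (interval_of n F) (interval_of n E)"
proof -
  obtain i j l q where ij: "interval_of n E = (i, j)" "i < j" "j \<le> n" "qis n (Pcx i j l) E q"
    using exceptional_interval_of[OF E] .
  obtain i' j' l' q' where ij': "interval_of n F = (i', j')" "i' < j'" "j' \<le> n" "qis n (Pcx i' j' l') F q'"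
    using exceptional_interval_of[OF F] .
  show ?thesis
    using all_D_hom_is_zero_iff[OF ij'(2,3) ij(2,3) ij'(4) ij(4)] E F ij(1) ij'(1)
    by (simp add: exceptional_pair_def)
qed

lemma exceptional_seq_iff:
  "exceptional_seq n (Es :: 'k::field cpx list) \<longleftrightarrow>
     (\<forall>E\<in>set Es. exceptional n E) \<and> hom_ordered (map (interval_of n) Es)"
proof (cases "\<forall>E\<in>set Es. exceptional n E")
  case True
  then have "exceptional_pair n (Es ! i) (Es ! j) \<longleftrightarrow> \<not> hom_int (interval_of n (Es ! j)) (interval_of n (Es ! i))"
    if "i < j" "j < length Es" for i j
    using exceptional_pair_iff that by (metis nth_mem order.strict_trans)
  then show ?thesis using True
    unfolding exceptional_seq_def hom_ordered_def sorted_wrt_map sorted_wrt_iff_nth_less by auto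
next
  case False
  then show ?thesis by (auto simp: exceptional_seq_def)
qed

lemma complete_exceptional_seqsD:
  assumes "Es \<in> complete_exceptional_seqs n"
  shows "E \<in> set Es \<Longrightarrow> exceptional n (E :: 'k::field cpx)"
    and "length Es = n" "distinct (map (interval_of n) Es)"
    and "nc_tree n (set (map (interval_of n) Es))"
proof -
  have es: "\<forall>E\<in>set Es. exceptional n E" "hom_ordered (map (interval_of n) Es)" and len: "length Es = n"
    using assms by (auto simp: complete_exceptional_seqs_def exceptional_seq_iff)
  show "E \<in> set Es \<Longrightarrow> exceptional n E" "length Es = n" using es len by auto
  have sub: "set (map (interval_of n) Es) \<subseteq> intervals n" using es(1) by (simp add: image_subset_iff interval_of_in)
  show "distinct (map (interval_of n) Es)" using hom_ordered_distinct[OF es(2) sub] .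
  show "nc_tree n (set (map (interval_of n) Es))" using hom_ordered_nc_tree[OF es(2) sub] len by simp
qed

lemma permutation_of_same_set:
  assumes "distinct xs" "distinct ys" "set xs = set ys"
  obtains \<sigma> where "\<sigma> permutes {..<length xs}" "\<And>i. i < length xs \<Longrightarrow> xs ! i = ys ! \<sigma> i"
proof -
  have "mset xs = mset ys" using assms set_eq_iff_mset_eq_distinct by blast
  then obtain \<sigma> where \<sigma>: "\<sigma> permutes {..<length ys}" "permute_list \<sigma> ys = xs"
    by (rule mset_eq_permutation)
  then show ?thesis using that[of \<sigma>] permute_list_nth[OF \<sigma>(1)] by (metis length_permute_list)
qed

text \<open>The intervals in a complete exceptional sequence are distinct, so equality of the sets
  of intervals already gives a permutation; the shifts are then chosen entry by entry.\<close>

lemma exceptional_seq_rel_iff: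
  "(Es, Es') \<in> exceptional_seq_rel n \<longleftrightarrow>
     Es \<in> complete_exceptional_seqs n \<and> Es' \<in> complete_exceptional_seqs n \<and>
     interval_of n ` set Es = interval_of n ` set (Es' :: 'k::field cpx list)"
proof (cases "Es \<in> complete_exceptional_seqs n \<and> Es' \<in> complete_exceptional_seqs n")
  case False
  then show ?thesis by (auto simp: exceptional_seq_rel_def)
next
  case True
  note D = complete_exceptional_seqsD[OF conjunct1[OF True]]
  note D' = complete_exceptional_seqsD[OF conjunct2[OF True]]
  have iso: "(\<exists>s. D_iso n (Es ! i) (shift s (Es' ! j))) \<longleftrightarrow> interval_of n (Es ! i) = interval_of n (Es' ! j)"
    if "i < n" "j < n" for i j
    using D_iso_shift_interval_of D(1) D'(1) that D(2) D'(2) by (metis nth_mem)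
  have "(\<exists>\<sigma> (l :: nat \<Rightarrow> int). \<sigma> permutes {..<n} \<and> (\<forall>i<n. D_iso n (Es ! i) (shift (l i) (Es' ! \<sigma> i)))) \<longleftrightarrow>
    (\<exists>\<sigma>. \<sigma> permutes {..<n} \<and> (\<forall>i<n. interval_of n (Es ! i) = interval_of n (Es' ! \<sigma> i)))" (is "?L \<longleftrightarrow> ?R")
  proof
    assume ?L
    then obtain \<sigma> l where \<sigma>: "\<sigma> permutes {..<n}" "\<forall>i<n. D_iso n (Es ! i) (shift (l i) (Es' ! \<sigma> i))" by blast
    have "interval_of n (Es ! i) = interval_of n (Es' ! \<sigma> i)" if "i < n" for i
      using iso[OF that, of "\<sigma> i"] \<sigma> that permutes_in_image[OF \<sigma>(1), of i] by auto
    then show ?R using \<sigma>(1) by blast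
  next
    assume ?R
    then obtain \<sigma> where \<sigma>: "\<sigma> permutes {..<n}" "\<forall>i<n. interval_of n (Es ! i) = interval_of n (Es' ! \<sigma> i)" by blast
    have "\<exists>s. D_iso n (Es ! i) (shift s (Es' ! \<sigma> i))" if "i < n" for i
      using iso[OF that, of "\<sigma> i"] \<sigma> that permutes_in_image[OF \<sigma>(1), of i] by auto
    then obtain l where "\<forall>i<n. D_iso n (Es ! i) (shift (l i) (Es' ! \<sigma> i))" by metis
    then show ?L using \<sigma>(1) by blast
  qed
  also have "?R \<longleftrightarrow> interval_of n ` set Es = interval_of n ` set Es'"
  proof
    assume ?R
    then obtain \<sigma> where \<sigma>: "\<sigma> permutes {..<n}" "\<forall>i<n. interval_of n (Es ! i) = interval_of n (Es' ! \<sigma> i)" by blast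
    have "interval_of n ` set Es = (\<lambda>i. interval_of n (Es ! i)) ` {..<n}"
      using D(2) by (force simp: in_set_conv_nth image_iff)
    also have "\<dots> = (\<lambda>i. interval_of n (Es' ! i)) ` \<sigma> ` {..<n}"
      unfolding image_image using \<sigma>(2) by (intro image_cong) auto
    also have "\<sigma> ` {..<n} = {..<n}" using permutes_image[OF \<sigma>(1)] .
    also have "(\<lambda>i. interval_of n (Es' ! i)) ` {..<n} = interval_of n ` set Es'"
      using D'(2) by (force simp: in_set_conv_nth image_iff)
    finally show "interval_of n ` set Es = interval_of n ` set Es'" .
  next
    assume "interval_of n ` set Es = interval_of n ` set Es'"
    then have "set (map (interval_of n) Es) = set (map (interval_of n) Es')" by simp
    then obtain \<sigma> where \<sigma>: "\<sigma> permutes {..<length (map (interval_of n) Es)}"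
      "\<And>i. i < length (map (interval_of n) Es) \<Longrightarrow> map (interval_of n) Es ! i = map (interval_of n) Es' ! \<sigma> i"
      using permutation_of_same_set[OF D(3) D'(3)] by blast
    have \<sigma>n: "\<sigma> permutes {..<n}" using \<sigma>(1) D(2) by simp
    have "interval_of n (Es ! i) = interval_of n (Es' ! \<sigma> i)" if "i < n" for i
      using \<sigma>(2)[of i] that D(2) D'(2) permutes_in_image[OF \<sigma>n, of i] by simp
    then show ?R using \<sigma>n by blast
  qed
  finally show ?thesis using True by (simp add: exceptional_seq_rel_def)
qed

text \<open>The modules of the intervals are placed in degree \<open>0\<close>, in the order
  obtained from \<open>nc_tree_ordered\<close>.\<close>

lemma nc_tree_exceptional_seq:
  assumes "nc_tree n A"
  obtains Es :: "'k::field cpx list" where "Es \<in> complete_exceptional_seqs n" "interval_of n ` set Es = A"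
proof -
  obtain es where es: "set es = A" "hom_ordered es" "length es = n" using nc_tree_ordered[OF assms] .
  let ?X = "\<lambda>(i, j). Xcx i j 0 :: 'k cpx"
  have X: "exceptional n (?X e) \<and> interval_of n (?X e) = e" if "e \<in> set es" for e
  proof -
    obtain i j where e: "e = (i, j)" by (cases e)
    have ij: "i < j" "j \<le> n" using that e es(1) assms by (auto simp: nc_tree_def intervals_def)
    obtain q where "qis n (Pcx i j 0) (Xcx i j 0 :: 'k cpx) q" using qis_Pcx_Xcx[OF ij] by blast
    then show ?thesis using exceptional_Xcx[OF ij, of 0] interval_of_eq[OF ij] e by auto
  qed
  have "map (interval_of n) (map ?X es) = es"
    unfolding map_map using X by (intro map_idI) simp
  then have "map ?X es \<in> complete_exceptional_seqs n"
    using X es(2,3) unfolding complete_exceptional_seqs_def exceptional_seq_iff by auto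
  moreover have "interval_of n ` set (map ?X es) = A" using X es(1) by (force simp: image_iff)
  ultimately show ?thesis using that by blast
qed

lemma Phi_eq:
  assumes "exceptional n (E :: 'k::field cpx)"
  shows "Phi n p E = (\<lambda>(i, j). chord p i j) (interval_of n E)"
  unfolding Phi_def is_Phi_iff[OF assms] by simp

theorem theorem2p5:
  fixes n :: nat and z :: complex and r :: real and p :: "nat \<Rightarrow> complex"
  assumes "n \<ge> 1"
    and "ccw_on_circle z r n p"
  defines "\<E> \<equiv> (complete_exceptional_seqs n :: 'k::field cpx list set)"
    and "R \<equiv> (exceptional_seq_rel n :: 'k cpx list rel)"
  shows "equiv \<E> R
    \<and> (\<forall>Es \<in> \<E>. \<forall>E \<in> set Es. \<exists>!C. is_Phi n p E C)
    \<and> (\<forall>(Es, Es') \<in> R. Phi_seq n p Es = Phi_seq n p Es')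
    \<and> (\<exists>F. (\<forall>Es \<in> \<E>. F (R `` {Es}) = Phi_seq n p Es)
         \<and> bij_betw F (\<E> // R) (noncrossing_spanning_trees z r n p))"
proof -
  interpret circle_points z r n p by unfold_locales (rule assms(2))
  let ?I = "\<lambda>Es. interval_of n ` set Es"
  have R_iff: "(Es, Es') \<in> R \<longleftrightarrow> Es \<in> \<E> \<and> Es' \<in> \<E> \<and> ?I Es = ?I Es'" for Es Es'
    unfolding R_def \<E>_def by (rule exceptional_seq_rel_iff)
  have tree: "nc_tree n (?I Es)" and sub: "?I Es \<subseteq> intervals n" if "Es \<in> \<E>" for Es
    using complete_exceptional_seqsD(4)[of Es n] that by (auto simp: \<E>_def nc_tree_def)
  have Phi: "Phi_seq n p Es = chord_set (?I Es)" if "Es \<in> \<E>" for Es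
  proof -
    have "Phi_seq n p Es = (\<lambda>E. (\<lambda>(i, j). chord p i j) (interval_of n E)) ` set Es"
      unfolding Phi_seq_def
      by (intro image_cong refl Phi_eq complete_exceptional_seqsD(1)[OF that[unfolded \<E>_def]])
    then show ?thesis by (simp add: chord_set_def image_image)
  qed
  have eq: "equiv \<E> R"
    by (rule equivI) (auto simp: refl_on_def sym_def trans_def R_iff)
  have ex1: "\<forall>Es \<in> \<E>. \<forall>E \<in> set Es. \<exists>!C. is_Phi n p E C"
  proof (intro ballI)
    fix Es E assume "Es \<in> \<E>" "E \<in> set Es"
    then have "exceptional n E" unfolding \<E>_def by (rule complete_exceptional_seqsD(1))
    then show "\<exists>!C. is_Phi n p E C" by (simp add: is_Phi_iff)
  qed
  have resp: "\<forall>(Es, Es') \<in> R. Phi_seq n p Es = Phi_seq n p Es'"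
    using Phi by (auto simp: R_iff)
  \<comment> \<open>\<open>F\<close> evaluates an arbitrary member of the class; by
    \<open>resp\<close> the value does not depend on the choice.\<close>
  define F where "F c = Phi_seq n p (SOME Es. Es \<in> c)" for c :: "'k cpx list set"
  have F: "F (R `` {Es}) = Phi_seq n p Es" if "Es \<in> \<E>" for Es
  proof -
    have "Es \<in> R `` {Es}" using equiv_class_self[OF eq that] .
    then have "(SOME Es'. Es' \<in> R `` {Es}) \<in> R `` {Es}" by (rule someI)
    then show ?thesis using resp unfolding F_def by fastforce
  qed
  have "bij_betw F (\<E> // R) (noncrossing_spanning_trees z r n p)"
    unfolding bij_betw_def
  proof
    show "inj_on F (\<E> // R)"
    proof (rule inj_onI)
      fix c d assume "c \<in> \<E> // R" "d \<in> \<E> // R" and cd: "F c = F d"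
      then obtain Es Es' where E: "Es \<in> \<E>" "c = R `` {Es}" and E': "Es' \<in> \<E>" "d = R `` {Es'}"
        by (auto elim!: quotientE)
      have "chord_set (?I Es) = chord_set (?I Es')" using cd E E' F Phi by simp
      then have "?I Es = ?I Es'" using chord_set_inj[OF sub[OF E(1)] sub[OF E'(1)]] by blast
      then have "(Es, Es') \<in> R" using E(1) E'(1) R_iff by blast
      then show "c = d" unfolding E(2) E'(2) by (rule equiv_class_eq[OF eq])
    qed
    show "F ` (\<E> // R) = noncrossing_spanning_trees z r n p"
    proof (intro equalityI subsetI)
      fix T assume "T \<in> F ` (\<E> // R)"
      then obtain Es where Es: "Es \<in> \<E>" "T = Phi_seq n p Es" using F by (auto elim!: quotientE)
      then show "T \<in> noncrossing_spanning_trees z r n p"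
        using nc_tree_chord_set[OF sub[OF Es(1)]] tree[OF Es(1)] Phi by simp
    next
      fix T assume "T \<in> noncrossing_spanning_trees z r n p"
      then obtain A where A: "A \<subseteq> intervals n" "T = chord_set A" "nc_tree n A" by (rule noncrossing_tree_cases)
      obtain Es :: "'k cpx list" where Es: "Es \<in> complete_exceptional_seqs n" "?I Es = A"
        using nc_tree_exceptional_seq[OF A(3)] .
      then have "Es \<in> \<E>" by (simp add: \<E>_def)
      then have "T = F (R `` {Es})" "R `` {Es} \<in> \<E> // R" using F Phi A(2) Es(2) by (auto intro: quotientI)
      then show "T \<in> F ` (\<E> // R)" by blast
    qed
  qed
  moreover have "\<forall>Es \<in> \<E>. F (R `` {Es}) = Phi_seq n p Es" using F by (intro ballI)
  ultimately show ?thesis by (intro conjI exI[of _ F] eq ex1 resp)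
qed

end
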